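(* Let $\mathcal{L}$ be a finite-dimensional complex vector space and let $X\subset\mathbb{P}\mathcal{L}$ be an irreducible curve of degree $>1$ with vanishing ideal $\mathcal{I}(X)$ and dual variety $X^\vee\subset\mathbb{P}\mathcal{L}^\ast$. Let $F$ be any homogeneous polynomial on $\mathcal{L}$ of positive degree not vanishing identically on $X$. Then $\mathrm{MLD}_F(X)=1$ if and only if both of the following hold: (i) the (projective) linear span of $X$ is two-dimensional; (ii) there exists $\alpha\in\mathcal{L}^\ast$ such that $\mathrm{mult}_{[\alpha]}(X^\vee)=\deg(X^\vee)-1$ and $F-\alpha^{\deg(F)}\in\mathcal{I}(X)$. Moreover, $\mathrm{MLD}_F(X)=1$ implies that $X^\vee$ is a hypersurface $X^\vee=V(g)\subset\mathbb{P}\mathcal{L}^\ast$ and that the solution $\Phi_{X,\mathcal{L},F}$ to the homaloidal PDE with respect to $F$ corresponding to $X$ is determined by $\alpha$ and $g$: $$\Phi_{X,\mathcal{L},F}=\deg(F)^{\deg(F)}\cdot\big(\alpha(\nabla\log g)\big)^{\deg(F)}.$$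
   Context: Maximum likelihood degree: $C_X\subset\mathcal{L}$ is the affine cone over $X$ and $C_X^\circ=(C_X)_{\mathrm{reg}}\setminus V(F)$. For $u\in\mathcal{L}^\ast$, $\ell_{F,u}(p)=\log F(p)-u(p)$, with differential $p\mapsto\frac{d_pF}{F(p)}-u$. Let $\xi_F=\{(x,u): x\text{ is a critical point of }\ell_{F,u}|_{C_X^\circ}\}\subset\mathcal{L}\times\mathcal{L}^\ast$. $\mathrm{MLD}_F(X)$ is the degree of the projection $\xi_F\to\mathcal{L}^\ast$ if it is dominant and $0$ otherwise (the number of critical points for general $u$). If $\mathrm{MLD}_F(X)=1$, then for general $u\in\mathcal{L}^\ast$ there is a unique critical point $\mathrm{MLE}_{X,\mathcal{L},F}(u)\in C_X^\circ$, which is a rational function of $u$. It is known that the varieties $X$ with $\mathrm{MLD}_F(X)=1$ are in bijection with the solutions $\Phi\colon\mathcal{L}^\ast\dashrightarrow\mathbb{C}$ (rational and homogeneous) of the homaloidal PDE $\Phi=F\circ(-\nabla\log\Phi)$; the solution $\Phi_{X,\mathcal{L},F}$ corresponding to $X$ satisfies $\mathrm{MLE}_{X,\mathcal{L},F}=-\nabla\log\Phi_{X,\mathcal{L},F}$, hence $\Phi_{X,\mathcal{L},F}=F\circ\mathrm{MLE}_{X,\mathcal{L},F}$. Gradients of functions on $\mathcal{L}^\ast$ take values in $\mathcal{L}$, so $\alpha(\nabla\log g)$ is the rational function $u\mapsto\alpha(\nabla_u\log g)$ on $\mathcal{L}^\ast$, where $g$ is a polynomial generating the vanishing ideal of $X^\vee$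 and $\alpha$ is as in (ii). $\mathrm{mult}_{[\alpha]}$ denotes multiplicity at the point $[\alpha]\in\mathbb{P}\mathcal{L}^\ast$. *)

theory Defs
  imports "HOL-Analysis.Analysis"
begin

text \<open>
  Coordinates: the vector space is \<open>complex ^ 'n\<close>, and its dual is identified with
  \<open>complex ^ 'n\<close> as well, by the bilinear pairing below (not the Hermitian inner product).
\<close>

definition pairing :: "complex ^ 'n \<Rightarrow> complex ^ 'n \<Rightarrow> complex" where
  "pairing u x = (\<Sum>i\<in>UNIV. u $ i * x $ i)"

section \<open>Polynomials\<close>

text \<open>
  Polynomials are represented by the functions they induce; over the infinite field of complex
  numbers the two are in bijection, and so are forms of degree \<open>d\<close> and the functions below
  (the zero function is a form of every degree).
\<close>

definition monomial_fun :: "('n \<Rightarrow> nat) \<Rightarrow> complex ^ 'n \<Rightarrow> complex" where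
  "monomial_fun m x = (\<Prod>i\<in>UNIV. x $ i ^ m i)"

definition polynomial :: "(complex ^ 'n \<Rightarrow> complex) \<Rightarrow> bool" where
  "polynomial f \<longleftrightarrow>
     (\<exists>M c. finite M \<and> f = (\<lambda>x. \<Sum>m\<in>M. c m * monomial_fun m x))"

definition homogeneous :: "nat \<Rightarrow> (complex ^ 'n \<Rightarrow> complex) \<Rightarrow> bool" where
  "homogeneous d f \<longleftrightarrow>
     (\<exists>M c. finite M \<and> (\<forall>m\<in>M. sum m UNIV = d) \<and>
            f = (\<lambda>x. \<Sum>m\<in>M. c m * monomial_fun m x))"

text \<open>\<open>P\<close> holds at a general point, i.e. on some nonempty Zariski open set.\<close>

definition generically :: "(complex ^ 'n \<Rightarrow> bool) \<Rightarrow> bool" where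
  "generically P \<longleftrightarrow>
     (\<exists>q. polynomial q \<and> q \<noteq> (\<lambda>_. 0) \<and> (\<forall>u. q u \<noteq> 0 \<longrightarrow> P u))"

text \<open>
  The cardinality of \<open>S u\<close> for general \<open>u\<close>. The convention \<open>0\<close> only concerns families
  without a generic finite cardinality.
\<close>

definition generic_card :: "(complex ^ 'n \<Rightarrow> 'b set) \<Rightarrow> nat" where
  "generic_card S =
     (if \<exists>m. generically (\<lambda>u. finite (S u) \<and> card (S u) = m)
      then THE m. generically (\<lambda>u. finite (S u) \<and> card (S u) = m)
      else 0)"

text \<open>Derivatives are complex derivatives: \<open>t\<close> ranges over the complex numbers.\<close>

definition gradient :: "(complex ^ 'n \<Rightarrow> complex) \<Rightarrow> complex ^ 'n \<Rightarrow> complex ^ 'n" where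
  "gradient f p = (\<chi> i. deriv (\<lambda>t. f (p + t *s axis i 1)) 0)"

definition differential ::
    "(complex ^ 'n \<Rightarrow> complex) \<Rightarrow> complex ^ 'n \<Rightarrow> complex ^ 'n \<Rightarrow> complex" where
  "differential f p v = pairing (gradient f p) v"

text \<open>\<open>\<nabla> log f\<close>, which needs no choice of a branch of the logarithm.\<close>

definition log_gradient :: "(complex ^ 'n \<Rightarrow> complex) \<Rightarrow> complex ^ 'n \<Rightarrow> complex ^ 'n" where
  "log_gradient f u = inverse (f u) *s gradient f u"

section \<open>Projective varieties\<close>

text \<open>
  A point of projective space is a line through the origin, so that subsets of projective space
  have type \<open>(complex ^ 'n) set set\<close>; the point \<open>[v]\<close> is \<open>vec.span {v}\<close>.
\<close>

definition proj_space :: "(complex ^ 'n) set set" where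
  "proj_space = {vec.span {v} | v. v \<noteq> 0}"

definition proj_zeros :: "(complex ^ 'n \<Rightarrow> complex) set \<Rightarrow> (complex ^ 'n) set set" where
  "proj_zeros S = {p \<in> proj_space. \<forall>f\<in>S. \<forall>v\<in>p. f v = 0}"

definition proj_closed :: "(complex ^ 'n) set set \<Rightarrow> bool" where
  "proj_closed Z \<longleftrightarrow> (\<exists>S. (\<forall>f\<in>S. \<exists>d. homogeneous d f) \<and> Z = proj_zeros S)"

definition proj_closure :: "(complex ^ 'n) set set \<Rightarrow> (complex ^ 'n) set set" where
  "proj_closure S = \<Inter>{Z. proj_closed Z \<and> S \<subseteq> Z}"

definition proj_irreducible :: "(complex ^ 'n) set set \<Rightarrow> bool" where
  "proj_irreducible Z \<longleftrightarrow> proj_closed Z \<and> Z \<noteq> {} \<and>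
     (\<forall>A B. proj_closed A \<and> proj_closed B \<and> Z = A \<union> B \<longrightarrow> Z = A \<or> Z = B)"

text \<open>Krull dimension (of nonempty sets).\<close>

definition proj_dim :: "(complex ^ 'n) set set \<Rightarrow> enat" where
  "proj_dim X = Sup {enat k | k. \<exists>Z :: nat \<Rightarrow> (complex ^ 'n) set set.
     (\<forall>i\<le>k. proj_irreducible (Z i) \<and> Z i \<subseteq> X) \<and> (\<forall>i<k. Z i \<subset> Z (Suc i))}"

definition irreducible_curve :: "(complex ^ 'n) set set \<Rightarrow> bool" where
  "irreducible_curve X \<longleftrightarrow> proj_irreducible X \<and> proj_dim X = 1"

definition affine_cone :: "(complex ^ 'n) set set \<Rightarrow> (complex ^ 'n) set" where
  "affine_cone X = insert 0 (\<Union>X)"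

definition vanishing_ideal ::
    "(complex ^ 'n) set set \<Rightarrow> (complex ^ 'n \<Rightarrow> complex) set" where
  "vanishing_ideal X = {f. polynomial f \<and> (\<forall>x\<in>affine_cone X. f x = 0)}"

text \<open>The dimension of the projective linear span of \<open>X\<close> (as an integer: \<open>-1\<close> if \<open>X\<close> is empty).\<close>

definition proj_span_dim :: "(complex ^ 'n) set set \<Rightarrow> int" where
  "proj_span_dim X = int (vec.dim (vec.span (affine_cone X))) - 1"

text \<open>The degree of a curve: the number of points on a general hyperplane section.\<close>

definition curve_degree :: "(complex ^ 'n) set set \<Rightarrow> nat" where
  "curve_degree X = generic_card (\<lambda>u. {p \<in> X. \<forall>v\<in>p. pairing u v = 0})"

text \<open>The Zariski tangent space of the affine cone.\<close>

definition tangent_space ::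
    "(complex ^ 'n) set set \<Rightarrow> complex ^ 'n \<Rightarrow> (complex ^ 'n) set" where
  "tangent_space X x = {v. \<forall>f\<in>vanishing_ideal X. differential f x v = 0}"

text \<open>
  The regular locus of the affine cone over an irreducible \<open>X\<close>; the cone is then
  irreducible of dimension \<open>proj_dim X + 1\<close>.
\<close>

definition cone_reg :: "(complex ^ 'n) set set \<Rightarrow> (complex ^ 'n) set" where
  "cone_reg X =
     {x \<in> affine_cone X. enat (vec.dim (tangent_space X x)) = proj_dim X + 1}"

text \<open>
  The dual variety: the closure of the set of hyperplanes tangent to \<open>X\<close> at a regular point.
  For \<open>x \<noteq> 0\<close>, the embedded projective tangent space at \<open>[x]\<close> is the projectivisation of
  the tangent space of the cone at \<open>x\<close>.
\<close>

definition dual_variety :: "(complex ^ 'n) set set \<Rightarrow> (complex ^ 'n) set set" where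
  "dual_variety X = proj_closure
     {vec.span {u} | u. u \<noteq> 0 \<and>
        (\<exists>x\<in>cone_reg X. x \<noteq> 0 \<and> (\<forall>v\<in>tangent_space X x. pairing u v = 0))}"

section \<open>Hypersurfaces\<close>

text \<open>\<open>Y\<close> is the hypersurface \<open>V(g)\<close> and \<open>g\<close> generates its vanishing ideal.\<close>

definition hypersurface_equation ::
    "(complex ^ 'n) set set \<Rightarrow> (complex ^ 'n \<Rightarrow> complex) \<Rightarrow> bool" where
  "hypersurface_equation Y g \<longleftrightarrow>
     g \<noteq> (\<lambda>_. 0) \<and> (\<exists>e>0. homogeneous e g) \<and> Y = proj_zeros {g} \<and>
     vanishing_ideal Y = {(\<lambda>x. g x * h x) | h. polynomial h}"

text \<open>The lowest degree of a nonzero term in the Taylor expansion of \<open>g\<close> at \<open>a\<close>.\<close>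

definition vanishing_order :: "(complex ^ 'n \<Rightarrow> complex) \<Rightarrow> complex ^ 'n \<Rightarrow> nat" where
  "vanishing_order g a =
     (LEAST k. \<exists>v. (deriv ^^ k) (\<lambda>t. g (a + t *s v)) 0 \<noteq> 0)"

text \<open>
  The degree of a hypersurface and its multiplicity at \<open>[a]\<close>, both read off from a generator of
  the vanishing ideal (which is unique up to a nonzero factor). Nothing is specified about their
  values on sets that are not hypersurfaces.
\<close>

definition hypersurface_degree :: "(complex ^ 'n) set set \<Rightarrow> nat" where
  "hypersurface_degree Y = (THE e. \<exists>g. hypersurface_equation Y g \<and> homogeneous e g)"

definition hypersurface_mult :: "complex ^ 'n \<Rightarrow> (complex ^ 'n) set set \<Rightarrow> nat" where
  "hypersurface_mult a Y =
     (THE k. \<exists>g. hypersurface_equation Y g \<and> k = vanishing_order g a)"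

section \<open>Maximum likelihood degree\<close>

text \<open>
  \<open>crit_incidence F X\<close> is the set \<open>\<xi>\<^sub>F\<close> of all \<open>(x, u)\<close> such that \<open>x\<close> is a critical point of
  \<open>log F - u\<close> on the regular locus of the cone minus \<open>V(F)\<close>: the differential vanishes on
  the tangent space at \<open>x\<close>.
\<close>

definition crit_incidence :: "(complex ^ 'n \<Rightarrow> complex) \<Rightarrow> (complex ^ 'n) set set \<Rightarrow>
    ((complex ^ 'n) \<times> (complex ^ 'n)) set" where
  "crit_incidence F X = {(x, u). x \<in> cone_reg X \<and> F x \<noteq> 0 \<and>
     (\<forall>v\<in>tangent_space X x. differential F x v / F x - pairing u v = 0)}"

definition zariski_dense :: "(complex ^ 'n) set \<Rightarrow> bool" where
  "zariski_dense A \<longleftrightarrow> (\<forall>q. polynomial q \<and> (\<forall>u\<in>A. q u = 0) \<longrightarrow> q = (\<lambda>_. 0))"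

text \<open>
  The degree of the projection to the second factor is the cardinality of its general fibre.
\<close>

definition MLD :: "(complex ^ 'n \<Rightarrow> complex) \<Rightarrow> (complex ^ 'n) set set \<Rightarrow> nat" where
  "MLD F X =
     (if zariski_dense (snd ` crit_incidence F X)
      then generic_card (\<lambda>u. {x. (x, u) \<in> crit_incidence F X})
      else 0)"

text \<open>Meaningful for general \<open>u\<close> when \<open>MLD F X = 1\<close>.\<close>

definition MLE ::
    "(complex ^ 'n \<Rightarrow> complex) \<Rightarrow> (complex ^ 'n) set set \<Rightarrow> complex ^ 'n \<Rightarrow> complex ^ 'n" where
  "MLE F X u = (THE x. (x, u) \<in> crit_incidence F X)"

section \<open>The homaloidal PDE\<close>

text \<open>
  Rational functions are represented by total functions; they are compared only at general points.
\<close>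

definition homogeneous_rational :: "(complex ^ 'n \<Rightarrow> complex) \<Rightarrow> bool" where
  "homogeneous_rational \<Phi> \<longleftrightarrow>
     (\<exists>a b P Q. homogeneous a P \<and> homogeneous b Q \<and> Q \<noteq> (\<lambda>_. 0) \<and>
        generically (\<lambda>u. \<Phi> u = P u / Q u))"

definition homaloidal_solution ::
    "(complex ^ 'n \<Rightarrow> complex) \<Rightarrow> (complex ^ 'n \<Rightarrow> complex) \<Rightarrow> bool" where
  "homaloidal_solution F \<Phi> \<longleftrightarrow>
     homogeneous_rational \<Phi> \<and> generically (\<lambda>u. \<Phi> u \<noteq> 0) \<and>
     generically (\<lambda>u. \<Phi> u = F (- log_gradient \<Phi> u))"

text \<open>
  \<open>\<Phi>\<close> is the solution corresponding to \<open>X\<close>. It is unique as a rational function, since the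
  two conditions force \<open>\<Phi> = F \<circ> MLE F X\<close> at general points.
\<close>

definition homaloidal_solution_of ::
    "(complex ^ 'n \<Rightarrow> complex) \<Rightarrow> (complex ^ 'n) set set \<Rightarrow> (complex ^ 'n \<Rightarrow> complex) \<Rightarrow> bool" where
  "homaloidal_solution_of F X \<Phi> \<longleftrightarrow>
     homaloidal_solution F \<Phi> \<and> generically (\<lambda>u. MLE F X u = - log_gradient \<Phi> u)"

end

theory Submission
  imports Defs "HOL-Complex_Analysis.Complex_Analysis"
begin

text \<open>
  Three ideas carry the proof.

  If \<open>MLD F X = 1\<close>, then \<open>F\<close> is a power of a linear form on \<open>X\<close>. Along a holomorphic arc \<open>\<gamma>\<close> of regular
  points, \<open>\<gamma> s\<close> is critical for \<open>u\<close>, up to a factor, when a function \<open>m u\<close> that depends linearly on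
  \<open>u\<close> vanishes at \<open>s\<close>. In a pencil \<open>u0 + z u1\<close> of functionals for which \<open>\<gamma> 0\<close> is already critical, the
  choice \<open>z = - m u0 s / m u1 s\<close> makes \<open>\<gamma> s\<close> a second critical point. Uniqueness therefore makes
  the functions \<open>m u0\<close> and \<open>m u1\<close> proportional, so that the functionals \<open>\<kappa>\<close> with \<open>m \<kappa> = 0\<close> have codimension
  at most two. But \<open>m \<kappa> = 0\<close> says that \<open>\<kappa>\<^sup>d / F\<close> is constant on \<open>X\<close>. Hence two such functionals are
  proportional on \<open>X\<close>, the linear span of \<open>X\<close> is a plane, and a suitable multiple \<open>\<alpha>\<close> of one of them
  satisfies \<open>F = \<alpha>\<^sup>d\<close> on \<open>X\<close> (\<open>MLD_1_imp_power_of_linear_form\<close>).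

  For a plane curve with \<open>F = \<alpha>\<^sup>d\<close>, a point \<open>x\<close> is critical for \<open>u\<close> exactly when \<open>u - (d / \<alpha>(x)) \<alpha>\<close> is
  tangent to \<open>X\<close> at \<open>x\<close>. Critical points thus correspond to the points other than \<open>[\<alpha>]\<close> in which the
  line through \<open>[u]\<close> and \<open>[\<alpha>]\<close> meets the dual curve, and uniqueness should mean that \<open>[\<alpha>]\<close> has
  multiplicity \<open>deg - 1\<close> on it. To construct an equation, let the line through \<open>[\<alpha>]\<close> vary with a
  parameter \<open>z\<close>. The point of contact is a holomorphic function of \<open>z\<close> off a finite set, and its
  coordinates have finite fibres, because a line meets \<open>X\<close> in finitely many points. By the great
  Picard theorem they are rational functions of \<open>z\<close> (\<open>rational_if_finite_fibres\<close>). So the tangent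
  line in question is \<open>\<beta>1 + z \<beta>2 - (P(z) / Q(z)) \<alpha>\<close> with coprime polynomials \<open>P\<close> and \<open>Q\<close>; clearing
  denominators gives a form \<open>g\<close> that is affine-linear in the direction \<open>\<alpha>\<close>, and coprimality
  makes it generate the ideal of the dual curve (\<open>equation_divides\<close>, \<open>dual_equation\<close>).

  Conversely, suppose that \<open>g (u + t \<alpha>) = g u + t A u\<close> with \<open>A = \<alpha>(\<nabla>g)\<close>. The only tangent line
  \<open>u + t \<alpha>\<close> has \<open>t = - g u / A u\<close>, so \<open>\<alpha>(x) = d A u / g u\<close> at a critical point \<open>x\<close>. By biduality
  (\<open>gradient_dual_equation\<close>), \<open>x\<close> is a multiple of \<open>\<nabla>g\<close> at this line, which gives
  \<open>x = d (\<nabla>g / g - \<nabla>A / A)\<close>. This proves uniqueness. It also identifies \<open>x\<close> as \<open>- \<nabla> log \<Psi>\<close> and \<open>F(x)\<close> as \<open>\<Psi>\<close> for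
  \<open>\<Psi> = d\<^sup>d (A / g)\<^sup>d\<close>, which is the stated formula. Existence for general \<open>u\<close> holds because the functionals with a
  critical point are Zariski dense and being critical is a rational condition on \<open>u\<close>
  (\<open>generic_critical_point\<close>).

  The arcs are integral curves of polynomial vector fields tangent to the cone, found as convergent power
  series (\<open>tangent_vector_field\<close>, \<open>integral_arc\<close>). A form that vanishes on such an arc vanishes on
  \<open>X\<close> (\<open>form_vanishes_on_curve\<close>), since the Zariski closure of the arc is irreducible and has more than
  one point. In this way statements about \<open>X\<close> follow from the identity theorem on a disc.
\<close>

(* The dollar sign is kept for the components of vectors. *)
no_notation fps_nth (infixl \<open>$\<close> 75)

section \<open>The pairing\<close>

lemma pairing_commute: "pairing u x = pairing x u"
  by (simp add: pairing_def mult.commute)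

lemma pairing_linear [simp]:
  "pairing (u + v) x = pairing u x + pairing v x"
  "pairing u (x + y) = pairing u x + pairing u y"
  "pairing (u - v) x = pairing u x - pairing v x"
  "pairing u (x - y) = pairing u x - pairing u y"
  "pairing (- u) x = - pairing u x"
  "pairing u (- x) = - pairing u x"
  "pairing (c *s u) x = c * pairing u x"
  "pairing u (c *s x) = c * pairing u x"
  "pairing 0 x = 0"
  "pairing u 0 = 0"
  by (simp_all add: pairing_def algebra_simps sum.distrib sum_subtractf sum_distrib_left flip: sum_negf)

lemma pairing_axis [simp]:
  fixes x u :: "complex ^ 'n"
  shows "pairing (axis i 1) x = x $ i" "pairing u (axis i 1) = u $ i"
proof -
  have *: "pairing (axis i 1) x = x $ i" for x :: "complex ^ 'n"
  proof -
    have "axis i 1 $ j * x $ j = (if j = i then x $ i else 0)" for j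
      by (simp add: axis_def)
    then show ?thesis by (simp add: pairing_def)
  qed
  from *[of x] *[of u] show "pairing (axis i 1) x = x $ i" "pairing u (axis i 1) = u $ i"
    by (simp_all add: pairing_commute)
qed

lemma pairing_eq_zeroD: "(\<And>v. pairing u v = 0) \<Longrightarrow> u = 0"
  by (metis pairing_axis(2) vec_eq_iff zero_index)

lemma pairing_nonzero:
  assumes "u \<noteq> 0"
  obtains v where "pairing u v = 1" "pairing v u = 1"
proof -
  obtain w where w: "pairing u w \<noteq> 0"
    using assms pairing_eq_zeroD by blast
  show thesis
    using that[of "(1 / pairing u w) *s w"] w by (simp add: pairing_commute)
qed

section \<open>Polynomial functions\<close>

lemma polynomial_monomial: "polynomial (\<lambda>x. a * monomial_fun m x)"
  unfolding polynomial_def by (rule exI[of _ "{m}"], rule exI[of _ "\<lambda>_. a"]) simp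

lemma polynomial_const [simp]: "polynomial (\<lambda>_. a)"
  using polynomial_monomial[of a "\<lambda>_. 0"] by (simp add: monomial_fun_def)

lemma polynomial_coord [simp]: "polynomial (\<lambda>x. x $ i)"
proof -
  have "monomial_fun (\<lambda>j. if j = i then 1 else 0) x = x $ i" for x :: "complex ^ 'a"
  proof -
    have "x $ j ^ (if j = i then 1 else 0) = (if j = i then x $ i else 1)" for j
      by simp
    then show ?thesis by (simp add: monomial_fun_def)
  qed
  then show ?thesis
    using polynomial_monomial[of 1 "\<lambda>j. if j = i then 1 else 0"] by simp
qed

lemma polynomial_add [intro]:
  assumes "polynomial f" "polynomial g"
  shows "polynomial (\<lambda>x. f x + g x)"
proof -
  obtain M c where M: "finite M" "f = (\<lambda>x. \<Sum>m\<in>M. c m * monomial_fun m x)"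
    using assms(1) unfolding polynomial_def by blast
  obtain M' c' where M': "finite M'" "g = (\<lambda>x. \<Sum>m\<in>M'. c' m * monomial_fun m x)"
    using assms(2) unfolding polynomial_def by blast
  have ext: "(\<Sum>m\<in>A. a m * monomial_fun m x) =
      (\<Sum>m\<in>A \<union> B. (if m \<in> A then a m else 0) * monomial_fun m x)"
    if "finite A" "finite B" for A B a and x :: "complex ^ 'n"
    using that by (intro sum.mono_neutral_cong_left) auto
  have "f x + g x = (\<Sum>m\<in>M \<union> M'. ((if m \<in> M then c m else 0) + (if m \<in> M' then c' m else 0))
      * monomial_fun m x)" for x
    unfolding M(2) M'(2) ext[OF M(1) M'(1), of c x] ext[OF M'(1) M(1), of c' x]
    by (simp only: distrib_right sum.distrib Un_commute[of M' M])
  then show ?thesis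
    unfolding polynomial_def using M(1) M'(1)
    by (intro exI[of _ "M \<union> M'"]
        exI[of _ "\<lambda>m. (if m \<in> M then c m else 0) + (if m \<in> M' then c' m else 0)"] conjI ext) simp_all
qed

lemma polynomial_sum [intro]:
  "(\<And>i. i \<in> S \<Longrightarrow> polynomial (f i)) \<Longrightarrow> polynomial (\<lambda>x. \<Sum>i\<in>S. f i x)"
  by (induction S rule: infinite_finite_induct) auto

lemma polynomial_mult [intro]:
  assumes "polynomial f" "polynomial g"
  shows "polynomial (\<lambda>x. f x * g x)"
proof -
  obtain M c where M: "finite M" "f = (\<lambda>x. \<Sum>m\<in>M. c m * monomial_fun m x)"
    using assms(1) unfolding polynomial_def by blast
  obtain M' c' where M': "finite M'" "g = (\<lambda>x. \<Sum>m\<in>M'. c' m * monomial_fun m x)"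
    using assms(2) unfolding polynomial_def by blast
  have "f x * g x = (\<Sum>m\<in>M. \<Sum>m'\<in>M'. (c m * c' m') * monomial_fun (\<lambda>i. m i + m' i) x)" for x
    unfolding M(2) M'(2) sum_product
    by (intro sum.cong refl) (simp add: monomial_fun_def power_add prod.distrib mult_ac)
  then have "(\<lambda>x. f x * g x) =
      (\<lambda>x. \<Sum>m\<in>M. \<Sum>m'\<in>M'. (c m * c' m') * monomial_fun (\<lambda>i. m i + m' i) x)"
    by blast
  then show ?thesis
    by (simp add: polynomial_sum polynomial_monomial)
qed

lemma polynomial_power [intro]: "polynomial f \<Longrightarrow> polynomial (\<lambda>x. f x ^ k)"
  by (induction k) auto

lemma polynomial_prod [intro]:
  "(\<And>i. i \<in> S \<Longrightarrow> polynomial (f i)) \<Longrightarrow> polynomial (\<lambda>x. \<Prod>i\<in>S. f i x)"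
  by (induction S rule: infinite_finite_induct) auto

lemma polynomial_minus [intro]: "polynomial f \<Longrightarrow> polynomial (\<lambda>x. - f x)"
  using polynomial_mult[of "\<lambda>_. - 1" f] by simp

lemma polynomial_diff [intro]: "polynomial f \<Longrightarrow> polynomial g \<Longrightarrow> polynomial (\<lambda>x. f x - g x)"
  using polynomial_add[of f "\<lambda>x. - g x"] by auto

lemma polynomial_pairing [simp]: "polynomial (pairing u)" "polynomial (\<lambda>x. pairing x u)"
proof -
  show "polynomial (pairing u)"
    unfolding pairing_def[abs_def] by (intro polynomial_sum polynomial_mult) auto
  then show "polynomial (\<lambda>x. pairing x u)"
    by (simp add: pairing_commute[of _ u])
qed

lemma polynomial_pairing_maps [intro]:
  assumes "\<And>i. polynomial (\<lambda>x. A x $ i)" "\<And>i. polynomial (\<lambda>x. B x $ i)"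
  shows "polynomial (\<lambda>x. pairing (A x) (B x))"
  unfolding pairing_def using assms by (intro polynomial_sum polynomial_mult) auto

text \<open>
  Most properties of polynomial functions below are inherited from the constants and the coordinates
  along this induction.
\<close>
lemma polynomial_induct [consumes 1, case_names const coord add mult]:
  assumes "polynomial f"
    and "\<And>c. P (\<lambda>_. c)"
    and "\<And>i. P (\<lambda>x. x $ i)"
    and add: "\<And>f g. polynomial f \<Longrightarrow> polynomial g \<Longrightarrow> P f \<Longrightarrow> P g \<Longrightarrow> P (\<lambda>x. f x + g x)"
    and mult: "\<And>f g. polynomial f \<Longrightarrow> polynomial g \<Longrightarrow> P f \<Longrightarrow> P g \<Longrightarrow> P (\<lambda>x. f x * g x)"
  shows "P f"
proof -
  obtain M c where M: "finite M" "f = (\<lambda>x. \<Sum>m\<in>M. c m * monomial_fun m x)"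
    using assms(1) unfolding polynomial_def by blast
  have pow: "P (\<lambda>x. x $ i ^ k)" for i k
  proof (induction k)
    case 0 show ?case using assms(2)[of 1] by simp
  next
    case (Suc k)
    then show ?case using mult[of "\<lambda>x. x $ i" "\<lambda>x. x $ i ^ k"] assms(3)
      by (simp add: polynomial_power)
  qed
  have "P (\<lambda>x. \<Prod>i\<in>S. x $ i ^ m i)" for S m
  proof (induction S rule: infinite_finite_induct)
    case (insert i S)
    then show ?case
      using mult[of "\<lambda>x. x $ i ^ m i" "\<lambda>x. \<Prod>i\<in>S. x $ i ^ m i"] pow
      by (simp add: polynomial_power polynomial_prod)
  qed (use assms(2)[of 1] in simp_all)
  then have mono: "P (\<lambda>x. a * monomial_fun m x)" for a m
    using mult[of "\<lambda>_. a" "monomial_fun m"] assms(2) polynomial_monomial[of 1 m]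
    by (simp add: monomial_fun_def[abs_def])
  have "P (\<lambda>x. \<Sum>m\<in>S. c m * monomial_fun m x)" for S
  proof (induction S rule: infinite_finite_induct)
    case (insert i S)
    then show ?case
      using add[of "\<lambda>x. c i * monomial_fun i x" "\<lambda>x. \<Sum>m\<in>S. c m * monomial_fun m x"] mono
      by (simp add: polynomial_sum polynomial_monomial)
  qed (use assms(2)[of 0] in simp_all)
  then show ?thesis by (simp add: M(2))
qed

lemma polynomial_compose:
  assumes "polynomial f" and A: "\<And>i. polynomial (\<lambda>x. A x $ i)"
  shows "polynomial (\<lambda>x. f (A x))"
  using assms(1) by (induction rule: polynomial_induct) (auto simp: A)

lemma holomorphic_on_polynomial:
  assumes "polynomial f" and "\<And>i. (\<lambda>s. \<gamma> s $ i) holomorphic_on S"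
  shows "(\<lambda>s. f (\<gamma> s)) holomorphic_on S"
  using assms(1) by (induction rule: polynomial_induct) (auto intro!: holomorphic_intros assms(2))

lemma continuous_on_polynomial:
  fixes f :: "complex ^ 'n \<Rightarrow> complex"
  assumes "polynomial f"
  shows "continuous_on S f"
  using assms by (induction rule: polynomial_induct) (auto intro!: continuous_intros)

text \<open>
  Uniformity in the parameter \<open>x\<close> of the line makes it possible to substitute for \<open>t\<close> a function of \<open>x\<close>
  and to clear its denominators.
\<close>
lemma polynomial_on_lines:
  fixes A B :: "complex ^ 'm \<Rightarrow> complex ^ 'n"
  assumes "polynomial f" and A: "\<And>i. polynomial (\<lambda>x. A x $ i)" and B: "\<And>i. polynomial (\<lambda>x. B x $ i)"
  obtains p N where "\<And>j. polynomial (\<lambda>x. coeff (p x) j)" "\<And>x. degree (p x) \<le> N"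
    "\<And>x t. poly (p x) t = f (A x + t *s B x)"
proof -
  have "\<exists>p N. (\<forall>j. polynomial (\<lambda>x. coeff (p x) j)) \<and> (\<forall>x. degree (p x) \<le> N) \<and>
    (\<forall>x t. poly (p x) t = f (A x + t *s B x))"
    using assms(1)
  proof (induction rule: polynomial_induct)
    case (const c)
    show ?case by (rule exI[of _ "\<lambda>_. [:c:]"], rule exI[of _ 0]) simp
  next
    case (coord i)
    have "polynomial (\<lambda>x. coeff [:A x $ i, B x $ i:] j)" for j
      by (cases j; cases "j - 1") (auto simp: A B coeff_pCons split: nat.split)
    then show ?case
      by (intro exI[of _ "\<lambda>x. [:A x $ i, B x $ i:]"] exI[of _ 1]) simp
  next
    case (add f g)
    then obtain p N q M where "\<forall>j. polynomial (\<lambda>x. coeff (p x) j)" "\<forall>x. degree (p x) \<le> N"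
      "\<forall>x t. poly (p x) t = f (A x + t *s B x)" "\<forall>j. polynomial (\<lambda>x. coeff (q x) j)"
      "\<forall>x. degree (q x) \<le> M" "\<forall>x t. poly (q x) t = g (A x + t *s B x)"
      by blast
    then show ?case
      by (intro exI[of _ "\<lambda>x. p x + q x"] exI[of _ "max N M"])
        (auto intro!: degree_add_le intro: le_max_iff_disj[THEN iffD2])
  next
    case (mult f g)
    then obtain p N q M where "\<forall>j. polynomial (\<lambda>x. coeff (p x) j)" "\<forall>x. degree (p x) \<le> N"
      "\<forall>x t. poly (p x) t = f (A x + t *s B x)" "\<forall>j. polynomial (\<lambda>x. coeff (q x) j)"
      "\<forall>x. degree (q x) \<le> M" "\<forall>x t. poly (q x) t = g (A x + t *s B x)"
      by blast
    moreover from this have "degree (p x * q x) \<le> N + M" for x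
      by (meson add_mono degree_mult_le order_trans)
    ultimately show ?case
      by (intro exI[of _ "\<lambda>x. p x * q x"] exI[of _ "N + M"])
        (auto simp: coeff_mult intro!: polynomial_sum polynomial_mult)
  qed
  then show thesis using that by blast
qed

lemma polynomial_on_line:
  assumes "polynomial f"
  obtains p where "\<And>t. poly p t = f (a + t *s b)"
proof -
  obtain p :: "complex ^ 'a \<Rightarrow> complex poly" and N where "\<And>x t. poly (p x) t = f (a + t *s b)"
    by (rule polynomial_on_lines[OF assms, of "\<lambda>_. a" "\<lambda>_. b"]) auto
  then show thesis using that by blast
qed

lemma finite_zeros_on_line:
  assumes "polynomial f" "f (a + t *s b) \<noteq> 0"
  shows "finite {t. f (a + t *s b) = 0}"
proof -
  obtain p where "\<And>t. poly p t = f (a + t *s b)"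
    using polynomial_on_line[OF assms(1)] by blast
  then show ?thesis using poly_roots_finite[of p] assms(2)
    by (metis (mono_tags, lifting) Collect_cong poly_0)
qed

lemma poly_zero_if_zero_off_0:
  fixes p :: "complex poly"
  assumes "\<And>t. t \<noteq> 0 \<Longrightarrow> poly p t = 0"
  shows "p = 0"
proof -
  have "infinite (- {0::complex})"
    using infinite_UNIV_char_0 by (simp add: Compl_eq_Diff_UNIV)
  moreover have "- {0} \<subseteq> {t. poly p t = 0}" using assms by blast
  ultimately show ?thesis using poly_roots_finite finite_subset by blast
qed

text \<open>
  The line through a point where \<open>f\<close> does not vanish and a point where \<open>g\<close> does not vanish reduces
  this to polynomials in one variable.
\<close>
lemma polynomial_mult_zero_on:
  assumes f: "polynomial f" and g: "polynomial g"
    and V: "\<And>a b t. a \<in> V \<Longrightarrow> b \<in> V \<Longrightarrow> a + t *s (b - a) \<in> V"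
    and fg: "\<And>x. x \<in> V \<Longrightarrow> f x * g x = 0"
  shows "(\<forall>x\<in>V. f x = 0) \<or> (\<forall>x\<in>V. g x = 0)"
proof (rule ccontr)
  assume "\<not> ?thesis"
  then obtain a b where ab: "a \<in> V" "b \<in> V" "f a \<noteq> 0" "g b \<noteq> 0" by blast
  obtain p where p: "\<And>t. poly p t = f (a + t *s (b - a))" using polynomial_on_line[OF f] by blast
  obtain q where q: "\<And>t. poly q t = g (a + t *s (b - a))" using polynomial_on_line[OF g] by blast
  have "poly (p * q) t = 0" for t
    using fg[OF V[OF ab(1,2)]] by (simp add: p q)
  then have "p * q = 0"
    using poly_all_0_iff_0 by blast
  moreover have "poly p 0 \<noteq> 0" "poly q 1 \<noteq> 0"
    using ab by (simp_all add: p q)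
  ultimately show False by auto
qed

lemma polynomial_mult_zero:
  assumes "polynomial f" "polynomial g" "\<And>x. f x * g x = 0"
  shows "(\<forall>x. f x = 0) \<or> (\<forall>x. g x = 0)"
  using polynomial_mult_zero_on[OF assms(1,2), of UNIV] assms(3) by auto

lemma generically_mono: "generically P \<Longrightarrow> (\<And>u. P u \<Longrightarrow> Q u) \<Longrightarrow> generically Q"
  unfolding generically_def by blast

lemma generically_conj:
  assumes "generically P" "generically Q"
  shows "generically (\<lambda>u. P u \<and> Q u)"
proof -
  obtain p where p: "polynomial p" "p \<noteq> (\<lambda>_. 0)" "\<And>u. p u \<noteq> 0 \<Longrightarrow> P u"
    using assms(1) unfolding generically_def by blast
  obtain q where q: "polynomial q" "q \<noteq> (\<lambda>_. 0)" "\<And>u. q u \<noteq> 0 \<Longrightarrow> Q u"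
    using assms(2) unfolding generically_def by blast
  have "(\<lambda>u. p u * q u) \<noteq> (\<lambda>_. 0)"
    using polynomial_mult_zero[OF p(1) q(1)] p(2) q(2) by (metis ext)
  then show ?thesis
    unfolding generically_def using p q by (intro exI[of _ "\<lambda>u. p u * q u"]) auto
qed

lemma generically_ex: "generically P \<Longrightarrow> \<exists>u. P u"
  unfolding generically_def by blast

lemma generically_nonzero: "polynomial q \<Longrightarrow> q u \<noteq> 0 \<Longrightarrow> generically (\<lambda>u. q u \<noteq> 0)"
  unfolding generically_def by auto

section \<open>Homogeneous polynomials\<close>

lemma homogeneousD: "homogeneous k f \<Longrightarrow> f (c *s x) = c ^ k * f x"
  unfolding homogeneous_def
  by (auto simp: monomial_fun_def power_mult_distrib prod.distrib simp flip: power_sum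
      simp: sum_distrib_left algebra_simps intro!: sum.cong)

lemma homogeneous_imp_polynomial: "homogeneous k f \<Longrightarrow> polynomial f"
  unfolding homogeneous_def polynomial_def by blast

text \<open>
  Comparing coefficients of the polynomial \<open>t \<mapsto> f (t x)\<close> shows that the monomials of degree other than
  \<open>k\<close> cancel, so that they may be dropped from any representation of \<open>f\<close>.
\<close>
lemma homogeneous_iff:
  "homogeneous k f \<longleftrightarrow> polynomial f \<and> (\<forall>c x. f (c *s x) = c ^ k * f x)"
proof safe
  assume "polynomial f" and scale: "\<forall>c x. f (c *s x) = c ^ k * f x"
  then obtain M c where M: "finite M" "f = (\<lambda>x. \<Sum>m\<in>M. c m * monomial_fun m x)"
    unfolding polynomial_def by blast
  have "f x = (\<Sum>m\<in>{m\<in>M. sum m UNIV = k}. c m * monomial_fun m x)" for x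
  proof -
    define p where "p = (\<Sum>m\<in>M. monom (c m * monomial_fun m x) (sum m UNIV))"
    have "poly p t = poly (monom (f x) k) t" for t
    proof -
      have "monomial_fun m (t *s x) = t ^ sum m UNIV * monomial_fun m x" for m
        by (simp add: monomial_fun_def power_mult_distrib prod.distrib power_sum)
      then have "poly p t = f (t *s x)"
        by (auto simp: p_def poly_sum poly_monom M(2) algebra_simps intro!: sum.cong)
      then show ?thesis using scale by (simp add: poly_monom)
    qed
    then have "p = monom (f x) k" by (simp add: poly_eq_poly_eq_iff[symmetric] fun_eq_iff)
    then have "f x = coeff p k" by simp
    also have "\<dots> = (\<Sum>m\<in>M. if sum m UNIV = k then c m * monomial_fun m x else 0)"
      by (simp add: p_def coeff_sum coeff_monom)
    also have "\<dots> = (\<Sum>m\<in>{m\<in>M. sum m UNIV = k}. c m * monomial_fun m x)"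
      using M(1) by (simp add: sum.If_cases Int_def)
    finally show ?thesis .
  qed
  then show "homogeneous k f"
    unfolding homogeneous_def using M(1)
    by (intro exI[of _ "{m\<in>M. sum m UNIV = k}"] exI[of _ c]) auto
qed (auto simp: homogeneousD homogeneous_imp_polynomial)

lemma homogeneousI_nonzero:
  assumes f: "polynomial f" and scale: "\<And>c x. c \<noteq> 0 \<Longrightarrow> f (c *s x) = c ^ k * f x"
  shows "homogeneous k f"
proof -
  have "f (c *s x) = c ^ k * f x" for c x
  proof -
    obtain p where p: "\<And>t. poly p t = f (0 + t *s x)" using polynomial_on_line[OF f] by blast
    have "poly (p - monom (f x) k) t = 0" if "t \<noteq> 0" for t
      using scale[OF that] by (simp add: p poly_monom)
    then have "p - monom (f x) k = 0" by (rule poly_zero_if_zero_off_0)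
    then show ?thesis using p[of c] by (simp add: poly_monom mult.commute)
  qed
  then show ?thesis using f homogeneous_iff by blast
qed

lemma homogeneous_pairing: "homogeneous 1 (pairing u)"
  by (simp add: homogeneous_iff)

lemma homogeneous_mult: "homogeneous j f \<Longrightarrow> homogeneous k g \<Longrightarrow> homogeneous (j + k) (\<lambda>x. f x * g x)"
  by (auto simp: homogeneous_iff power_add)

lemma homogeneous_power: "homogeneous k f \<Longrightarrow> homogeneous (k * m) (\<lambda>x. f x ^ m)"
  by (auto simp: homogeneous_iff power_mult power_mult_distrib)

lemma homogeneous_diff: "homogeneous k f \<Longrightarrow> homogeneous k g \<Longrightarrow> homogeneous k (\<lambda>x. f x - g x)"
  by (auto simp: homogeneous_iff algebra_simps)

lemma homogeneous_cmult: "homogeneous k f \<Longrightarrow> homogeneous k (\<lambda>x. c * f x)"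
  by (auto simp: homogeneous_iff)

text \<open>The homogeneous components of \<open>f\<close> are the coefficients of \<open>t \<mapsto> f (t x)\<close>.\<close>
lemma homogeneous_components:
  fixes f :: "complex ^ 'n \<Rightarrow> complex"
  assumes "polynomial f"
  obtains p N where "\<And>j. homogeneous j (\<lambda>x. coeff (p x) j)" "\<And>x. degree (p x) \<le> N"
    "\<And>x t. poly (p x) t = f (t *s x)"
proof -
  obtain p :: "complex ^ 'n \<Rightarrow> complex poly" and N where p:
    "\<And>j. polynomial (\<lambda>x. coeff (p x) j)" "\<And>x. degree (p x) \<le> N"
    "\<And>x t. poly (p x) t = f (0 + t *s x)"
    by (rule polynomial_on_lines[OF assms, of "\<lambda>_. 0" "\<lambda>x. x"]) auto
  have "homogeneous j (\<lambda>x. coeff (p x) j)" for j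
  proof -
    have "coeff (p (c *s x)) j = c ^ j * coeff (p x) j" for c x
    proof -
      have "poly (p (c *s x)) t = poly (pcompose (p x) [:0, c:]) t" for t
        by (simp add: p(3) poly_pcompose mult.commute)
      then have "p (c *s x) = pcompose (p x) [:0, c:]"
        by (simp add: poly_eq_poly_eq_iff[symmetric] fun_eq_iff)
      then show ?thesis by (simp add: coeff_pcompose_linear)
    qed
    then show ?thesis using p(1) homogeneous_iff by blast
  qed
  moreover have "poly (p x) t = f (t *s x)" for x t
    using p(3) by simp
  ultimately show thesis using that p(2) by blast
qed

lemma poly_eq_sum_atMost:
  fixes p :: "complex poly"
  assumes "degree p \<le> N"
  shows "poly p t = (\<Sum>j\<le>N. coeff p j * t ^ j)"
  unfolding poly_altdef using assms
  by (intro sum.mono_neutral_left) (auto simp: coeff_eq_0)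

text \<open>Each homogeneous component is multiplied by the missing power of the linear form \<open>l\<close>.\<close>
lemma homogenization:
  fixes f :: "complex ^ 'n \<Rightarrow> complex"
  assumes "polynomial f"
  obtains N h where "homogeneous N h"
    "\<And>x. pairing l x \<noteq> 0 \<Longrightarrow> h x = pairing l x ^ N * f ((1 / pairing l x) *s x)"
proof -
  obtain p N where p: "\<And>j. homogeneous j (\<lambda>x. coeff (p x) j)" "\<And>x. degree (p x) \<le> N"
    "\<And>x t. poly (p x) t = f (t *s x)"
    using homogeneous_components[OF assms] by blast
  define h where "h = (\<lambda>x. \<Sum>j\<le>N. pairing l x ^ (N - j) * coeff (p x) j)"
  have "homogeneous N h"
    unfolding homogeneous_iff
  proof safe
    show "polynomial h"
      unfolding h_def
      by (intro polynomial_sum polynomial_mult polynomial_power polynomial_pairing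
          homogeneous_imp_polynomial[OF p(1)])
    fix c x
    have "pairing l (c *s x) ^ (N - j) * coeff (p (c *s x)) j
        = c ^ N * (pairing l x ^ (N - j) * coeff (p x) j)" if "j \<le> N" for j
    proof -
      have "c ^ (N - j) * c ^ j = c ^ N" using that by (simp flip: power_add)
      then show ?thesis using homogeneousD[OF p(1)] by (simp add: power_mult_distrib algebra_simps)
    qed
    then show "h (c *s x) = c ^ N * h x"
      unfolding h_def by (simp add: sum_distrib_left)
  qed
  moreover have "h x = pairing l x ^ N * f ((1 / pairing l x) *s x)" if "pairing l x \<noteq> 0" for x
  proof -
    have 1: "f ((1 / pairing l x) *s x) = (\<Sum>j\<le>N. coeff (p x) j * (1 / pairing l x) ^ j)"
      using p(3)[of x] poly_eq_sum_atMost[OF p(2)] by metis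
    have 2: "pairing l x ^ (N - j) * coeff (p x) j
        = pairing l x ^ N * (coeff (p x) j * (1 / pairing l x) ^ j)" if "j \<le> N" for j
      using \<open>pairing l x \<noteq> 0\<close> that by (simp add: power_diff power_divide field_simps)
    show ?thesis
      unfolding h_def 1 sum_distrib_left by (intro sum.cong refl 2) simp
  qed
  ultimately show thesis using that by blast
qed

section \<open>Derivatives of polynomials\<close>

text \<open>
  The chain rule determines the gradient. Stating it for all holomorphic arcs at once lets it
  pass through the induction over polynomials, and makes the gradient polynomial.
\<close>
lemma polynomial_has_gradient:
  assumes "polynomial f"
  shows "\<exists>G. (\<forall>i. polynomial (\<lambda>x. G x $ i)) \<and>
    (\<forall>\<gamma> \<gamma>' s. (\<forall>i. ((\<lambda>s. \<gamma> s $ i) has_field_derivative \<gamma>' $ i) (at s)) \<longrightarrow>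
      ((\<lambda>s. f (\<gamma> s)) has_field_derivative pairing (G (\<gamma> s)) \<gamma>') (at s))"
  using assms
proof (induction rule: polynomial_induct)
  case (const c)
  show ?case by (rule exI[of _ "\<lambda>_. 0"]) simp
next
  case (coord i)
  show ?case by (rule exI[of _ "\<lambda>_. axis i 1"]) simp
next
  case (add f g)
  then obtain G H where "\<forall>i. polynomial (\<lambda>x. G x $ i)" "\<forall>i. polynomial (\<lambda>x. H x $ i)"
    and GH: "\<forall>\<gamma> \<gamma>' s. (\<forall>i. ((\<lambda>s. \<gamma> s $ i) has_field_derivative \<gamma>' $ i) (at s)) \<longrightarrow>
      ((\<lambda>s. f (\<gamma> s)) has_field_derivative pairing (G (\<gamma> s)) \<gamma>') (at s)"
      "\<forall>\<gamma> \<gamma>' s. (\<forall>i. ((\<lambda>s. \<gamma> s $ i) has_field_derivative \<gamma>' $ i) (at s)) \<longrightarrow>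
      ((\<lambda>s. g (\<gamma> s)) has_field_derivative pairing (H (\<gamma> s)) \<gamma>') (at s)"
    by blast
  moreover have "((\<lambda>s. f (\<gamma> s) + g (\<gamma> s)) has_field_derivative pairing (G (\<gamma> s) + H (\<gamma> s)) \<gamma>') (at s)"
    if "\<forall>i. ((\<lambda>s. \<gamma> s $ i) has_field_derivative \<gamma>' $ i) (at s)" for \<gamma> \<gamma>' s
    using DERIV_add[OF GH(1)[rule_format, OF that[rule_format]] GH(2)[rule_format, OF that[rule_format]]]
    by simp
  ultimately show ?case
    by (intro exI[of _ "\<lambda>x. G x + H x"]) (auto intro: polynomial_add)
next
  case (mult f g)
  then obtain G H where "\<forall>i. polynomial (\<lambda>x. G x $ i)" "\<forall>i. polynomial (\<lambda>x. H x $ i)"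
    and GH: "\<forall>\<gamma> \<gamma>' s. (\<forall>i. ((\<lambda>s. \<gamma> s $ i) has_field_derivative \<gamma>' $ i) (at s)) \<longrightarrow>
      ((\<lambda>s. f (\<gamma> s)) has_field_derivative pairing (G (\<gamma> s)) \<gamma>') (at s)"
      "\<forall>\<gamma> \<gamma>' s. (\<forall>i. ((\<lambda>s. \<gamma> s $ i) has_field_derivative \<gamma>' $ i) (at s)) \<longrightarrow>
      ((\<lambda>s. g (\<gamma> s)) has_field_derivative pairing (H (\<gamma> s)) \<gamma>') (at s)"
    by blast
  moreover have "((\<lambda>s. f (\<gamma> s) * g (\<gamma> s)) has_field_derivative
      pairing (g (\<gamma> s) *s G (\<gamma> s) + f (\<gamma> s) *s H (\<gamma> s)) \<gamma>') (at s)"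
    if "\<forall>i. ((\<lambda>s. \<gamma> s $ i) has_field_derivative \<gamma>' $ i) (at s)" for \<gamma> \<gamma>' s
    using DERIV_mult[OF GH(1)[rule_format, OF that[rule_format]] GH(2)[rule_format, OF that[rule_format]]]
    by (simp add: algebra_simps)
  ultimately show ?case
    using mult(1,2) by (intro exI[of _ "\<lambda>x. g x *s G x + f x *s H x"])
      (auto intro!: polynomial_add polynomial_mult)
qed

lemma line_has_derivative:
  "((\<lambda>t. (p + t *s v) $ i) has_field_derivative v $ i) (at s)" for p v :: "complex ^ 'n"
  by (auto intro!: derivative_eq_intros)

lemma polynomial_gradient_aux:
  assumes "polynomial f"
  shows "(\<forall>i. polynomial (\<lambda>x. gradient f x $ i)) \<and>
    (\<forall>\<gamma> \<gamma>' s. (\<forall>i. ((\<lambda>s. \<gamma> s $ i) has_field_derivative \<gamma>' $ i) (at s)) \<longrightarrow>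
      ((\<lambda>s. f (\<gamma> s)) has_field_derivative pairing (gradient f (\<gamma> s)) \<gamma>') (at s))"
proof -
  obtain G where G: "\<forall>i. polynomial (\<lambda>x. G x $ i)"
    "\<And>\<gamma> \<gamma>' s. (\<forall>i. ((\<lambda>s. \<gamma> s $ i) has_field_derivative \<gamma>' $ i) (at s)) \<Longrightarrow>
      ((\<lambda>s. f (\<gamma> s)) has_field_derivative pairing (G (\<gamma> s)) \<gamma>') (at s)"
    using polynomial_has_gradient[OF assms] by blast
  have "gradient f p = G p" for p
  proof -
    have "gradient f p $ i = G p $ i" for i
    proof -
      have "((\<lambda>t. f (p + t *s axis i 1)) has_field_derivative
          pairing (G (p + 0 *s axis i 1)) (axis i 1)) (at 0)"
        by (rule G(2)) (use line_has_derivative in blast)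
      then show ?thesis
        by (simp add: gradient_def DERIV_imp_deriv)
    qed
    then show ?thesis by (simp add: vec_eq_iff)
  qed
  then have "gradient f = G" by blast
  then show ?thesis using G by blast
qed

lemma polynomial_gradient [simp]: "polynomial f \<Longrightarrow> polynomial (\<lambda>x. gradient f x $ i)"
  using polynomial_gradient_aux by blast

lemma gradient_chain:
  assumes "polynomial f" "\<And>i. ((\<lambda>s. \<gamma> s $ i) has_field_derivative \<gamma>' $ i) (at s)"
  shows "((\<lambda>s. f (\<gamma> s)) has_field_derivative pairing (gradient f (\<gamma> s)) \<gamma>') (at s)"
  using polynomial_gradient_aux assms by blast

lemma gradient_line:
  assumes "polynomial f"
  shows "((\<lambda>t. f (p + t *s v)) has_field_derivative pairing (gradient f (p + t *s v)) v) (at t)"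
  using gradient_chain[OF assms, of "\<lambda>t. p + t *s v" v] line_has_derivative by blast

lemma gradient_eqI:
  assumes "\<And>v. ((\<lambda>t. f (p + t *s v)) has_field_derivative pairing G v) (at 0)"
  shows "gradient f p = G"
  using DERIV_imp_deriv[OF assms] by (simp add: gradient_def vec_eq_iff)

lemma gradient_const [simp]: "gradient (\<lambda>_. c) p = 0"
  by (rule gradient_eqI) simp

lemma gradient_pairing [simp]: "gradient (pairing u) p = u" "gradient (\<lambda>x. x $ i) p = axis i 1"
  by (rule gradient_eqI, auto intro!: derivative_eq_intros)+

lemma gradient_add:
  assumes "polynomial f" "polynomial g"
  shows "gradient (\<lambda>x. f x + g x) p = gradient f p + gradient g p"
  using DERIV_add[OF gradient_line[OF assms(1), of p _ 0] gradient_line[OF assms(2), of p _ 0]]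
  by (intro gradient_eqI) simp

lemma gradient_mult:
  assumes "polynomial f" "polynomial g"
  shows "gradient (\<lambda>x. f x * g x) p = g p *s gradient f p + f p *s gradient g p"
  using DERIV_mult[OF gradient_line[OF assms(1), of p _ 0] gradient_line[OF assms(2), of p _ 0]]
  by (intro gradient_eqI) (simp add: algebra_simps)

lemma gradient_cmult: "polynomial f \<Longrightarrow> gradient (\<lambda>x. c * f x) p = c *s gradient f p"
  using gradient_mult[of "\<lambda>_. c" f p] by simp

lemma gradient_diff:
  assumes "polynomial f" "polynomial g"
  shows "gradient (\<lambda>x. f x - g x) p = gradient f p - gradient g p"
  using DERIV_diff[OF gradient_line[OF assms(1), of p _ 0] gradient_line[OF assms(2), of p _ 0]]
  by (intro gradient_eqI) simp

lemma gradient_power: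
  assumes "polynomial f"
  shows "gradient (\<lambda>x. f x ^ k) p = (of_nat k * f p ^ (k - 1)) *s gradient f p"
  using DERIV_power[OF gradient_line[OF assms, of p _ 0], where n = k]
  by (intro gradient_eqI) (simp add: algebra_simps)

lemma gradient_Euler:
  assumes "homogeneous k f"
  shows "pairing (gradient f x) x = of_nat k * f x"
proof -
  have "((\<lambda>t. f (0 + t *s x)) has_field_derivative pairing (gradient f (0 + 1 *s x)) x) (at 1)"
    by (rule gradient_line[OF homogeneous_imp_polynomial[OF assms]])
  moreover have "((\<lambda>t. f (0 + t *s x)) has_field_derivative of_nat k * f x) (at 1)"
    unfolding add_0 homogeneousD[OF assms] by (auto intro!: derivative_eq_intros)
  ultimately show ?thesis using DERIV_unique by fastforce
qed

lemma gradient_scale: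
  assumes "homogeneous k f" "k > 0" "c \<noteq> 0"
  shows "gradient f (c *s x) = c ^ (k - 1) *s gradient f x"
proof (rule gradient_eqI)
  fix v
  have "((\<lambda>t. c ^ k * f (x + t *s ((1 / c) *s v))) has_field_derivative
      c ^ k * pairing (gradient f x) ((1 / c) *s v)) (at 0)"
    using DERIV_cmult[OF gradient_line[OF homogeneous_imp_polynomial[OF assms(1)], of x "(1 / c) *s v" 0]]
    by simp
  moreover have "c ^ k * f (x + t *s ((1 / c) *s v)) = f (c *s x + t *s v)" for t
    using assms(3) homogeneousD[OF assms(1), of c "x + t *s ((1 / c) *s v)"]
    by (simp add: vector_add_ldistrib)
  moreover have "c ^ k * pairing (gradient f x) ((1 / c) *s v) = pairing (c ^ (k - 1) *s gradient f x) v"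
    using assms(2,3) by (cases k) auto
  ultimately show "((\<lambda>t. f (c *s x + t *s v)) has_field_derivative
      pairing (c ^ (k - 1) *s gradient f x) v) (at 0)" by simp
qed

text \<open>
  Hadamard's lemma. The coefficient vector \<open>C\<close> is not the gradient off \<open>a\<close>, but as a polynomial map
  it detects the zeros of several such \<open>f\<close> near \<open>a\<close> by linear algebra.
\<close>
lemma polynomial_Hadamard:
  assumes "polynomial f"
  shows "\<exists>C. (\<forall>j. polynomial (\<lambda>x. C x $ j)) \<and> (\<forall>x. f x - f a = pairing (C x) (x - a)) \<and>
    C a = gradient f a"
  using assms
proof (induction rule: polynomial_induct)
  case (const c)
  show ?case by (rule exI[of _ "\<lambda>_. 0"]) simp
next
  case (coord i)
  show ?case by (rule exI[of _ "\<lambda>_. axis i 1"]) simp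
next
  case (add f g)
  then obtain C D where "\<forall>j. polynomial (\<lambda>x. C x $ j)" "\<forall>x. f x - f a = pairing (C x) (x - a)"
    "C a = gradient f a" "\<forall>j. polynomial (\<lambda>x. D x $ j)" "\<forall>x. g x - g a = pairing (D x) (x - a)"
    "D a = gradient g a" by blast
  moreover from this have "f x + g x - (f a + g a) = pairing (C x + D x) (x - a)" for x
    by (metis (no_types, lifting) add_diff_add pairing_linear(1))
  ultimately show ?case
    using gradient_add[OF add(1,2)] by (intro exI[of _ "\<lambda>x. C x + D x"]) auto
next
  case (mult f g)
  then obtain C D where CD: "\<forall>j. polynomial (\<lambda>x. C x $ j)" "\<forall>x. f x - f a = pairing (C x) (x - a)"
    "C a = gradient f a" "\<forall>j. polynomial (\<lambda>x. D x $ j)" "\<forall>x. g x - g a = pairing (D x) (x - a)"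
    "D a = gradient g a" by blast
  have "f x * g x - f a * g a = pairing (g x *s C x + f a *s D x) (x - a)" for x
  proof -
    have "f x * g x - f a * g a = g x * (f x - f a) + f a * (g x - g a)" by algebra
    then show ?thesis using CD(2,5) by (simp del: pairing_linear(4))
  qed
  then show ?case
    using mult(1,2) CD by (intro exI[of _ "\<lambda>x. g x *s C x + f a *s D x"])
      (auto simp: gradient_mult intro!: polynomial_add polynomial_mult)
qed

section \<open>Linear algebra of the pairing\<close>

lemma matrix_vector_mult_pairing: "(M *v v) $ i = pairing (M $ i) v"
  by (simp add: matrix_vector_mult_def pairing_def)

lemma subspace_pairing_kernel: "vec.subspace {v. \<forall>u\<in>N. pairing u v = 0}"
  by (rule vec.subspaceI) auto

lemma separating_functional:
  fixes W :: "(complex ^ 'n) set"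
  assumes W: "vec.subspace W" and x: "x \<notin> W"
  obtains u where "\<And>w. w \<in> W \<Longrightarrow> pairing u w = 0" "pairing u x = 1"
proof -
  obtain B where B: "B \<subseteq> W" "vec.independent B" "W \<subseteq> vec.span B" "card B = vec.dim W"
    using vec.basis_exists by metis
  have spanB: "vec.span B = W"
    using B(1,3) W by (metis vec.span_minimal subset_antisym)
  then have ind: "vec.independent (insert x B)"
    using x B(2) by (simp add: vec.independent_insert)
  define i0 where "i0 = (undefined :: 'n)"
  obtain g where g: "Vector_Spaces.linear (*s) (*s) g"
    "\<forall>b\<in>insert x B. g b = (if b = x then axis i0 1 else 0 :: complex ^ 'n)"
    using vec.linear_independent_extend[OF ind, of "\<lambda>b. if b = x then axis i0 1 else 0"] by blast
  define u where "u = (matrix g) $ i0"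
  have u: "pairing u y = g y $ i0" for y
    unfolding u_def matrix_vector_mult_pairing[symmetric] using matrix_works[OF g(1)] by simp
  have "pairing u w = 0" if "w \<in> W" for w
  proof -
    have "w \<in> vec.span B" using that spanB by simp
    then show ?thesis
    proof (induction rule: vec.span_induct)
      case base
      then show ?case by (rule vec.subspaceI[unfolded mem_Collect_eq]; simp)
    next
      case (step b)
      then have "b \<noteq> x" using x B(1) by blast
      then show ?case using g(2) step by (simp add: u)
    qed
  qed
  moreover have "pairing u x = 1"
    using g(2) by (simp add: u axis_def)
  ultimately show thesis using that by blast
qed

text \<open>
  A basis of a space \<open>N\<close> of functionals, completed to a basis of the dual space, gives coordinates
  in which the common kernel of \<open>N\<close> is a coordinate subspace.
\<close>
lemma adapted_matrix:
  fixes N :: "(complex ^ 'n) set"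
  assumes N: "vec.subspace N"
  obtains M :: "complex ^ 'n ^ 'n" and K where "invertible M" "\<And>i. i \<in> K \<Longrightarrow> M $ i \<in> N"
    "{v. \<forall>u\<in>N. pairing u v = 0} = {v. \<forall>i\<in>K. pairing (M $ i) v = 0}"
proof -
  obtain B where B: "B \<subseteq> N" "vec.independent B" "N \<subseteq> vec.span B" "card B = vec.dim N"
    using vec.basis_exists by metis
  obtain B' where B': "B \<subseteq> B'" "vec.independent B'" "(UNIV :: (complex ^ 'n) set) \<subseteq> vec.span B'"
    using vec.maximal_independent_subset_extend[OF subset_UNIV B(2)] by metis
  have "card B' = CARD('n)" "finite B'"
    using vec.basis_card_eq_dim[of B' UNIV] B' vec_dim_card[where 'a=complex and 'n='n]
      vec.finiteI_independent by auto
  then obtain \<phi> where \<phi>: "bij_betw \<phi> (UNIV :: 'n set) B'"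
    by (metis finite_same_card_bij finite_UNIV finite)
  define M where "M = (\<chi> i. \<phi> i)"
  define K where "K = {i. \<phi> i \<in> B}"
  have "rows M = B'"
    using \<phi> by (auto simp: rows_def row_def M_def bij_betw_def vec_nth_inverse)
  then have "invertible M"
    using matrix_left_invertible_span_rows_gen[of M] B'(3) invertible_left_inverse by blast
  moreover have "M $ i \<in> N" if "i \<in> K" for i
    using that B(1) by (auto simp: M_def K_def)
  moreover have "{v. \<forall>u\<in>N. pairing u v = 0} = {v. \<forall>i\<in>K. pairing (M $ i) v = 0}" (is "?L = ?R")
  proof
    show "?L \<subseteq> ?R" using calculation(2) by blast
    show "?R \<subseteq> ?L"
    proof safe
      fix v u assume v: "\<forall>i\<in>K. pairing (M $ i) v = 0" and "u \<in> N"
      then have "u \<in> vec.span B" using B(3) by blast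
      then show "pairing u v = 0"
      proof (induction rule: vec.span_induct)
        case base
        show ?case by (rule vec.subspaceI[unfolded mem_Collect_eq]; simp)
      next
        case (step b)
        then obtain i where "b = \<phi> i" using \<phi> B'(1) by (metis bij_betw_iff_bijections subsetD)
        then show ?case using v step by (simp add: K_def M_def)
      qed
    qed
  qed
  ultimately show thesis using that by blast
qed

lemma dim_pairing_kernel:
  fixes M :: "complex ^ 'n ^ 'n"
  assumes "invertible M"
  shows "vec.dim {v. \<forall>i\<in>K. pairing (M $ i) v = 0} = card (- K)"
proof -
  have "(*v) M ` {v. \<forall>i\<in>K. pairing (M $ i) v = 0} = {y. \<forall>i. i \<notin> - K \<longrightarrow> y $ i = 0}"
  proof safe
    fix y :: "complex ^ 'n" assume y: "\<forall>i. i \<notin> - K \<longrightarrow> y $ i = 0"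
    obtain A where A: "M ** A = mat 1" using assms invertible_def by blast
    have My: "M *v (A *v y) = y" by (simp add: matrix_vector_mul_assoc A)
    then have "\<forall>i\<in>K. pairing (M $ i) (A *v y) = 0"
      using y by (metis ComplD matrix_vector_mult_pairing)
    then show "y \<in> (*v) M ` {v. \<forall>i\<in>K. pairing (M $ i) v = 0}"
      using My by (intro image_eqI[of _ _ "A *v y"]) simp_all
  qed (simp add: matrix_vector_mult_pairing)
  moreover have "inj ((*v) M)"
    using assms invertible_left_inverse matrix_left_invertible_injective by blast
  then have inj: "inj_on ((*v) M) (vec.span {v. \<forall>i\<in>K. pairing (M $ i) v = 0})"
    by (rule inj_on_subset) simp
  have lin: "Vector_Spaces.linear (*s) (*s) ((*v) M)" by simp
  note vec.dim_image_eq[OF lin inj]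
  ultimately show ?thesis
    using dim_substandard_cart[of "- K", where 'a=complex] by simp
qed

lemma invertible_iff_kernel:
  fixes M :: "complex ^ 'n ^ 'n"
  shows "det M \<noteq> 0 \<longleftrightarrow> (\<forall>v. (\<forall>i. pairing (M $ i) v = 0) \<longrightarrow> v = 0)"
proof -
  have "M *v v = 0 \<longleftrightarrow> (\<forall>i. pairing (M $ i) v = 0)" for v
    by (simp add: vec_eq_iff matrix_vector_mult_pairing)
  then show ?thesis
    using invertible_det_nz invertible_left_inverse matrix_left_invertible_ker by metis
qed

lemma polynomial_det:
  assumes "\<And>i j. polynomial (\<lambda>x. A x $ i $ j)"
  shows "polynomial (\<lambda>x. det (A x))"
  unfolding det_def using assms by (intro polynomial_sum polynomial_mult polynomial_prod) auto

section \<open>Projective sets and their cones\<close>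

lemma span_singleton_iff: "w \<in> vec.span {v} \<longleftrightarrow> (\<exists>c. w = c *s v)" for v :: "complex ^ 'n"
  by (auto simp: vec.span_singleton)

lemma span_singleton_eq:
  fixes v w :: "complex ^ 'n"
  assumes "v \<noteq> 0" "w \<noteq> 0"
  shows "vec.span {v} = vec.span {w} \<longleftrightarrow> (\<exists>c. w = c *s v)"
proof
  assume "vec.span {v} = vec.span {w}"
  then show "\<exists>c. w = c *s v"
    using vec.span_base[of w "{w}"] span_singleton_iff by blast
next
  assume "\<exists>c. w = c *s v"
  then obtain c where c: "w = c *s v" by blast
  then have "c \<noteq> 0" using assms(2) by auto
  then have "v = (1 / c) *s w" using c by simp
  then have "v \<in> vec.span {w}" "w \<in> vec.span {v}"
    using c span_singleton_iff by blast+
  then show "vec.span {v} = vec.span {w}"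
    by (simp add: vec.span_eq)
qed

lemma proj_zeros_span_iff:
  assumes "\<forall>f\<in>S. \<exists>k. homogeneous k f" "v \<noteq> 0"
  shows "vec.span {v} \<in> proj_zeros S \<longleftrightarrow> (\<forall>f\<in>S. f v = 0)"
proof -
  have "(\<forall>w\<in>vec.span {v}. f w = 0) \<longleftrightarrow> f v = 0" if f: "f \<in> S" for f
  proof -
    obtain k where k: "homogeneous k f" using assms(1) f by blast
    show ?thesis
    proof
      assume "f v = 0"
      then show "\<forall>w\<in>vec.span {v}. f w = 0"
        using homogeneousD[OF k] by (auto simp: span_singleton_iff)
    qed (use vec.span_base[of v "{v}"] in blast)
  qed
  then show ?thesis
    using assms(2) by (auto simp: proj_zeros_def proj_space_def)
qed

lemma proj_zeros_subset: "proj_zeros S \<subseteq> proj_space"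
  by (auto simp: proj_zeros_def)

lemma proj_closed_subset: "proj_closed X \<Longrightarrow> X \<subseteq> proj_space"
  by (auto simp: proj_closed_def proj_zeros_def)

lemma affine_cone_iff:
  assumes "X \<subseteq> proj_space" "x \<noteq> 0"
  shows "x \<in> affine_cone X \<longleftrightarrow> vec.span {x} \<in> X"
proof
  assume "x \<in> affine_cone X"
  then obtain p where p: "p \<in> X" "x \<in> p" using assms(2) by (auto simp: affine_cone_def)
  then obtain v where v: "p = vec.span {v}" "v \<noteq> 0" using assms(1) by (auto simp: proj_space_def)
  then show "vec.span {x} \<in> X"
    using p span_singleton_eq[OF v(2) assms(2)] span_singleton_iff by metis
next
  assume "vec.span {x} \<in> X"
  then show "x \<in> affine_cone X"
    using vec.span_base[of x "{x}"] by (auto simp: affine_cone_def)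
qed

lemma affine_cone_scale:
  assumes "X \<subseteq> proj_space" "x \<in> affine_cone X"
  shows "c *s x \<in> affine_cone X"
proof (cases "x = 0 \<or> c = 0")
  case True
  then show ?thesis by (auto simp: affine_cone_def)
next
  case False
  then have "vec.span {c *s x} = vec.span {x}"
    using span_singleton_eq[of x "c *s x"] by auto
  then show ?thesis
    using False assms(2) affine_cone_iff[OF assms(1), of x] affine_cone_iff[OF assms(1), of "c *s x"]
    by simp
qed

lemma vanishing_idealD: "f \<in> vanishing_ideal X \<Longrightarrow> x \<in> affine_cone X \<Longrightarrow> f x = 0"
  by (simp add: vanishing_ideal_def)

lemma vanishing_ideal_polynomial: "f \<in> vanishing_ideal X \<Longrightarrow> polynomial f"
  by (simp add: vanishing_ideal_def)

lemma vanishing_ideal_components: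
  assumes X: "X \<subseteq> proj_space" and f: "f \<in> vanishing_ideal X" and x: "f x \<noteq> 0"
  obtains k h where "homogeneous k h" "h \<in> vanishing_ideal X" "h x \<noteq> 0"
proof -
  obtain p N where p: "\<And>j. homogeneous j (\<lambda>x. coeff (p x) j)" "\<And>x. degree (p x) \<le> N"
    "\<And>x t. poly (p x) t = f (t *s x)"
    using homogeneous_components[OF vanishing_ideal_polynomial[OF f]] by blast
  have "p y = 0" if "y \<in> affine_cone X" for y
    using vanishing_idealD[OF f affine_cone_scale[OF X that]] p(3) by (metis poly_all_0_iff_0)
  then have I: "(\<lambda>x. coeff (p x) j) \<in> vanishing_ideal X" for j
    using homogeneous_imp_polynomial[OF p(1)] by (simp add: vanishing_ideal_def)
  have "poly (p x) 1 \<noteq> 0" using p(3) x by simp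
  then have "p x \<noteq> 0" by auto
  then obtain j where "coeff (p x) j \<noteq> 0" by (metis leading_coeff_0_iff)
  then show thesis using that[OF p(1) I] by blast
qed

lemma mem_affine_cone_iff:
  assumes X: "proj_closed X" "X \<noteq> {}"
  shows "x \<in> affine_cone X \<longleftrightarrow> (\<forall>f\<in>vanishing_ideal X. f x = 0)"
proof (cases "x = 0")
  case True
  then show ?thesis by (auto simp: affine_cone_def vanishing_ideal_def)
next
  case False
  obtain S where S: "\<forall>f\<in>S. \<exists>k. homogeneous k f" "X = proj_zeros S"
    using X(1) unfolding proj_closed_def by blast
  obtain v where v: "v \<noteq> 0" "vec.span {v} \<in> X"
    using X(2) S(2) by (auto simp: proj_zeros_def proj_space_def)
  have "f \<in> vanishing_ideal X" if f: "f \<in> S" for f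
  proof -
    obtain k where k: "homogeneous k f" using S(1) f by blast
    have "f y = 0" if "y \<in> affine_cone X" "y \<noteq> 0" for y
      using that affine_cone_iff[OF proj_closed_subset[OF X(1)]] proj_zeros_span_iff[OF S(1)] f S(2)
      by blast
    moreover have "f v = 0" using v proj_zeros_span_iff[OF S(1)] f S(2) by blast
    then have "f 0 = 0" using homogeneousD[OF k, of 0 v] by simp
    ultimately show ?thesis
      using homogeneous_imp_polynomial[OF k] by (auto simp: vanishing_ideal_def)
  qed
  then show ?thesis
    using False affine_cone_iff[OF proj_closed_subset[OF X(1)] False] proj_zeros_span_iff[OF S(1) False]
      S(2) vanishing_idealD by blast
qed

lemma proj_closed_zeros: "\<forall>f\<in>S. \<exists>k. homogeneous k f \<Longrightarrow> proj_closed (proj_zeros S)"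
  unfolding proj_closed_def by blast

lemma proj_closed_Int: "proj_closed A \<Longrightarrow> proj_closed B \<Longrightarrow> proj_closed (A \<inter> B)"
proof -
  assume "proj_closed A" "proj_closed B"
  then obtain S T where "\<forall>f\<in>S. \<exists>k. homogeneous k f" "A = proj_zeros S"
    "\<forall>f\<in>T. \<exists>k. homogeneous k f" "B = proj_zeros T" unfolding proj_closed_def by blast
  moreover have "proj_zeros S \<inter> proj_zeros T = proj_zeros (S \<union> T)"
    by (auto simp: proj_zeros_def)
  ultimately show ?thesis using proj_closed_zeros[of "S \<union> T"] by auto
qed

lemma proj_closed_subspace:
  assumes "vec.subspace W"
  shows "proj_closed {vec.span {v} | v. v \<in> W \<and> v \<noteq> 0}" (is "proj_closed ?L")
proof -
  define S where "S = {pairing u | u. \<forall>w\<in>W. pairing u w = 0}"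
  have S: "\<forall>f\<in>S. \<exists>k. homogeneous k f"
    unfolding S_def using homogeneous_pairing by blast
  have "vec.span {v} \<in> proj_zeros S \<longleftrightarrow> v \<in> W" if "v \<noteq> 0" for v
    using proj_zeros_span_iff[OF S that] separating_functional[OF assms, of v] unfolding S_def
    by (smt (verit, ccfv_threshold) mem_Collect_eq zero_neq_one)
  then have "?L = proj_zeros S"
    using proj_zeros_subset[of S] unfolding proj_space_def by blast
  then show ?thesis using proj_closed_zeros[OF S] by simp
qed

text \<open>
  If \<open>Z\<close> were the union of two smaller closed sets, a form of each that does not vanish on \<open>Z\<close> would
  contradict the primality.
\<close>
lemma proj_irreducibleI:
  assumes Z: "proj_closed Z" "Z \<noteq> {}"
    and prime: "\<And>j k f g. homogeneous j f \<Longrightarrow> homogeneous k g \<Longrightarrow>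
      (\<And>v. v \<noteq> 0 \<Longrightarrow> vec.span {v} \<in> Z \<Longrightarrow> f v * g v = 0) \<Longrightarrow>
      (\<forall>v. v \<noteq> 0 \<longrightarrow> vec.span {v} \<in> Z \<longrightarrow> f v = 0) \<or> (\<forall>v. v \<noteq> 0 \<longrightarrow> vec.span {v} \<in> Z \<longrightarrow> g v = 0)"
  shows "proj_irreducible Z"
  unfolding proj_irreducible_def
proof (intro conjI allI impI Z)
  fix A B assume AB: "proj_closed A \<and> proj_closed B \<and> Z = A \<union> B"
  obtain S where S: "\<forall>f\<in>S. \<exists>k. homogeneous k f" "A = proj_zeros S"
    using AB unfolding proj_closed_def by blast
  obtain T where T: "\<forall>f\<in>T. \<exists>k. homogeneous k f" "B = proj_zeros T"
    using AB unfolding proj_closed_def by blast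
  have sub: "p \<in> Z \<Longrightarrow> \<exists>v. v \<noteq> 0 \<and> p = vec.span {v}" for p
    using proj_closed_subset[OF Z(1)] unfolding proj_space_def by blast
  show "Z = A \<or> Z = B"
  proof (rule ccontr)
    assume "\<not> (Z = A \<or> Z = B)"
    then have "\<not> Z \<subseteq> A" "\<not> Z \<subseteq> B" using AB by auto
    then obtain v w where v: "v \<noteq> 0" "vec.span {v} \<in> Z" "vec.span {v} \<notin> A"
      and w: "w \<noteq> 0" "vec.span {w} \<in> Z" "vec.span {w} \<notin> B"
      using sub by blast
    obtain f where f: "f \<in> S" "f v \<noteq> 0"
      using v S(2) proj_zeros_span_iff[OF S(1)] by blast
    obtain g where g: "g \<in> T" "g w \<noteq> 0"
      using w T(2) proj_zeros_span_iff[OF T(1)] by blast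
    have "f z * g z = 0" if "z \<noteq> 0" "vec.span {z} \<in> Z" for z
      using that AB S(2) T(2) proj_zeros_span_iff[OF S(1)] proj_zeros_span_iff[OF T(1)] f(1) g(1)
      by (metis UnE mult_eq_0_iff)
    moreover obtain j k where "homogeneous j f" "homogeneous k g" using S(1) T(1) f(1) g(1) by blast
    ultimately show False using prime v w f g by blast
  qed
qed

lemma proj_irreducible_subspace:
  assumes W: "vec.subspace W" and w: "w \<in> W" "w \<noteq> 0"
  shows "proj_irreducible {vec.span {v} | v. v \<in> W \<and> v \<noteq> 0}" (is "proj_irreducible ?L")
proof (rule proj_irreducibleI)
  show "proj_closed ?L" by (rule proj_closed_subspace[OF W])
  show "?L \<noteq> {}" using w by blast
  have mem: "vec.span {v} \<in> ?L \<longleftrightarrow> v \<in> W" if "v \<noteq> 0" for v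
    using that span_singleton_eq[OF that] vec.subspace_scale[OF W]
      span_singleton_eq[OF _ that] by (smt (verit) mem_Collect_eq)
  fix j k f g
  assume f: "homogeneous j f" and g: "homogeneous k g"
    and "\<And>v. v \<noteq> 0 \<Longrightarrow> vec.span {v} \<in> ?L \<Longrightarrow> f v * g v = 0"
  then have fg: "f v * g v = 0" if "v \<in> W" "v \<noteq> 0" for v using mem that by blast
  have "f 0 * g 0 = 0"
    using fg[OF w] homogeneousD[OF f, of 0 w] homogeneousD[OF g, of 0 w] by auto
  with fg have fg: "f v * g v = 0" if "v \<in> W" for v using that by (cases "v = 0") auto
  have "a + t *s (b - a) \<in> W" if "a \<in> W" "b \<in> W" for a b t
    by (intro vec.subspace_add[OF W] vec.subspace_scale[OF W] vec.subspace_diff[OF W] that)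
  then have "(\<forall>v\<in>W. f v = 0) \<or> (\<forall>v\<in>W. g v = 0)"
    using fg by (intro polynomial_mult_zero_on homogeneous_imp_polynomial[OF f]
        homogeneous_imp_polynomial[OF g]) blast+
  then show "(\<forall>v. v \<noteq> 0 \<longrightarrow> vec.span {v} \<in> ?L \<longrightarrow> f v = 0) \<or> (\<forall>v. v \<noteq> 0 \<longrightarrow> vec.span {v} \<in> ?L \<longrightarrow> g v = 0)"
    using mem by blast
qed

lemma proj_irreducible_point:
  assumes "P \<in> proj_space"
  shows "proj_irreducible {P}"
proof -
  obtain v where v: "v \<noteq> 0" "P = vec.span {v}" using assms by (auto simp: proj_space_def)
  have "vec.span {w} = P" if "w \<in> vec.span {v}" "w \<noteq> 0" for w
    using v span_singleton_eq[OF v(1) that(2)] span_singleton_iff that(1) by metis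
  then have "{vec.span {w} | w. w \<in> vec.span {v} \<and> w \<noteq> 0} = {P}"
    using v vec.span_base[of v "{v}"] by blast
  then show ?thesis
    using proj_irreducible_subspace[of "vec.span {v}" v] v vec.span_base[of v "{v}"] by simp
qed

lemma proj_closure_eq:
  assumes "P \<subseteq> proj_space"
  shows "proj_closure P = proj_zeros {f. (\<exists>k. homogeneous k f) \<and> (\<forall>p\<in>P. \<forall>v\<in>p. f v = 0)}" (is "_ = proj_zeros ?S")
proof
  have "proj_closed (proj_zeros ?S)" by (rule proj_closed_zeros) blast
  moreover have "P \<subseteq> proj_zeros ?S" using assms by (auto simp: proj_zeros_def)
  ultimately show "proj_closure P \<subseteq> proj_zeros ?S"
    unfolding proj_closure_def by blast
  show "proj_zeros ?S \<subseteq> proj_closure P"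
    unfolding proj_closure_def
  proof (intro Inter_greatest)
    fix Z assume "Z \<in> {Z. proj_closed Z \<and> P \<subseteq> Z}"
    then obtain T where "\<forall>f\<in>T. \<exists>k. homogeneous k f" "Z = proj_zeros T" "P \<subseteq> Z"
      unfolding proj_closed_def by blast
    then have "T \<subseteq> ?S" by (auto simp: proj_zeros_def)
    then show "proj_zeros ?S \<subseteq> Z"
      unfolding \<open>Z = proj_zeros T\<close> proj_zeros_def by blast
  qed
qed

section \<open>Irreducible curves\<close>

lemma irreducible_curveD:
  assumes "irreducible_curve X"
  shows "proj_closed X" "X \<noteq> {}" "X \<subseteq> proj_space"
  using assms proj_closed_subset by (auto simp: irreducible_curve_def proj_irreducible_def)

text \<open>Otherwise a point, \<open>Z\<close> and \<open>X\<close> would form a chain of length two.\<close>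
lemma irreducible_subset_curve:
  assumes X: "irreducible_curve X" and Z: "proj_irreducible Z" "Z \<subseteq> X"
    and PQ: "P \<in> Z" "Q \<in> Z" "P \<noteq> Q"
  shows "Z = X"
proof (rule ccontr)
  assume "Z \<noteq> X"
  define c where "c = (\<lambda>i::nat. if i = 0 then {P} else if i = 1 then Z else X)"
  have "P \<in> proj_space" using PQ(1) Z(2) irreducible_curveD(3)[OF X] by blast
  then have "\<forall>i\<le>2. proj_irreducible (c i) \<and> c i \<subseteq> X"
    using proj_irreducible_point X Z PQ by (auto simp: c_def irreducible_curve_def)
  moreover have "\<forall>i<2. c i \<subset> c (Suc i)"
    using PQ Z(2) \<open>Z \<noteq> X\<close> by (auto simp: c_def less_Suc_eq numeral_2_eq_2)
  ultimately have "enat 2 \<le> proj_dim X"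
    unfolding proj_dim_def by (intro Sup_upper) blast
  moreover have "proj_dim X = enat 1" using X by (simp add: irreducible_curve_def one_enat_def)
  ultimately show False by simp
qed

lemma curve_two_points:
  assumes X: "irreducible_curve X"
  obtains P Q where "P \<in> X" "Q \<in> X" "P \<noteq> Q"
proof -
  let ?S = "{enat k | k. \<exists>Z :: nat \<Rightarrow> _.
     (\<forall>i\<le>k. proj_irreducible (Z i) \<and> Z i \<subseteq> X) \<and> (\<forall>i<k. Z i \<subset> Z (Suc i))}"
  have "Sup ?S = 1" using X unfolding irreducible_curve_def proj_dim_def by blast
  then have "\<not> Sup ?S \<le> 0" by simp
  then obtain k where "k \<in> ?S" "\<not> k \<le> 0" by (meson Sup_least)
  then obtain n and Z :: "nat \<Rightarrow> _" where "n > 0" "\<forall>i\<le>n. proj_irreducible (Z i) \<and> Z i \<subseteq> X"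
    "\<forall>i<n. Z i \<subset> Z (Suc i)" by (auto simp: zero_enat_def)
  then have "Z 0 \<noteq> {}" "Z 0 \<subset> Z 1" "Z 1 \<subseteq> X" by (auto simp: proj_irreducible_def)
  then show thesis using that by blast
qed

lemma generic_card_eq:
  assumes "generically (\<lambda>u. finite (S u) \<and> card (S u) = m)"
  shows "generic_card S = m"
proof -
  have "m' = m" if "generically (\<lambda>u. finite (S u) \<and> card (S u) = m')" for m'
    using generically_ex[OF generically_conj[OF that assms]] by auto
  then have "(THE m. generically (\<lambda>u. finite (S u) \<and> card (S u) = m)) = m"
    using assms by blast
  then show ?thesis using assms unfolding generic_card_def by auto
qed

lemma generic_card_eqD:
  assumes "generic_card S = m" "m \<noteq> 0"
  shows "generically (\<lambda>u. finite (S u) \<and> card (S u) = m)"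
proof -
  obtain m' where "generically (\<lambda>u. finite (S u) \<and> card (S u) = m')"
    using assms unfolding generic_card_def by presburger
  then show ?thesis using generic_card_eq assms(1) by metis
qed

text \<open>A curve that contains a line is that line, which has degree one.\<close>
lemma line_not_subset_curve:
  assumes X: "irreducible_curve X" and deg: "curve_degree X > 1"
    and w: "w1 \<noteq> 0" "w2 \<notin> vec.span {w1}"
  shows "\<not> vec.span {w1, w2} \<subseteq> affine_cone X"
proof
  assume sub: "vec.span {w1, w2} \<subseteq> affine_cone X"
  let ?W = "vec.span {w1, w2}"
  have w2: "w2 \<noteq> 0" using w(2) vec.span_zero by blast
  have mem: "w1 \<in> ?W" "w2 \<in> ?W" by (auto intro: vec.span_base)
  have W: "?W = {a *s w1 + b *s w2 | a b. True}"
    by (auto simp: vec.span_insert span_singleton_iff algebra_simps)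
  let ?L = "{vec.span {v} | v. v \<in> ?W \<and> v \<noteq> 0}"
  have "?L \<subseteq> X"
    using sub affine_cone_iff[OF irreducible_curveD(3)[OF X]] by blast
  moreover have "vec.span {w1} \<noteq> vec.span {w2}"
    using w(2) vec.span_base[of w2 "{w2}"] by blast
  moreover have "proj_irreducible ?L"
    by (rule proj_irreducible_subspace[OF _ mem(1) w(1)]) simp
  ultimately have "?L = X"
    using irreducible_subset_curve[OF X, of ?L "vec.span {w1}" "vec.span {w2}"] w(1) w2 mem by blast
  have "{p \<in> X. \<forall>v\<in>p. pairing u v = 0} = {vec.span {pairing u w2 *s w1 - pairing u w1 *s w2}}"
    if u: "pairing u w1 \<noteq> 0" for u
  proof -
    let ?v = "pairing u w2 *s w1 - pairing u w1 *s w2"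
    have nz: "?v \<noteq> 0"
    proof
      assume "?v = 0"
      then have "w2 = (pairing u w2 / pairing u w1) *s w1"
        using u by (simp add: vec_eq_iff field_simps)
      then show False using w(2) span_singleton_iff by blast
    qed
    have "?v \<in> ?W" by (auto intro!: vec.span_diff vec.span_scale mem)
    then have "vec.span {?v} \<in> X" using nz \<open>?L = X\<close> by blast
    moreover have "p = vec.span {?v}" if p: "p \<in> X" "\<forall>v\<in>p. pairing u v = 0" for p
    proof -
      obtain v where v: "p = vec.span {v}" "v \<in> ?W" "v \<noteq> 0" using p(1) \<open>?L = X\<close> by blast
      then obtain a b where ab: "v = a *s w1 + b *s w2" using W by blast
      have "pairing u v = 0" using p(2) v(1) vec.span_base by blast
      then have a: "a = - b * pairing u w2 / pairing u w1"
        using u by (simp add: ab field_simps) (metis add.inverse_unique add.commute)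
      then have "v = (- b / pairing u w1) *s ?v"
        using u by (simp add: ab a vec_eq_iff field_simps)
      then show ?thesis using v nz span_singleton_eq[OF nz v(3)] by metis
    qed
    moreover have "\<forall>w\<in>vec.span {?v}. pairing u w = 0"
      by (auto simp: span_singleton_iff)
    ultimately show ?thesis by blast
  qed
  then have "generically (\<lambda>u. finite {p \<in> X. \<forall>v\<in>p. pairing u v = 0} \<and>
      card {p \<in> X. \<forall>v\<in>p. pairing u v = 0} = 1)"
    unfolding generically_def using pairing_nonzero[OF w(1)]
    by (intro exI[of _ "\<lambda>u. pairing u w1"]) (auto, metis zero_neq_one)
  then have "curve_degree X = 1"
    unfolding curve_degree_def by (rule generic_card_eq)
  with deg show False by simp
qed

lemma finite_line_curve:
  assumes X: "irreducible_curve X" and deg: "curve_degree X > 1"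
    and w: "w1 \<noteq> 0" "w2 \<notin> vec.span {w1}"
  shows "finite {t. w1 + t *s w2 \<in> affine_cone X}"
proof -
  obtain x where x: "x \<in> vec.span {w1, w2}" "x \<notin> affine_cone X"
    using line_not_subset_curve[OF X deg w] by blast
  obtain b where "x - b *s w1 \<in> vec.span {w2}"
    using x(1) by (auto simp: vec.span_insert)
  then obtain c where xc: "x = b *s w1 + c *s w2"
    by (auto simp: span_singleton_iff) (metis add.commute diff_add_cancel)
  obtain f where "f \<in> vanishing_ideal X" "f x \<noteq> 0"
    using x(2) mem_affine_cone_iff[OF irreducible_curveD(1,2)[OF X]] by blast
  then obtain k h where h: "homogeneous k h" "h \<in> vanishing_ideal X" "h x \<noteq> 0"
    using vanishing_ideal_components[OF irreducible_curveD(3)[OF X]] by metis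
  have hp: "polynomial h" using h(1) homogeneous_imp_polynomial by blast
  have "h (c *s w2 + b *s w1) \<noteq> 0" using h(3) xc by (simp add: add.commute)
  then have "finite {t. h (c *s w2 + t *s w1) = 0}"
    using finite_zeros_on_line[OF hp] by blast
  then have "finite (insert 0 {t. h (c *s w2 + t *s w1) = 0})" by simp
  then obtain t where t: "t \<noteq> 0" "h (c *s w2 + t *s w1) \<noteq> 0"
    using ex_new_if_finite[OF infinite_UNIV_char_0] by (metis (mono_tags, lifting) insertCI mem_Collect_eq)
  have "h (c *s w2 + t *s w1) = t ^ k * h (w1 + (c / t) *s w2)"
    using homogeneousD[OF h(1), of t "w1 + (c / t) *s w2"] t(1)
    by (simp add: vector_add_ldistrib add.commute)
  then have "h (w1 + (c / t) *s w2) \<noteq> 0" using t by auto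
  then have "finite {t. h (w1 + t *s w2) = 0}" using finite_zeros_on_line[OF hp] by blast
  then show ?thesis
    by (rule finite_subset[rotated]) (use vanishing_idealD[OF h(2)] in blast)
qed

section \<open>Holomorphic arcs on a curve\<close>

text \<open>
  The following two lemmas play the part of irreducibility: a condition that is a product of
  holomorphic conditions along an arc holds because one of its factors holds identically.
\<close>
lemma holomorphic_mult_zero:
  assumes S: "open S" "connected S" and fg: "f holomorphic_on S" "g holomorphic_on S"
    "\<And>s. s \<in> S \<Longrightarrow> f s * g s = 0"
  shows "(\<forall>s\<in>S. f s = 0) \<or> (\<forall>s\<in>S. g s = 0)"
proof (rule ccontr)
  assume "\<not> ?thesis"
  then obtain a where a: "a \<in> S" "f a \<noteq> 0" and ng: "\<not> (\<forall>s\<in>S. g s = 0)" by blast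
  have "open (S \<inter> f -` (- {0}))"
    using continuous_open_preimage[OF holomorphic_on_imp_continuous_on[OF fg(1)] S(1)] by blast
  then have "g s = 0" if "s \<in> S" for s
    using analytic_continuation_open[of "S \<inter> f -` (- {0})" S g "\<lambda>_. 0" s] S fg(2,3) a that by auto
  with ng show False by blast
qed

lemma holomorphic_prod_zero:
  assumes S: "open S" "connected S" and "finite R" "\<And>r. r \<in> R \<Longrightarrow> f r holomorphic_on S"
    "\<And>s. s \<in> S \<Longrightarrow> (\<Prod>r\<in>R. f r s) = 0" and "S \<noteq> {}"
  shows "\<exists>r\<in>R. \<forall>s\<in>S. f r s = 0"
  using assms(3-)
proof (induction R)
  case (insert a R)
  have "(\<forall>s\<in>S. f a s = 0) \<or> (\<forall>s\<in>S. (\<Prod>r\<in>R. f r s) = 0)"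
    using insert.prems(2) insert.hyps insert.prems(1)
    by (intro holomorphic_mult_zero[OF S]) (auto intro!: holomorphic_intros)
  then show ?case using insert by (metis insertCI)
qed auto

text \<open>The quotient \<open>b / a\<close> is locally constant where \<open>a\<close> has no zero; the identity theorem does the rest.\<close>
lemma wronskian_zero:
  fixes a b :: "complex \<Rightarrow> complex"
  assumes S: "open S" "connected S" and a: "\<And>s. s \<in> S \<Longrightarrow> (a has_field_derivative a' s) (at s)"
    and b: "\<And>s. s \<in> S \<Longrightarrow> (b has_field_derivative b' s) (at s)"
    and w: "\<And>s. s \<in> S \<Longrightarrow> a s * b' s = a' s * b s" and s1: "s1 \<in> S" "a s1 \<noteq> 0" and s: "s \<in> S"
  shows "b s = (b s1 / a s1) * a s"
proof -
  have hol: "a holomorphic_on S" "b holomorphic_on S"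
    using a b S(1) holomorphic_on_open by blast+
  have "open (S \<inter> a -` (- {0}))"
    using continuous_open_preimage[OF holomorphic_on_imp_continuous_on[OF hol(1)] S(1)] by blast
  then obtain e where e: "e > 0" "ball s1 e \<subseteq> S \<inter> a -` (- {0})"
    using s1 openE by (metis (no_types, lifting) ComplI IntI singletonD vimageI)
  have "\<exists>c. \<forall>x\<in>ball s1 e. b x / a x = c"
  proof (rule has_field_derivative_zero_constant[OF convex_ball])
    fix x assume "x \<in> ball s1 e"
    then have x: "x \<in> S" "a x \<noteq> 0" using e by auto
    have "((\<lambda>x. b x / a x) has_field_derivative (b' x * a x - b x * a' x) / (a x * a x)) (at x)"
      using DERIV_divide[OF b[OF x(1)] a[OF x(1)] x(2)] .
    moreover have "b' x * a x - b x * a' x = 0" using w[OF x(1)] by (simp add: algebra_simps)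
    ultimately show "((\<lambda>x. b x / a x) has_field_derivative 0) (at x within ball s1 e)"
      by (simp add: has_field_derivative_at_within)
  qed
  then obtain c where c: "\<And>x. x \<in> ball s1 e \<Longrightarrow> b x / a x = c" by blast
  then have "c = b s1 / a s1" using e(1) by force
  have eq: "b x = (b s1 / a s1) * a x" if "x \<in> ball s1 e" for x
  proof -
    have "a x \<noteq> 0" using e(2) that by auto
    then show ?thesis using c[OF that] \<open>c = b s1 / a s1\<close> by (simp add: divide_eq_eq)
  qed
  show ?thesis
  proof (rule analytic_continuation_open[where s = "ball s1 e" and s' = S and f = b
        and g = "\<lambda>x. (b s1 / a s1) * a x" and z = s])
    show "ball s1 e \<noteq> {}" "ball s1 e \<subseteq> S" using e by auto
    show "(\<lambda>x. (b s1 / a s1) * a x) holomorphic_on S" by (intro holomorphic_intros hol)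
  qed (use eq in \<open>simp_all add: S hol s\<close>)
qed

text \<open>
  A form that vanishes on a nonconstant holomorphic arc of the cone vanishes on the whole curve: by
  the identity theorem, the closure of the arc is irreducible.
\<close>
lemma form_vanishes_on_curve:
  assumes X: "irreducible_curve X" and r: "r > 0"
    and hol: "\<And>i. (\<lambda>s. \<gamma> s $ i) holomorphic_on ball 0 r"
    and \<gamma>: "\<And>s. s \<in> ball 0 r \<Longrightarrow> \<gamma> s \<in> affine_cone X" "\<And>s. s \<in> ball 0 r \<Longrightarrow> \<gamma> s \<noteq> 0"
    and s12: "s1 \<in> ball 0 r" "s2 \<in> ball 0 r" "vec.span {\<gamma> s1} \<noteq> vec.span {\<gamma> s2}"
    and G: "homogeneous k G" "\<And>s. s \<in> ball 0 r \<Longrightarrow> G (\<gamma> s) = 0" and x: "x \<in> affine_cone X"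
  shows "G x = 0"
proof -
  define S where "S = {f. (\<exists>k. homogeneous k f) \<and> (\<forall>s\<in>ball 0 r. f (\<gamma> s) = 0)}"
  have S: "\<forall>f\<in>S. \<exists>k. homogeneous k f" by (auto simp: S_def)
  let ?Z = "proj_zeros S"
  have in_Z: "vec.span {\<gamma> s} \<in> ?Z" if "s \<in> ball 0 r" for s
    using proj_zeros_span_iff[OF S \<gamma>(2)[OF that]] that by (auto simp: S_def)
  have "proj_irreducible ?Z"
  proof (rule proj_irreducibleI)
    show "proj_closed ?Z" by (rule proj_closed_zeros[OF S])
    show "?Z \<noteq> {}" using in_Z[OF s12(1)] by blast
    fix j k f g
    assume f: "homogeneous j f" and g: "homogeneous k g"
      and fg: "\<And>v. v \<noteq> 0 \<Longrightarrow> vec.span {v} \<in> ?Z \<Longrightarrow> f v * g v = 0"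
    have "(\<forall>s\<in>ball 0 r. f (\<gamma> s) = 0) \<or> (\<forall>s\<in>ball 0 r. g (\<gamma> s) = 0)"
      by (rule holomorphic_mult_zero[OF open_ball connected_ball
            holomorphic_on_polynomial[OF homogeneous_imp_polynomial[OF f] hol]
            holomorphic_on_polynomial[OF homogeneous_imp_polynomial[OF g] hol]])
        (rule fg[OF \<gamma>(2) in_Z])
    then have "f \<in> S \<or> g \<in> S" using f g by (auto simp: S_def)
    then show "(\<forall>v. v \<noteq> 0 \<longrightarrow> vec.span {v} \<in> ?Z \<longrightarrow> f v = 0) \<or> (\<forall>v. v \<noteq> 0 \<longrightarrow> vec.span {v} \<in> ?Z \<longrightarrow> g v = 0)"
      using proj_zeros_span_iff[OF S] by blast
  qed
  moreover have "?Z \<subseteq> X"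
  proof
    fix p assume p: "p \<in> ?Z"
    obtain T where T: "\<forall>f\<in>T. \<exists>k. homogeneous k f" "X = proj_zeros T"
      using irreducible_curveD(1)[OF X] unfolding proj_closed_def by blast
    have "f (\<gamma> s) = 0" if "f \<in> T" "s \<in> ball 0 r" for f s
      using that \<gamma>[OF that(2)] T(2) proj_zeros_span_iff[OF T(1)] affine_cone_iff[OF irreducible_curveD(3)[OF X]]
      by blast
    then have "T \<subseteq> S" using T(1) by (auto simp: S_def)
    then show "p \<in> X" using p T(2) by (auto simp: proj_zeros_def)
  qed
  ultimately have "?Z = X"
    using irreducible_subset_curve[OF X] in_Z s12 by metis
  have GS: "G \<in> S" using G by (auto simp: S_def)
  show ?thesis
  proof (cases "x = 0")
    case True
    have "G (\<gamma> s1) = 0" using G(2) s12(1) by blast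
    then show ?thesis using True homogeneousD[OF G(1), of 0 "\<gamma> s1"] by simp
  next
    case False
    then show ?thesis
      using x affine_cone_iff[OF irreducible_curveD(3)[OF X] False] \<open>?Z = X\<close> proj_zeros_span_iff[OF S False] GS
      by blast
  qed
qed

section \<open>Tangent spaces\<close>

lemma tangent_space_eq:
  "tangent_space X x = {v. \<forall>u\<in>(\<lambda>f. gradient f x) ` vanishing_ideal X. pairing u v = 0}"
  by (auto simp: tangent_space_def differential_def)

lemma tangentD: "v \<in> tangent_space X x \<Longrightarrow> f \<in> vanishing_ideal X \<Longrightarrow> pairing (gradient f x) v = 0"
  by (simp add: tangent_space_def differential_def)

lemma subspace_tangent_space: "vec.subspace (tangent_space X x)"
  unfolding tangent_space_eq by (rule subspace_pairing_kernel)

lemma subspace_gradients: "vec.subspace ((\<lambda>f. gradient f x) ` vanishing_ideal X)"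
proof (rule vec.subspaceI)
  show "0 \<in> (\<lambda>f. gradient f x) ` vanishing_ideal X"
    by (intro image_eqI[of _ _ "\<lambda>_. 0"]) (auto simp: vanishing_ideal_def)
next
  fix u v assume "u \<in> (\<lambda>f. gradient f x) ` vanishing_ideal X" "v \<in> (\<lambda>f. gradient f x) ` vanishing_ideal X"
  then obtain f g where "f \<in> vanishing_ideal X" "g \<in> vanishing_ideal X" "u = gradient f x" "v = gradient g x"
    by blast
  then show "u + v \<in> (\<lambda>f. gradient f x) ` vanishing_ideal X"
    by (intro image_eqI[of _ _ "\<lambda>x. f x + g x"]) (auto simp: vanishing_ideal_def gradient_add)
next
  fix c u assume "u \<in> (\<lambda>f. gradient f x) ` vanishing_ideal X"
  then obtain f where "f \<in> vanishing_ideal X" "u = gradient f x" by blast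
  then show "c *s u \<in> (\<lambda>f. gradient f x) ` vanishing_ideal X"
    by (intro image_eqI[of _ _ "\<lambda>x. c * f x"])
      (auto simp: vanishing_ideal_def gradient_cmult intro!: polynomial_mult)
qed

text \<open>
  The rows of \<open>M\<close> indexed by \<open>K\<close> are differentials of elements of the ideal that cut out the tangent
  space; the other rows complete them to coordinates.
\<close>
lemma tangent_space_adapted_matrix:
  fixes X :: "(complex ^ 'n) set set"
  obtains M :: "complex ^ 'n ^ 'n" and K where "invertible M"
    "\<And>i. i \<in> K \<Longrightarrow> M $ i \<in> (\<lambda>f. gradient f x) ` vanishing_ideal X"
    "tangent_space X x = {v. \<forall>i\<in>K. pairing (M $ i) v = 0}"
proof (rule adapted_matrix[OF subspace_gradients[of x X]])
  fix M :: "complex ^ 'n ^ 'n" and K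
  assume *: "invertible M" "\<And>i. i \<in> K \<Longrightarrow> M $ i \<in> (\<lambda>f. gradient f x) ` vanishing_ideal X"
    "{v. \<forall>u\<in>(\<lambda>f. gradient f x) ` vanishing_ideal X. pairing u v = 0} = {v. \<forall>i\<in>K. pairing (M $ i) v = 0}"
  show thesis
    by (rule that[OF *(1,2)]) (simp_all only: tangent_space_eq *(3))
qed

lemma radial_tangent:
  assumes "X \<subseteq> proj_space" "x \<in> affine_cone X"
  shows "x \<in> tangent_space X x"
proof -
  have "pairing (gradient f x) x = 0" if f: "f \<in> vanishing_ideal X" for f
  proof -
    have "((\<lambda>t. f (0 + t *s x)) has_field_derivative pairing (gradient f (0 + 1 *s x)) x) (at 1)"
      by (rule gradient_line[OF vanishing_ideal_polynomial[OF f]])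
    moreover have "(\<lambda>t. f (0 + t *s x)) = (\<lambda>_. 0)"
      using vanishing_idealD[OF f affine_cone_scale[OF assms]] by auto
    ultimately show ?thesis using DERIV_unique DERIV_const by (metis add_0 vec.scale_one)
  qed
  then show ?thesis by (simp add: tangent_space_def differential_def)
qed

lemma tangent_space_scale:
  assumes X: "X \<subseteq> proj_space" and "c \<noteq> 0"
  shows "tangent_space X (c *s x) = tangent_space X x"
proof -
  have sub: "tangent_space X y \<subseteq> tangent_space X (c *s y)" if "c \<noteq> 0" for c y
  proof
    fix v assume v: "v \<in> tangent_space X y"
    have "pairing (gradient f (c *s y)) v = 0" if f: "f \<in> vanishing_ideal X" for f
    proof -
      have fp: "polynomial f" using f vanishing_ideal_polynomial by blast
      have "polynomial (\<lambda>z. f (c *s z))"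
        by (rule polynomial_compose[OF fp]) (auto intro!: polynomial_mult)
      then have h: "(\<lambda>z. f (c *s z)) \<in> vanishing_ideal X"
        using vanishing_idealD[OF f] affine_cone_scale[OF X] by (auto simp: vanishing_ideal_def)
      have "gradient (\<lambda>z. f (c *s z)) y = c *s gradient f (c *s y)"
      proof (rule gradient_eqI)
        fix w
        have "c *s (y + t *s w) = c *s y + t *s (c *s w)" for t
          by (simp add: vec_eq_iff algebra_simps)
        then show "((\<lambda>t. f (c *s (y + t *s w))) has_field_derivative
            pairing (c *s gradient f (c *s y)) w) (at 0)"
          using gradient_line[OF fp, of "c *s y" "c *s w" 0] by (simp add: mult.commute)
      qed
      then have "c * pairing (gradient f (c *s y)) v = 0"
        using tangentD[OF v h] by simp
      then show ?thesis using \<open>c \<noteq> 0\<close> by simp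
    qed
    then show "v \<in> tangent_space X (c *s y)" by (simp add: tangent_space_def differential_def)
  qed
  show ?thesis
    using sub[OF assms(2), of x] sub[of "1 / c" "c *s x"] assms(2) by auto
qed

lemma cone_reg_iff:
  assumes "irreducible_curve X"
  shows "x \<in> cone_reg X \<longleftrightarrow> x \<in> affine_cone X \<and> vec.dim (tangent_space X x) = 2"
proof -
  have "proj_dim X + 1 = enat 2" using assms by (simp add: irreducible_curve_def one_enat_def)
  then show ?thesis by (simp add: cone_reg_def)
qed

lemma cone_reg_scale:
  assumes "irreducible_curve X" "x \<in> cone_reg X" "c \<noteq> 0"
  shows "c *s x \<in> cone_reg X"
  using assms affine_cone_scale[OF irreducible_curveD(3)[OF assms(1)]]
    tangent_space_scale[OF irreducible_curveD(3)[OF assms(1)] assms(3)]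
  by (simp add: cone_reg_iff)

lemma independent_pair:
  fixes a b :: "complex ^ 'n"
  assumes "a \<noteq> 0" "b \<notin> vec.span {a}"
  shows "vec.independent {a, b}" "card {a, b} = 2"
proof -
  have "a \<noteq> b" using assms(2) vec.span_base by blast
  then show "card {a, b} = 2" by simp
  show "vec.independent {a, b}"
    using assms vec.independent_insert[of b "{a}"] \<open>a \<noteq> b\<close> by (simp add: insert_commute)
qed

lemma subspace_eq_span_pair:
  fixes T :: "(complex ^ 'n) set"
  assumes "vec.subspace T" "vec.dim T \<le> 2" "a \<in> T" "b \<in> T" "a \<noteq> 0" "b \<notin> vec.span {a}"
  shows "T = vec.span {a, b}"
  using vec.card_ge_dim_independent[of "{a, b}" T] independent_pair[OF assms(5,6)] assms(1-4)
    vec.span_minimal[of "{a, b}" T] by auto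

text \<open>
  If the differentials of the ideal at \<open>x1\<close> cut out only the line through \<open>x1\<close>, then Hadamard
  expansions exhibit \<open>[x1]\<close> as the only point of the curve off a hypersurface that misses it.
\<close>
lemma tangent_dim_ge_2:
  fixes X :: "(complex ^ 'n) set set"
  assumes X: "irreducible_curve X" and x1: "x1 \<in> affine_cone X" "x1 \<noteq> 0"
  shows "vec.dim (tangent_space X x1) \<ge> 2"
proof (rule ccontr)
  assume "\<not> ?thesis"
  then have small: "vec.dim (tangent_space X x1) \<le> 1" by simp
  note sub = irreducible_curveD(3)[OF X]
  obtain M :: "complex ^ 'n ^ 'n" and K where M: "invertible M"
    "\<And>i. i \<in> K \<Longrightarrow> M $ i \<in> (\<lambda>f. gradient f x1) ` vanishing_ideal X"
    "tangent_space X x1 = {v. \<forall>i\<in>K. pairing (M $ i) v = 0}"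
    by (rule tangent_space_adapted_matrix[of x1 X]) (rule that)
  have x1T: "x1 \<in> tangent_space X x1" by (rule radial_tangent[OF sub x1(1)])
  have T: "tangent_space X x1 \<subseteq> vec.span {x1}"
    using vec.card_ge_dim_independent[of "{x1}" "tangent_space X x1"] x1T x1(2) small by simp
  have "card (- K) \<le> 1" using small M(3) dim_pairing_kernel[OF M(1), of K] by simp
  then have one: "i = j" if "i \<notin> K" "j \<notin> K" for i j
    using that card_le_Suc0_iff_eq[of "- K"] by simp
  obtain l where l: "pairing l x1 = 1" using pairing_nonzero[OF x1(2)] by metis
  \<comment> \<open>the equation \<open>l = 1\<close> of an affine chart supplies the missing differential\<close>
  have "\<forall>i. \<exists>f. polynomial f \<and> gradient f x1 = (if i \<in> K then M $ i else l) \<and>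
      (\<forall>x\<in>affine_cone X. pairing l x = 1 \<longrightarrow> f x = 0)"
  proof
    fix i
    show "\<exists>f. polynomial f \<and> gradient f x1 = (if i \<in> K then M $ i else l) \<and>
      (\<forall>x\<in>affine_cone X. pairing l x = 1 \<longrightarrow> f x = 0)"
    proof (cases "i \<in> K")
      case True
      then show ?thesis using M(2)[OF True] vanishing_idealD vanishing_ideal_polynomial by force
    next
      case False
      then show ?thesis
        by (intro exI[of _ "\<lambda>x. pairing l x - 1"]) (auto simp: gradient_diff)
    qed
  qed
  then obtain f where f: "\<And>i. polynomial (f i)" "\<And>i. gradient (f i) x1 = (if i \<in> K then M $ i else l)"
    "\<And>i x. x \<in> affine_cone X \<Longrightarrow> pairing l x = 1 \<Longrightarrow> f i x = 0" by metis
  have "\<forall>i. \<exists>C. (\<forall>j. polynomial (\<lambda>x. C x $ j)) \<and> (\<forall>x. f i x - f i x1 = pairing (C x) (x - x1)) \<and>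
    C x1 = gradient (f i) x1"
    using polynomial_Hadamard f(1) by blast
  then obtain C where C: "\<And>i j. polynomial (\<lambda>x. C i x $ j)"
    "\<And>i x. f i x - f i x1 = pairing (C i x) (x - x1)" "\<And>i. C i x1 = gradient (f i) x1" by metis
  define \<delta> where "\<delta> x = det (\<chi> i. C i x)" for x
  have \<delta>: "polynomial \<delta>" unfolding \<delta>_def[abs_def] by (rule polynomial_det) (simp add: C(1))
  have "v = 0" if "\<And>i. pairing ((\<chi> i. C i x1) $ i) v = 0" for v
  proof -
    have v: "pairing (if i \<in> K then M $ i else l) v = 0" for i using that[of i] C(3) f(2) by simp
    have "pairing (M $ i) v = 0" if "i \<in> K" for i using v[of i] that by simp
    then have "v \<in> tangent_space X x1" unfolding M(3) by blast
    then obtain c where c: "v = c *s x1" using T span_singleton_iff by blast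
    show ?thesis
    proof (cases "K = UNIV")
      case True
      then have "\<forall>i. pairing (M $ i) x1 = 0" using x1T M(3) by simp
      then show ?thesis using invertible_iff_kernel[of M] M(1) invertible_det_nz x1(2) by metis
    next
      case False
      then obtain i where "i \<notin> K" by blast
      then have "pairing l v = 0" using v[of i] by simp
      then show ?thesis using c l by simp
    qed
  qed
  then have \<delta>1: "\<delta> x1 \<noteq> 0" unfolding \<delta>_def using invertible_iff_kernel by blast
  \<comment> \<open>where \<open>\<delta>\<close> does not vanish, the Hadamard expansions form an invertible system for \<open>x - x1\<close>\<close>
  have iso: "x = x1" if x: "x \<in> affine_cone X" "pairing l x = 1" "\<delta> x \<noteq> 0" for x
  proof -
    have "pairing ((\<chi> i. C i x) $ i) (x - x1) = 0" for i
      using C(2)[of i x] f(3)[OF x(1,2), of i] f(3)[OF x1(1) l, of i] by simp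
    then have "x - x1 = 0" using x(3) invertible_iff_kernel[of "\<chi> i. C i x"] unfolding \<delta>_def by blast
    then show ?thesis by simp
  qed
  obtain N h where h: "homogeneous N h"
    "\<And>x. pairing l x \<noteq> 0 \<Longrightarrow> h x = pairing l x ^ N * \<delta> ((1 / pairing l x) *s x)"
    using homogenization[OF \<delta>, of l] by blast
  define A where "A = X \<inter> proj_zeros {\<lambda>x. pairing l x * h x}"
  have hom: "\<forall>f\<in>{\<lambda>x. pairing l x * h x}. \<exists>k. homogeneous k f"
    using homogeneous_mult[OF homogeneous_pairing h(1)] by blast
  have "proj_closed A"
    unfolding A_def by (rule proj_closed_Int[OF irreducible_curveD(1)[OF X] proj_closed_zeros[OF hom]])
  moreover have P: "vec.span {x1} \<in> X" using x1 affine_cone_iff[OF sub] by blast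
  then have "proj_closed {vec.span {x1}}"
    using proj_irreducible_point sub proj_irreducible_def by blast
  moreover have "X = A \<union> {vec.span {x1}}"
  proof -
    have "p \<in> A \<or> p = vec.span {x1}" if p: "p \<in> X" for p
    proof -
      obtain y where y: "p = vec.span {y}" "y \<noteq> 0" using p sub by (auto simp: proj_space_def)
      show ?thesis
      proof (cases "pairing l y * h y = 0")
        case True
        then show ?thesis using p y proj_zeros_span_iff[OF hom y(2)] by (simp add: A_def)
      next
        case False
        let ?x = "(1 / pairing l y) *s y"
        have "y \<in> affine_cone X" using p y affine_cone_iff[OF sub] by blast
        then have "?x = x1" using False h(2)[of y] affine_cone_scale[OF sub] by (intro iso) auto
        then show ?thesis using y x1(2) span_singleton_eq[OF y(2) x1(2)] by metis
      qed
    qed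
    then show ?thesis using P by (auto simp: A_def)
  qed
  ultimately have "X = A \<or> X = {vec.span {x1}}"
    using X unfolding irreducible_curve_def proj_irreducible_def by blast
  then show False
  proof
    assume "X = A"
    then have "vec.span {x1} \<in> proj_zeros {\<lambda>x. pairing l x * h x}" using P A_def by blast
    then show False using proj_zeros_span_iff[OF hom x1(2)] l h(2)[of x1] \<delta>1 by simp
  next
    assume "X = {vec.span {x1}}"
    then show False using curve_two_points[OF X] by (metis singletonD)
  qed
qed

section \<open>Holomorphic arcs through regular points\<close>

text \<open>
  Near a regular point the cone is cut out to first order by \<open>n - 2\<close> elements of its ideal. The
  vector field below is the generalised cross product of their gradients with a functional \<open>l\<close>.
\<close>
lemma tangent_vector_field:
  fixes X :: "(complex ^ 'n) set set"
  assumes X: "irreducible_curve X" and x0: "x0 \<in> cone_reg X" and l: "pairing l x0 \<noteq> 0"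
  obtains v where "\<And>i. polynomial (\<lambda>x. v x $ i)" "\<And>x. pairing l (v x) = 0"
    "\<And>x. x \<in> affine_cone X \<Longrightarrow> v x \<in> tangent_space X x" "v x0 \<noteq> 0"
    "\<And>x. x \<in> affine_cone X \<Longrightarrow> pairing l x \<noteq> 0 \<Longrightarrow> v x \<noteq> 0 \<Longrightarrow>
      x \<in> cone_reg X \<and> tangent_space X x = vec.span {x, v x}"
proof -
  note sub = irreducible_curveD(3)[OF X]
  have x0C: "x0 \<in> affine_cone X" and dim2: "vec.dim (tangent_space X x0) = 2"
    using x0 cone_reg_iff[OF X] by auto
  have x0nz: "x0 \<noteq> 0" using l by auto
  have x0T: "x0 \<in> tangent_space X x0" by (rule radial_tangent[OF sub x0C])
  obtain M :: "complex ^ 'n ^ 'n" and K where M: "invertible M"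
    "\<And>i. i \<in> K \<Longrightarrow> M $ i \<in> (\<lambda>f. gradient f x0) ` vanishing_ideal X"
    "tangent_space X x0 = {v. \<forall>i\<in>K. pairing (M $ i) v = 0}"
    by (rule tangent_space_adapted_matrix[of x0 X]) (rule that)
  have "card (- K) = 2" using dim2 M(3) dim_pairing_kernel[OF M(1), of K] by simp
  then obtain i0 i1 where i01: "- K = {i0, i1}" "i0 \<noteq> i1" by (metis card_2_iff)
  have K: "i \<in> K \<longleftrightarrow> i \<noteq> i0 \<and> i \<noteq> i1" for i using i01 by auto
  have "\<forall>i\<in>K. \<exists>f. f \<in> vanishing_ideal X \<and> gradient f x0 = M $ i"
    using M(2) by force
  from bchoice[OF this] obtain f where
    f: "\<And>i. i \<in> K \<Longrightarrow> f i \<in> vanishing_ideal X" "\<And>i. i \<in> K \<Longrightarrow> gradient (f i) x0 = M $ i" by blast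
  define row where "row r x i = (if i = i0 then r else if i = i1 then l else gradient (f i) x)" for r x i
  define v where "v x = (\<chi> j. det (\<chi> i. row (axis j 1) x i))" for x
  have pv: "pairing r (v x) = det (\<chi> i. row r x i)" for r x
  proof -
    have "(\<chi> i. row r x i) = (\<chi> i. if i = i0 then \<Sum>j\<in>UNIV. r $ j *s axis j 1
        else if i = i1 then l else gradient (f i) x)"
      by (simp add: row_def vec_eq_iff basis_expansion[unfolded vec_eq_iff] del: sum_component)
    also have "det \<dots> = (\<Sum>j\<in>UNIV. r $ j * det (\<chi> i. row (axis j 1) x i))"
      unfolding row_def by (subst det_linear_row_sum) (auto simp: det_row_mul)
    finally show ?thesis by (simp add: pairing_def v_def)
  qed
  have same: "det (\<chi> i. row r x i) = 0" if "i \<noteq> i0" "r = row r x i" for r x i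
    by (rule det_identical_rows[of i i0]) (use that in \<open>auto simp: row_def row_def vec_eq_iff Finite_Cartesian_Product.row_def\<close>)
  have lv: "pairing l (v x) = 0" for x
    using same[of i1 l x] i01(2) pv by (simp add: row_def)
  have fv: "pairing (gradient (f i) x) (v x) = 0" if "i \<in> K" for i x
    using same[of i "gradient (f i) x" x] that pv K by (simp add: row_def)
  have poly: "polynomial (\<lambda>x. v x $ j)" for j
  proof -
    have "polynomial (\<lambda>x. row (axis j 1) x i $ k)" for i k
      unfolding row_def using f(1)[of i] K[of i] vanishing_ideal_polynomial[of "f i" X]
      by (cases "i = i0"; cases "i = i1") auto
    then have "polynomial (\<lambda>x. det (\<chi> i. row (axis j 1) x i))" by (intro polynomial_det) simp
    then show ?thesis by (simp add: v_def)
  qed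
  have reg: "vec.dim (tangent_space X x) = 2 \<and> v x \<in> tangent_space X x"
    if x: "x \<in> affine_cone X" "x \<noteq> 0" and vx: "v x \<noteq> 0" for x
  proof -
    obtain j where "v x $ j \<noteq> 0" using vx by (metis vec_eq_iff zero_index)
    then have "det (\<chi> i. row (axis j 1) x i) \<noteq> 0" by (simp add: v_def)
    then have inv: "invertible (\<chi> i. row (axis j 1) x i)" using invertible_det_nz by blast
    let ?U = "{w. \<forall>i\<in>K. pairing (gradient (f i) x) w = 0}"
    have "?U = {w. \<forall>i\<in>K. pairing ((\<chi> i. row (axis j 1) x i) $ i) w = 0}"
      using K by (auto simp: row_def)
    then have dimU: "vec.dim ?U = 2"
      using dim_pairing_kernel[OF inv, of K] i01 by simp
    have TU: "tangent_space X x \<subseteq> ?U" using f(1) tangentD by blast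
    have dimT: "vec.dim (tangent_space X x) \<ge> 2" by (rule tangent_dim_ge_2[OF X x])
    moreover have "vec.dim (tangent_space X x) \<le> 2" using vec.dim_subset[OF TU] dimU by simp
    moreover have "vec.subspace ?U" by (rule vec.subspaceI) auto
    then have "tangent_space X x = ?U"
      using vec.subspace_dim_equal[OF subspace_tangent_space _ TU] dimU dimT by simp
    then have "v x \<in> tangent_space X x" using fv by blast
    ultimately show ?thesis by simp
  qed
  have vT: "v x \<in> tangent_space X x" if "x \<in> affine_cone X" for x
  proof (cases "v x = 0")
    case True
    then show ?thesis using vec.subspace_0[OF subspace_tangent_space] by simp
  next
    case False
    \<comment> \<open>at the vertex, tangency follows by continuity along the line through \<open>x0\<close>\<close>
    have "v 0 = 0 \<or> v 0 \<in> tangent_space X 0"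
    proof -
      have "v 0 \<in> tangent_space X 0"
        unfolding tangent_space_def differential_def
      proof safe
        fix h assume h: "h \<in> vanishing_ideal X"
        define \<phi> where "\<phi> y = pairing (gradient h y) (v y)" for y
        have hp: "polynomial \<phi>"
          unfolding \<phi>_def using poly vanishing_ideal_polynomial[OF h] by (intro polynomial_pairing_maps) auto
        obtain p where p: "\<And>t. poly p t = \<phi> (0 + t *s x0)" using polynomial_on_line[OF hp] by blast
        have "poly p t = 0" if "t \<noteq> 0" for t
        proof -
          have "t *s x0 \<in> affine_cone X" "t *s x0 \<noteq> 0"
            using that x0nz affine_cone_scale[OF sub x0C] by auto
          then have "v (t *s x0) = 0 \<or> v (t *s x0) \<in> tangent_space X (t *s x0)" using reg by blast
          then show ?thesis using tangentD[OF _ h] by (auto simp: p \<phi>_def)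
        qed
        then have "p = 0" by (rule poly_zero_if_zero_off_0)
        then show "pairing (gradient h 0) (v 0) = 0" using p[of 0] by (simp add: \<phi>_def)
      qed
      then show ?thesis by blast
    qed
    then show ?thesis using reg[OF that] False by (cases "x = 0") auto
  qed
  have "v x0 \<noteq> 0"
  proof -
    let ?T = "tangent_space X x0"
    have "\<not> ?T \<subseteq> vec.span {x0}"
      using vec.dim_le_card[of ?T "{x0}"] dim2 by auto
    then obtain y where y: "y \<in> ?T" "y \<notin> vec.span {x0}" by blast
    define v0 where "v0 = y - (pairing l y / pairing l x0) *s x0"
    have v0T: "v0 \<in> ?T"
      unfolding v0_def using y x0T subspace_tangent_space
      by (intro vec.subspace_diff vec.subspace_scale) auto
    have lv0: "pairing l v0 = 0" using l by (simp add: v0_def)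
    have v0: "v0 \<notin> vec.span {x0}"
    proof
      assume "v0 \<in> vec.span {x0}"
      then have "v0 + (pairing l y / pairing l x0) *s x0 \<in> vec.span {x0}"
        by (intro vec.span_add vec.span_scale) (auto intro: vec.span_base)
      then show False using y(2) by (simp add: v0_def)
    qed
    then have "v0 \<noteq> 0" using vec.span_zero by blast
    then obtain r where r: "pairing r v0 = 1" using pairing_nonzero by metis
    have T: "?T = vec.span {x0, v0}"
      by (rule subspace_eq_span_pair[OF subspace_tangent_space _ x0T v0T x0nz v0]) (simp add: dim2)
    have "w = 0" if w: "\<And>i. pairing ((\<chi> i. row r x0 i) $ i) w = 0" for w
    proof -
      have "pairing (M $ i) w = 0" if "i \<in> K" for i
        using w[of i] that K f(2) by (simp add: row_def)
      then have "w \<in> ?T" using M(3) by blast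
      then obtain a where "w - a *s x0 \<in> vec.span {v0}" using T by (auto simp: vec.span_insert)
      then obtain b where "w - a *s x0 = b *s v0" using span_singleton_iff by blast
      then have wab: "w = a *s x0 + b *s v0" by (metis add.commute diff_add_cancel)
      have "pairing l w = 0" using w[of i1] i01(2) by (simp add: row_def)
      then have "a = 0" using l lv0 wab by simp
      moreover have "pairing r w = 0" using w[of i0] by (simp add: row_def)
      ultimately show "w = 0" using r wab by simp
    qed
    then have "pairing r (v x0) \<noteq> 0" unfolding pv using invertible_iff_kernel by blast
    then show ?thesis by auto
  qed
  moreover have "x \<in> cone_reg X \<and> tangent_space X x = vec.span {x, v x}"
    if x: "x \<in> affine_cone X" "pairing l x \<noteq> 0" "v x \<noteq> 0" for x
  proof -
    have xnz: "x \<noteq> 0" using x(2) by auto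
    have "v x \<notin> vec.span {x}"
      using x lv[of x] by (auto simp: span_singleton_iff)
    then show ?thesis
      using subspace_eq_span_pair[OF subspace_tangent_space _ radial_tangent[OF sub x(1)] vT[OF x(1)] xnz]
        reg[OF x(1) xnz x(3)] x(1) cone_reg_iff[OF X] by simp
  qed
  ultimately show thesis using that poly lv vT by blast
qed

lemma norm_smult_vec: "norm (c *s x) = norm c * norm (x :: complex ^ 'n)"
  by (simp add: norm_vec_def norm_mult L2_set_right_distrib)

text \<open>
  The formal solution \<open>\<Sum> D\<^sup>k x\<^sub>i (x0) s\<^sup>k / k!\<close> of the differential equation \<open>\<gamma>' = v(\<gamma>)\<close>, where \<open>D\<close> is
  the derivation along \<open>v\<close>, converges by Cauchy's inequality on shrinking balls. As
  \<open>G \<mapsto> \<Sum> D\<^sup>k G (x0) s\<^sup>k / k!\<close> is a ring homomorphism, it is \<open>G \<mapsto> G (\<gamma> s)\<close>; since \<open>D\<close> preserves the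
  ideal of \<open>X\<close>, the arc stays on the cone.
\<close>
lemma integral_arc:
  fixes X :: "(complex ^ 'n) set set" and v :: "complex ^ 'n \<Rightarrow> complex ^ 'n"
  assumes X: "proj_closed X" "X \<noteq> {}" and v: "\<And>i. polynomial (\<lambda>x. v x $ i)"
    and vT: "\<And>x. x \<in> affine_cone X \<Longrightarrow> v x \<in> tangent_space X x" and x0: "x0 \<in> affine_cone X"
  obtains \<gamma> r where "r > 0" "\<gamma> 0 = x0" "\<And>s. s \<in> ball 0 r \<Longrightarrow> \<gamma> s \<in> affine_cone X"
    "\<And>s i. s \<in> ball 0 r \<Longrightarrow> ((\<lambda>s. \<gamma> s $ i) has_field_derivative v (\<gamma> s) $ i) (at s)"
proof -
  define D where "D G = (\<lambda>x. pairing (gradient G x) (v x))" for G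
  have D_poly: "polynomial (D G)" if "polynomial G" for G
    unfolding D_def using that v by (intro polynomial_pairing_maps) auto
  have Dk_poly: "polynomial ((D ^^ k) G)" if "polynomial G" for G k
    using that by (induction k) (auto intro: D_poly)
  have cont_v: "continuous_on (cball x0 1) v"
    using continuous_on_vec_lambda[of "cball x0 1" "\<lambda>i x. v x $ i"] continuous_on_polynomial[OF v]
    by simp
  have bdd: "\<exists>B>0. \<forall>x\<in>cball x0 1. norm (h x) \<le> B"
    if "continuous_on (cball x0 1) h" for h :: "complex ^ 'n \<Rightarrow> 'b::real_normed_vector"
    using compact_imp_bounded[OF compact_continuous_image[OF that compact_cball]]
    by (auto simp: bounded_pos)
  obtain V where V: "V > 0" "\<And>x. x \<in> cball x0 1 \<Longrightarrow> norm (v x) \<le> V"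
    using bdd[OF cont_v] by blast
  \<comment> \<open>each derivative costs a margin \<open>\<delta>\<close>, and gains the factor \<open>V / \<delta>\<close>\<close>
  have bound: "norm ((D ^^ k) G x) \<le> B * (V / \<delta>) ^ k"
    if G: "polynomial G" and B: "\<And>x. x \<in> cball x0 1 \<Longrightarrow> norm (G x) \<le> B" and "\<delta> > 0"
      and "dist x0 x \<le> 1 - real k * \<delta>" for G B \<delta> k x
    using that(4)
  proof (induction k arbitrary: x)
    case 0
    then show ?case using B by simp
  next
    case (Suc k)
    let ?H = "(D ^^ k) G"
    let ?h = "\<lambda>t. ?H (x + t *s v x)"
    have Hp: "polynomial ?H" by (rule Dk_poly[OF G])
    have "0 \<le> real (Suc k) * \<delta>" using \<open>\<delta> > 0\<close> by simp
    then have x: "x \<in> cball x0 1" using Suc.prems by simp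
    have deriv: "(?h has_field_derivative pairing (gradient ?H (x + t *s v x)) (v x)) (at t)" for t
      by (rule gradient_line[OF Hp])
    then have hol: "?h holomorphic_on S" for S
      using holomorphic_on_open[of UNIV ?h] holomorphic_on_subset by blast
    have Bh: "norm (?h t) \<le> B * (V / \<delta>) ^ k" if "norm (0 - t) = \<delta> / V" for t
    proof (rule Suc.IH)
      have "norm (t *s v x) \<le> \<delta> / V * V"
        unfolding norm_smult_vec using that V(2)[OF x] V(1) \<open>\<delta> > 0\<close> by (intro mult_mono) auto
      then have "dist x (x + t *s v x) \<le> \<delta>" using V(1) by (simp add: dist_norm)
      then show "dist x0 (x + t *s v x) \<le> 1 - real k * \<delta>"
        using Suc.prems dist_triangle[of x0 "x + t *s v x" x] by (simp add: algebra_simps)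
    qed
    have "0 < \<delta> / V" using V(1) \<open>\<delta> > 0\<close> by simp
    from Cauchy_inequality[where n = 1 and \<xi> = 0, OF hol holomorphic_on_imp_continuous_on[OF hol] this Bh]
    have "norm ((deriv ^^ 1) ?h 0) \<le> fact 1 * (B * (V / \<delta>) ^ k) / (\<delta> / V) ^ 1" .
    moreover have "deriv ?h 0 = (D ^^ Suc k) G x"
      using DERIV_imp_deriv[OF deriv[of 0]] by (simp add: D_def)
    ultimately show ?case using V(1) \<open>\<delta> > 0\<close> by (simp add: field_simps)
  qed
  define e where "e G = Abs_fps (\<lambda>k. (D ^^ k) G x0 / fact k)" for G
  \<comment> \<open>with \<open>\<delta> = 1 / k\<close> and \<open>k\<^sup>k \<le> k! exp(1)\<^sup>k\<close>, the terms of the series are at most \<open>B (V exp(1) |s|)\<^sup>k\<close>\<close>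
  define r where "r = 1 / (2 * V * exp 1)"
  have r: "r > 0" using V(1) by (simp add: r_def)
  have conv: "fps_conv_radius (e G) \<ge> ereal r" if G: "polynomial G" for G
  proof -
    obtain B where B: "B > 0" "\<And>x. x \<in> cball x0 1 \<Longrightarrow> norm (G x) \<le> B"
      using bdd[OF continuous_on_polynomial[OF G]] by blast
    have nb: "norm (fps_nth (e G) k * of_real r ^ k) \<le> B * (1 / 2) ^ k" for k
    proof (cases "k = 0")
      case True
      then show ?thesis using B by (simp add: e_def)
    next
      case False
      have "norm ((D ^^ k) G x0) \<le> B * (V / (1 / real k)) ^ k"
        by (rule bound[OF G B(2)]) (use False in auto)
      moreover have kk: "real k ^ k \<le> fact k * exp 1 ^ k"
      proof -
        have "(\<Sum>n\<in>{k}. inverse (fact n) * real k ^ n) \<le> (\<Sum>n. inverse (fact n) * real k ^ n)"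
          by (rule sum_le_suminf) (use summable_exp[of "real k"] in \<open>auto simp: field_simps\<close>)
        also have "\<dots> = exp (real k)"
          by (simp add: exp_def scaleR_conv_of_real)
        also have "\<dots> = exp 1 ^ k" by (simp flip: exp_of_nat_mult)
        finally show ?thesis by (simp add: field_simps)
      qed
      moreover have "B * V ^ k * real k ^ k \<le> B * V ^ k * (fact k * exp 1 ^ k)"
        by (rule mult_left_mono[OF kk]) (use B(1) V(1) in simp)
      ultimately have "norm ((D ^^ k) G x0) \<le> B * V ^ k * (fact k * exp 1 ^ k)"
        by (simp add: power_mult_distrib mult.assoc)
      then have "norm ((D ^^ k) G x0) / fact k \<le> B * V ^ k * exp 1 ^ k"
        by (simp add: divide_le_eq mult_ac)
      then have "norm ((D ^^ k) G x0) / fact k * r ^ k \<le> B * V ^ k * exp 1 ^ k * r ^ k"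
        by (rule mult_right_mono) (use r in simp)
      also have "\<dots> = B * (V * exp 1 * r) ^ k"
        by (simp only: power_mult_distrib mult.assoc)
      also have "V * exp 1 * r = 1 / 2"
        using V(1) by (simp add: r_def)
      finally have le: "norm ((D ^^ k) G x0) / fact k * r ^ k \<le> B * (1 / 2) ^ k" .
      have "norm (of_real r :: complex) = r" using r by simp
      then have "norm (fps_nth (e G) k * of_real r ^ k) = norm ((D ^^ k) G x0) / fact k * r ^ k"
        unfolding e_def fps_nth_Abs_fps norm_mult norm_divide norm_power norm_fact by (rule arg_cong)
      with le show ?thesis by (rule ord_eq_le_trans[rotated])
    qed
    have "summable (\<lambda>k. B * (1 / 2 :: real) ^ k)"
      by (intro summable_mult summable_geometric) simp
    then have "summable (\<lambda>k. fps_nth (e G) k * of_real r ^ k)"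
      by (rule summable_comparison_test') (rule nb)
    then have "conv_radius (fps_nth (e G)) \<ge> norm (of_real r :: complex)"
      by (rule conv_radius_geI)
    then show ?thesis using r by (simp add: fps_conv_radius_def)
  qed
  have conv_less: "ereal (norm s) < fps_conv_radius (e G)" if "polynomial G" "norm s < r" for G s
    using less_le_trans[OF _ conv[OF that(1)], of "ereal (norm s)"] that(2) by simp
  have D_add: "D (\<lambda>x. f x + g x) = (\<lambda>x. D f x + D g x)" if "polynomial f" "polynomial g" for f g
    using that by (auto simp: D_def gradient_add)
  have D_mult: "D (\<lambda>x. f x * g x) = (\<lambda>x. D f x * g x + f x * D g x)" if "polynomial f" "polynomial g" for f g
    using that by (auto simp: D_def gradient_mult algebra_simps)
  have Dk_add: "(D ^^ k) (\<lambda>x. f x + g x) = (\<lambda>x. (D ^^ k) f x + (D ^^ k) g x)"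
    if "polynomial f" "polynomial g" for f g k
    by (induction k) (auto simp: D_add that Dk_poly)
  have e_add: "e (\<lambda>x. f x + g x) = e f + e g" if "polynomial f" "polynomial g" for f g
    by (simp add: e_def fps_eq_iff Dk_add that add_divide_distrib)
  have e_deriv: "fps_deriv (e f) = e (D f)" for f
    by (simp add: e_def fps_eq_iff funpow_Suc_right del: funpow.simps of_nat_Suc)
  have e_mult: "e (\<lambda>x. f x * g x) = e f * e g" if fg: "polynomial f" "polynomial g" for f g
  proof -
    have "fps_nth (e (\<lambda>x. f x * g x)) n = fps_nth (e f * e g) n" for n
      using fg
    proof (induction n arbitrary: f g)
      case 0
      then show ?case by (simp add: e_def)
    next
      case (Suc n)
      have "fps_nth (fps_deriv (e (\<lambda>x. f x * g x))) n = fps_nth (fps_deriv (e f * e g)) n"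
        using Suc.IH[OF D_poly[OF Suc.prems(1)] Suc.prems(2)] Suc.IH[OF Suc.prems(1) D_poly[OF Suc.prems(2)]]
          Suc.prems D_poly
        by (simp add: e_deriv D_mult e_add polynomial_mult)
      then have "of_nat (n + 1) * fps_nth (e (\<lambda>x. f x * g x)) (n + 1) =
          of_nat (n + 1) * fps_nth (e f * e g) (n + 1)"
        by (simp only: fps_deriv_nth)
      then show ?case
        by (metis mult_cancel_left Suc_eq_plus1 of_nat_neq_0)
    qed
    then show ?thesis by (simp add: fps_eq_iff)
  qed
  have e_const: "e (\<lambda>_. c) = fps_const c" for c
  proof -
    have "(D ^^ k) (\<lambda>_. 0) = (\<lambda>_. 0)" for k by (induction k) (auto simp: D_def)
    then have "(D ^^ Suc k) (\<lambda>_. c) = (\<lambda>_. 0)" for k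
      unfolding funpow_Suc_right by (simp add: D_def)
    then show ?thesis by (auto simp: e_def fps_eq_iff gr0_conv_Suc simp del: funpow.simps(2))
  qed
  define \<gamma> where "\<gamma> s = (\<chi> i. eval_fps (e (\<lambda>x. x $ i)) s)" for s
  have eval: "G (\<gamma> s) = eval_fps (e G) s" if G: "polynomial G" and s: "norm s < r" for G s
    using G
  proof (induction rule: polynomial_induct)
    case (const c)
    show ?case by (simp add: e_const)
  next
    case (coord i)
    show ?case by (simp add: \<gamma>_def)
  next
    case (add f g)
    have "ereal (norm s) < fps_conv_radius (e f)" "ereal (norm s) < fps_conv_radius (e g)"
      using conv_less[OF add(1) s] conv_less[OF add(2) s] by blast+
    then show ?case using add by (simp add: e_add eval_fps_add)
  next
    case (mult f g)
    have "ereal (norm s) < fps_conv_radius (e f)" "ereal (norm s) < fps_conv_radius (e g)"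
      using conv_less[OF mult(1) s] conv_less[OF mult(2) s] by blast+
    then show ?case using mult by (simp add: e_mult eval_fps_mult)
  qed
  show thesis
  proof
    show "r > 0" by (rule r)
    show "\<gamma> 0 = x0" by (simp add: \<gamma>_def eval_fps_at_0 e_def vec_eq_iff)
    fix s :: complex assume "s \<in> ball 0 r"
    then have s: "norm s < r" by simp
    show "\<gamma> s \<in> affine_cone X"
      unfolding mem_affine_cone_iff[OF X]
    proof
      fix G assume G: "G \<in> vanishing_ideal X"
      have "(D ^^ k) G \<in> vanishing_ideal X" for k
      proof (induction k)
        case (Suc k)
        then show ?case
          using tangentD[OF vT Suc] D_poly[OF vanishing_ideal_polynomial[OF Suc]]
          by (simp add: vanishing_ideal_def D_def)
      qed (simp add: G)
      then have "e G = 0" using vanishing_idealD[OF _ x0] by (simp add: e_def fps_eq_iff)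
      then show "G (\<gamma> s) = 0" using eval[OF vanishing_ideal_polynomial[OF G] s] by simp
    qed
    fix i
    have "ereal (norm s) < fps_conv_radius (e (\<lambda>x. x $ i))"
      by (rule conv_less[OF polynomial_coord s])
    then have "(eval_fps (e (\<lambda>x. x $ i)) has_field_derivative eval_fps (fps_deriv (e (\<lambda>x. x $ i))) s) (at s)"
      by (rule has_field_derivative_eval_fps)
    moreover have "eval_fps (fps_deriv (e (\<lambda>x. x $ i))) s = v (\<gamma> s) $ i"
      unfolding e_deriv using eval[OF D_poly[OF polynomial_coord[of i]] s] by (simp add: D_def)
    ultimately show "((\<lambda>s. \<gamma> s $ i) has_field_derivative v (\<gamma> s) $ i) (at s)"
      by (simp add: \<gamma>_def)
  qed
qed

text \<open>
  An integral arc of such a vector field inside the regular locus, with \<open>l\<close> constant along it. Every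
  regular point off the hyperplane \<open>l = 0\<close> lies on one, and each is dense in the curve.
\<close>
definition regular_arc :: "(complex ^ 'n) set set \<Rightarrow> complex ^ 'n \<Rightarrow> (complex ^ 'n \<Rightarrow> complex ^ 'n) \<Rightarrow>
    (complex \<Rightarrow> complex ^ 'n) \<Rightarrow> real \<Rightarrow> bool" where
  "regular_arc X l v \<gamma> r \<longleftrightarrow> r > 0 \<and> (\<forall>i. polynomial (\<lambda>x. v x $ i)) \<and> (\<forall>x. pairing l (v x) = 0) \<and>
    pairing l (\<gamma> 0) \<noteq> 0 \<and> (\<forall>x\<in>affine_cone X. v x \<in> tangent_space X x) \<and>
    (\<forall>x\<in>affine_cone X. pairing l x \<noteq> 0 \<longrightarrow> v x \<noteq> 0 \<longrightarrow>
      x \<in> cone_reg X \<and> tangent_space X x = vec.span {x, v x}) \<and>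
    (\<forall>s\<in>ball 0 r. \<gamma> s \<in> affine_cone X \<and> v (\<gamma> s) \<noteq> 0 \<and>
      (\<forall>i. ((\<lambda>s. \<gamma> s $ i) has_field_derivative v (\<gamma> s) $ i) (at s)))"

lemma regular_arcD:
  assumes "regular_arc X l v \<gamma> r"
  shows "r > 0" "polynomial (\<lambda>x. v x $ i)" "pairing l (v x) = 0" "pairing l (\<gamma> 0) \<noteq> 0"
    "x \<in> affine_cone X \<Longrightarrow> v x \<in> tangent_space X x"
    "x \<in> affine_cone X \<Longrightarrow> pairing l x \<noteq> 0 \<Longrightarrow> v x \<noteq> 0 \<Longrightarrow> x \<in> cone_reg X"
    "x \<in> affine_cone X \<Longrightarrow> pairing l x \<noteq> 0 \<Longrightarrow> v x \<noteq> 0 \<Longrightarrow> tangent_space X x = vec.span {x, v x}"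
    "s \<in> ball 0 r \<Longrightarrow> \<gamma> s \<in> affine_cone X" "s \<in> ball 0 r \<Longrightarrow> v (\<gamma> s) \<noteq> 0"
    "s \<in> ball 0 r \<Longrightarrow> ((\<lambda>s. \<gamma> s $ i) has_field_derivative v (\<gamma> s) $ i) (at s)"
  using assms unfolding regular_arc_def by blast+

lemma regular_arc_shrink:
  assumes "regular_arc X l v \<gamma> r" "0 < r'" "r' \<le> r"
  shows "regular_arc X l v \<gamma> r'"
proof -
  have "ball 0 r' \<subseteq> ball (0::complex) r" using assms by auto
  then show ?thesis using assms(1,2) unfolding regular_arc_def by blast
qed

lemma regular_arc_derivative:
  assumes "regular_arc X l v \<gamma> r" "polynomial f" "s \<in> ball 0 r"
  shows "((\<lambda>s. f (\<gamma> s)) has_field_derivative pairing (gradient f (\<gamma> s)) (v (\<gamma> s))) (at s)"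
  using gradient_chain[OF assms(2)] regular_arcD(10)[OF assms(1,3)] by blast

lemma regular_arc_derivative_pairing:
  assumes "regular_arc X l v \<gamma> r" "s \<in> ball 0 r"
  shows "((\<lambda>s. pairing u (\<gamma> s)) has_field_derivative pairing u (v (\<gamma> s))) (at s)"
  using regular_arc_derivative[OF assms(1) polynomial_pairing(1)[of u] assms(2)] by simp

lemma regular_arc_holomorphic:
  assumes "regular_arc X l v \<gamma> r" "polynomial f"
  shows "(\<lambda>s. f (\<gamma> s)) holomorphic_on ball 0 r"
  unfolding holomorphic_on_open[OF open_ball] using regular_arc_derivative[OF assms] by blast

lemma regular_arc_constant:
  assumes "regular_arc X l v \<gamma> r" and "\<And>s. s \<in> ball 0 r \<Longrightarrow> pairing u (v (\<gamma> s)) = 0" and "s \<in> ball 0 r"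
  shows "pairing u (\<gamma> s) = pairing u (\<gamma> 0)"
proof -
  have "\<exists>c. \<forall>s\<in>ball 0 r. pairing u (\<gamma> s) = c"
    using regular_arc_derivative_pairing[OF assms(1), of _ u] assms(2)
    by (intro has_field_derivative_zero_constant[OF convex_ball])
      (metis has_field_derivative_at_within)
  then show ?thesis using assms(3) regular_arcD(1)[OF assms(1)] by (metis centre_in_ball)
qed

lemma regular_arc_l:
  assumes "regular_arc X l v \<gamma> r" "s \<in> ball 0 r"
  shows "pairing l (\<gamma> s) = pairing l (\<gamma> 0)" "pairing l (\<gamma> s) \<noteq> 0" "\<gamma> s \<noteq> 0"
    "\<gamma> s \<in> cone_reg X" "tangent_space X (\<gamma> s) = vec.span {\<gamma> s, v (\<gamma> s)}"
proof -
  show "pairing l (\<gamma> s) = pairing l (\<gamma> 0)"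
    using regular_arc_constant[OF assms(1) _ assms(2)] regular_arcD(3)[OF assms(1)] by blast
  then show nz: "pairing l (\<gamma> s) \<noteq> 0" using regular_arcD(4)[OF assms(1)] by simp
  then show "\<gamma> s \<noteq> 0" by auto
  show "\<gamma> s \<in> cone_reg X" "tangent_space X (\<gamma> s) = vec.span {\<gamma> s, v (\<gamma> s)}"
    using regular_arcD(6,7)[OF assms(1) _ nz] regular_arcD(8,9)[OF assms] by blast+
qed

lemma regular_arc_moves:
  assumes "regular_arc X l v \<gamma> r" "pairing u (v (\<gamma> 0)) \<noteq> 0"
  shows "\<exists>s\<in>ball 0 r. pairing u (\<gamma> s) \<noteq> c"
proof (rule ccontr)
  assume "\<not> ?thesis"
  then have const: "\<And>s. s \<in> ball 0 r \<Longrightarrow> pairing u (\<gamma> s) = c" by blast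
  have r: "0 \<in> ball 0 r" using regular_arcD(1)[OF assms(1)] by simp
  have "((\<lambda>s. pairing u (\<gamma> s)) has_field_derivative 0) (at 0)"
    using has_field_derivative_transform_within_open[OF DERIV_const[of c] open_ball r] const by metis
  then show False
    using regular_arc_derivative_pairing[OF assms(1) r, of u] assms(2) DERIV_unique by blast
qed

lemma regular_arc_dense:
  assumes X: "irreducible_curve X" and arc: "regular_arc X l v \<gamma> r"
    and G: "homogeneous k G" "\<And>s. s \<in> ball 0 r \<Longrightarrow> G (\<gamma> s) = 0" and x: "x \<in> affine_cone X"
  shows "G x = 0"
proof -
  have r: "0 \<in> ball 0 r" using regular_arcD(1)[OF arc] by simp
  obtain u where "pairing u (v (\<gamma> 0)) = 1"
    using pairing_nonzero[OF regular_arcD(9)[OF arc r]] by metis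
  then obtain s where s: "s \<in> ball 0 r" "pairing u (\<gamma> s) \<noteq> pairing u (\<gamma> 0)"
    using regular_arc_moves[OF arc, of u "pairing u (\<gamma> 0)"] by auto
  have "vec.span {\<gamma> 0} \<noteq> vec.span {\<gamma> s}"
  proof
    assume "vec.span {\<gamma> 0} = vec.span {\<gamma> s}"
    then obtain c where c: "\<gamma> s = c *s \<gamma> 0"
      using span_singleton_eq[OF regular_arc_l(3)[OF arc r] regular_arc_l(3)[OF arc s(1)]] by blast
    then have "c = 1" using regular_arc_l(1)[OF arc s(1)] regular_arcD(4)[OF arc] by simp
    then show False using s(2) c by simp
  qed
  then show ?thesis
    using form_vanishes_on_curve[OF X regular_arcD(1)[OF arc] regular_arc_holomorphic[OF arc polynomial_coord]
        regular_arcD(8)[OF arc] regular_arc_l(3)[OF arc] r s(1) _ G x] by blast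
qed

lemma regular_arc_neighbourhood:
  assumes arc: "regular_arc X l v \<gamma> r" and f: "polynomial f" "f (\<gamma> 0) \<noteq> 0"
  obtains r' where "0 < r'" "r' \<le> r" "regular_arc X l v \<gamma> r'" "\<And>s. s \<in> ball 0 r' \<Longrightarrow> f (\<gamma> s) \<noteq> 0"
proof -
  have r: "0 \<in> ball 0 r" using regular_arcD(1)[OF arc] by simp
  have "open (ball 0 r \<inter> (\<lambda>s. f (\<gamma> s)) -` (- {0}))"
    using continuous_open_preimage[OF holomorphic_on_imp_continuous_on[OF regular_arc_holomorphic[OF arc f(1)]]
        open_ball, of "- {0}"] by blast
  then obtain e where e: "e > 0" "ball 0 e \<subseteq> ball 0 r \<inter> (\<lambda>s. f (\<gamma> s)) -` (- {0})"
    using r f(2) by (metis ComplI IntI openE singletonD vimageI)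
  have "regular_arc X l v \<gamma> (min e r)"
    using regular_arc_shrink[OF arc, of "min e r"] e(1) regular_arcD(1)[OF arc] by simp
  moreover have "f (\<gamma> s) \<noteq> 0" if "s \<in> ball 0 (min e r)" for s
    using that e(2) by auto
  ultimately show thesis
    using that[of "min e r"] e(1) regular_arcD(1)[OF arc] by simp
qed

lemma regular_arc_exists:
  assumes X: "irreducible_curve X" and x0: "x0 \<in> cone_reg X" and l: "pairing l x0 \<noteq> 0"
  obtains v \<gamma> r where "regular_arc X l v \<gamma> r" "\<gamma> 0 = x0"
proof -
  obtain v where v: "\<And>i. polynomial (\<lambda>x. v x $ i)" "\<And>x. pairing l (v x) = 0"
    "\<And>x. x \<in> affine_cone X \<Longrightarrow> v x \<in> tangent_space X x" "v x0 \<noteq> 0"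
    "\<And>x. x \<in> affine_cone X \<Longrightarrow> pairing l x \<noteq> 0 \<Longrightarrow> v x \<noteq> 0 \<Longrightarrow>
      x \<in> cone_reg X \<and> tangent_space X x = vec.span {x, v x}"
    using tangent_vector_field[OF X x0 l] by blast
  obtain \<gamma> r where \<gamma>: "r > 0" "\<gamma> 0 = x0" "\<And>s. s \<in> ball 0 r \<Longrightarrow> \<gamma> s \<in> affine_cone X"
    "\<And>s i. s \<in> ball 0 r \<Longrightarrow> ((\<lambda>s. \<gamma> s $ i) has_field_derivative v (\<gamma> s) $ i) (at s)"
    using integral_arc[OF irreducible_curveD(1,2)[OF X] v(1,3), of x0] x0 cone_reg_iff[OF X] by blast
  obtain j where j: "v x0 $ j \<noteq> 0" using v(4) by (metis vec_eq_iff zero_index)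
  have "(\<lambda>s. v (\<gamma> s) $ j) holomorphic_on ball 0 r"
    by (rule holomorphic_on_polynomial[OF v(1)])
      (use \<gamma>(4) in \<open>unfold holomorphic_on_open[OF open_ball], blast\<close>)
  then have "open (ball 0 r \<inter> (\<lambda>s. v (\<gamma> s) $ j) -` (- {0}))"
    using continuous_open_preimage[OF holomorphic_on_imp_continuous_on open_ball] by blast
  then obtain e where e: "e > 0" "ball 0 e \<subseteq> ball 0 r \<inter> (\<lambda>s. v (\<gamma> s) $ j) -` (- {0})"
    using \<gamma>(1,2) j by (metis ComplI IntI openE singletonD vimageI centre_in_ball)
  have "v (\<gamma> s) \<noteq> 0" if "s \<in> ball 0 e" for s
    using that e(2) by auto
  moreover have "ball (0::complex) e \<subseteq> ball 0 r" by (rule order_trans[OF e(2) Int_lower1])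
  ultimately have "regular_arc X l v \<gamma> e"
    unfolding regular_arc_def \<gamma>(2) using e(1) v(1-3,5) \<gamma>(3,4) l by blast
  then show thesis using that \<gamma>(2) by blast
qed

text \<open>
  If finitely many functionals determine every functional on \<open>C\<close>, then they are injective
  coordinates on the span.
\<close>
lemma curve_span_dim_le:
  fixes U :: "'k::finite \<Rightarrow> complex ^ 'n"
  assumes "\<And>u. \<exists>c. \<forall>x\<in>C. pairing u x = (\<Sum>i\<in>UNIV. c i * pairing (U i) x)"
  shows "vec.dim (vec.span C) \<le> CARD('k)"
proof -
  define A where "A = (\<chi> i. U i)"
  have A: "(A *v y) $ i = pairing (U i) y" for y i
    by (simp add: A_def matrix_vector_mult_pairing)
  have inj: "inj_on ((*v) A) (vec.span C)"
  proof (rule vec.inj_on_iff_eq_0[THEN iffD2])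
    show "vec.subspace (vec.span C)" by simp
    show "\<forall>y\<in>vec.span C. A *v y = 0 \<longrightarrow> y = 0"
    proof (intro ballI impI)
      fix y assume y: "y \<in> vec.span C" "A *v y = 0"
      have "pairing u y = 0" for u
      proof -
        obtain c where c: "\<forall>x\<in>C. pairing u x = (\<Sum>i\<in>UNIV. c i * pairing (U i) x)"
          using assms by blast
        have "pairing u y = (\<Sum>i\<in>UNIV. c i * pairing (U i) y)"
          using y(1)
        proof (induction rule: vec.span_induct)
          case base
          show ?case
            by (rule vec.subspaceI)
              (simp_all add: algebra_simps sum.distrib sum_distrib_left)
        next
          case (step x)
          then show ?case using c by blast
        qed
        then show ?thesis using A[of y] y(2) by simp
      qed
      then show "y = 0" using pairing_eq_zeroD[of y] by (simp add: pairing_commute[of y])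
    qed
  qed
  have lin: "Vector_Spaces.linear (*s) (*s) ((*v) A)" by simp
  have "vec.dim (vec.span C) = vec.dim ((*v) A ` vec.span C)"
    using vec.dim_image_eq[OF lin, of "vec.span C"] inj unfolding vec.span_span by simp
  also have "\<dots> \<le> CARD('k)"
    using dim_subset_UNIV_cart_gen by blast
  finally show ?thesis .
qed

text \<open>An arc in a line takes infinitely many values, while the curve meets each line in finitely many points.\<close>
lemma curve_span_dim_ge_3:
  assumes X: "irreducible_curve X" and deg: "curve_degree X > 1" and x0: "x0 \<in> cone_reg X" "x0 \<noteq> 0"
  shows "vec.dim (vec.span (affine_cone X)) \<ge> 3"
proof (rule ccontr)
  assume "\<not> ?thesis"
  then have small: "vec.dim (vec.span (affine_cone X)) \<le> 2" by simp
  obtain l where "pairing l x0 = 1" using pairing_nonzero[OF x0(2)] by metis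
  then obtain v \<gamma> r where arc: "regular_arc X l v \<gamma> r" "\<gamma> 0 = x0"
    using regular_arc_exists[OF X x0(1), of l] by auto
  have l: "pairing l x0 \<noteq> 0" using regular_arcD(4)[OF arc(1)] arc(2) by simp
  have r0: "0 \<in> ball 0 r" using regular_arcD(1)[OF arc(1)] by simp
  let ?w = "v x0"
  have wnz: "?w \<noteq> 0" using regular_arcD(9)[OF arc(1) r0] arc(2) by simp
  have w: "?w \<notin> vec.span {x0}"
    using regular_arcD(3)[OF arc(1), of x0] l wnz by (auto simp: span_singleton_iff)
  have x0C: "x0 \<in> affine_cone X" using x0 cone_reg_iff[OF X] by blast
  obtain u where u: "pairing u ?w = 1" using pairing_nonzero[OF wnz] by metis
  have wspan: "?w \<in> vec.span (affine_cone X)"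
  proof (rule ccontr)
    assume "?w \<notin> vec.span (affine_cone X)"
    then obtain u where u: "\<And>y. y \<in> vec.span (affine_cone X) \<Longrightarrow> pairing u y = 0" "pairing u ?w = 1"
      using separating_functional[OF vec.subspace_span] by metis
    then obtain s where "s \<in> ball 0 r" "pairing u (\<gamma> s) \<noteq> 0"
      using regular_arc_moves[OF arc(1), of u 0] arc(2) by auto
    then show False using u(1) regular_arcD(8)[OF arc(1)] vec.span_base by blast
  qed
  have W: "vec.span (affine_cone X) = vec.span {x0, ?w}"
    by (rule subspace_eq_span_pair[OF _ small _ wspan x0(2) w]) (auto intro: vec.span_base x0C)
  have \<gamma>: "\<gamma> s = x0 + (pairing u (\<gamma> s) - pairing u x0) *s ?w" if s: "s \<in> ball 0 r" for s
  proof -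
    have "\<gamma> s \<in> vec.span {x0, ?w}" using W regular_arcD(8)[OF arc(1) s] vec.span_base by blast
    then obtain a where "\<gamma> s - a *s x0 \<in> vec.span {?w}" by (auto simp: vec.span_insert)
    then obtain b where "\<gamma> s - a *s x0 = b *s ?w" using span_singleton_iff by blast
    then have ab: "\<gamma> s = a *s x0 + b *s ?w" by (metis add.commute diff_add_cancel)
    then have "a = 1" using regular_arc_l(1)[OF arc(1) s] l regular_arcD(3)[OF arc(1)] arc(2) by simp
    then show ?thesis using ab u by simp
  qed
  let ?T = "{t. x0 + t *s ?w \<in> affine_cone X}"
  have fin: "finite ?T" by (rule finite_line_curve[OF X deg x0(2) w])
  have "\<exists>t\<in>?T. \<forall>s\<in>ball 0 r. pairing u (\<gamma> s) - pairing u x0 - t = 0"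
  proof (rule holomorphic_prod_zero[OF open_ball connected_ball fin])
    show "(\<lambda>s. pairing u (\<gamma> s) - pairing u x0 - t) holomorphic_on ball 0 r" for t
      by (intro holomorphic_intros regular_arc_holomorphic[OF arc(1)]) simp
    fix s :: complex assume s: "s \<in> ball 0 r"
    have "pairing u (\<gamma> s) - pairing u x0 \<in> ?T" using \<gamma>[OF s] regular_arcD(8)[OF arc(1) s] by simp
    then show "(\<Prod>t\<in>?T. pairing u (\<gamma> s) - pairing u x0 - t) = 0"
      using fin by (intro prod_zero) auto
  qed (use r0 in blast)
  then obtain t where "\<forall>s\<in>ball 0 r. pairing u (\<gamma> s) = pairing u x0 + t" by (auto simp: algebra_simps)
  then show False
    using regular_arc_moves[OF arc(1), of u "pairing u x0 + t"] u arc(2) by auto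
qed

section \<open>Critical points\<close>

lemma critD:
  assumes X: "irreducible_curve X" and F: "homogeneous d F" and crit: "(x, u) \<in> crit_incidence F X"
  shows "x \<in> cone_reg X" "F x \<noteq> 0" "x \<in> affine_cone X"
    "v \<in> tangent_space X x \<Longrightarrow> pairing (gradient F x) v = F x * pairing u v"
    "pairing u x = of_nat d"
proof -
  show 1: "x \<in> cone_reg X" "F x \<noteq> 0" using crit by (auto simp: crit_incidence_def)
  then show C: "x \<in> affine_cone X" using cone_reg_iff[OF X] by blast
  show 2: "pairing (gradient F x) v = F x * pairing u v" if "v \<in> tangent_space X x" for v
    using crit that 1 by (auto simp: crit_incidence_def differential_def field_simps)
  show "pairing u x = of_nat d"
    using 2[OF radial_tangent[OF irreducible_curveD(3)[OF X] C]] gradient_Euler[OF F, of x] 1(2) by simp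
qed

lemma critI:
  assumes X: "irreducible_curve X" and F: "homogeneous d F" "d > 0"
    and x: "x \<in> cone_reg X" "F x \<noteq> 0" and u: "pairing u x \<noteq> 0"
    and eq: "\<And>v. v \<in> tangent_space X x \<Longrightarrow> of_nat d * F x * pairing u v = pairing (gradient F x) v * pairing u x"
  shows "((of_nat d / pairing u x) *s x, u) \<in> crit_incidence F X"
proof -
  let ?c = "of_nat d / pairing u x"
  have c: "?c \<noteq> 0" using u F(2) by simp
  have Fc: "F (?c *s x) = ?c ^ d * F x" by (rule homogeneousD[OF F(1)])
  have "differential F (?c *s x) v / F (?c *s x) - pairing u v = 0"
    if "v \<in> tangent_space X (?c *s x)" for v
  proof -
    have v: "v \<in> tangent_space X x"
      using that tangent_space_scale[OF irreducible_curveD(3)[OF X] c] by simp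
    have "pairing (gradient F x) v = ?c * F x * pairing u v"
      using eq[OF v] u by (simp add: field_simps)
    moreover have "differential F (?c *s x) v = ?c ^ (d - 1) * pairing (gradient F x) v"
      using gradient_scale[OF F c] by (simp add: differential_def)
    moreover have "?c ^ d = ?c ^ (d - 1) * ?c" using F(2) by (metis power_minus_mult)
    ultimately have "differential F (?c *s x) v = F (?c *s x) * pairing u v"
      using Fc by (simp only: mult_ac)
    moreover have "F (?c *s x) \<noteq> 0" using Fc c x(2) by simp
    ultimately show ?thesis by simp
  qed
  then show ?thesis
    using cone_reg_scale[OF X x(1) c] Fc c x(2) by (simp add: crit_incidence_def)
qed

lemma span_pair_iff: "x \<in> vec.span {a, b} \<longleftrightarrow> (\<exists>s t. x = s *s a + t *s b)" for a b :: "complex ^ 'n"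
proof
  assume "x \<in> vec.span {a, b}"
  then obtain s where "x - s *s a \<in> vec.span {b}" by (auto simp: vec.span_insert)
  then obtain t where "x - s *s a = t *s b" using span_singleton_iff by blast
  then show "\<exists>s t. x = s *s a + t *s b" by (metis add.commute diff_add_cancel)
qed (auto intro!: vec.span_add vec.span_scale intro: vec.span_base)

lemma MLD_eq_1D:
  assumes "MLD F X = 1"
  obtains q where "polynomial q" "q \<noteq> (\<lambda>_. 0)" "\<And>u. q u \<noteq> 0 \<Longrightarrow> \<exists>!x. (x, u) \<in> crit_incidence F X"
proof -
  have "generic_card (\<lambda>u. {x. (x, u) \<in> crit_incidence F X}) = 1"
    using assms unfolding MLD_def by (simp split: if_splits)
  then have "generically (\<lambda>u. finite {x. (x, u) \<in> crit_incidence F X} \<and>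
      card {x. (x, u) \<in> crit_incidence F X} = 1)"
    by (rule generic_card_eqD) simp
  then obtain q where q: "polynomial q" "q \<noteq> (\<lambda>_. 0)"
    "\<And>u. q u \<noteq> 0 \<Longrightarrow> card {x. (x, u) \<in> crit_incidence F X} = 1"
    unfolding generically_def by blast
  have "\<exists>!x. (x, u) \<in> crit_incidence F X" if u: "q u \<noteq> 0" for u
  proof -
    obtain y where "{x. (x, u) \<in> crit_incidence F X} = {y}" using q(3)[OF u] card_1_singletonE by blast
    then show ?thesis by (intro ex1I[of _ y]) blast+
  qed
  then show thesis using that q(1,2) by blast
qed

text \<open>
  A point \<open>\<gamma> s\<close> is critical, up to scaling, for the functionals \<open>u\<close> with \<open>m u s = 0\<close> below. A second
  point of the arc that is critical for some member of a pencil \<open>u0 + z u1\<close> of functionals critical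
  at \<open>\<gamma> 0\<close> contradicts uniqueness unless \<open>z\<close> is one of finitely many exceptional values. By the
  identity theorem \<open>m u1\<close> is then proportional to \<open>m u0\<close>, so that the functionals \<open>\<kappa>\<close> with \<open>m \<kappa> = 0\<close>
  form a space of codimension two. For such \<open>\<kappa>\<close> the functions \<open>\<kappa>\<^sup>d\<close> and \<open>F\<close> have vanishing Wronskian
  along the arc; this bounds the span of \<open>X\<close> and gives \<open>\<alpha>\<close>.
\<close>
lemma MLD_1_imp_power_of_linear_form:
  fixes X :: "(complex ^ 'n) set set"
  assumes X: "irreducible_curve X" and deg: "curve_degree X > 1"
    and F: "homogeneous d F" "d > 0" and MLD: "MLD F X = 1"
  obtains \<alpha> x0 where "\<And>x. x \<in> affine_cone X \<Longrightarrow> F x = pairing \<alpha> x ^ d"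
    "x0 \<in> cone_reg X" "pairing \<alpha> x0 \<noteq> 0" "vec.dim (vec.span (affine_cone X)) = 3"
proof -
  obtain q where q: "polynomial q" "q \<noteq> (\<lambda>_. 0)" "\<And>u. q u \<noteq> 0 \<Longrightarrow> \<exists>!x. (x, u) \<in> crit_incidence F X"
    using MLD_eq_1D[OF MLD] by blast
  obtain u0 where u0: "q u0 \<noteq> 0" using q(2) by blast
  then obtain p where p: "(p, u0) \<in> crit_incidence F X" using q(3) by blast
  note pD = critD[OF X F(1) p]
  have dnz: "of_nat d \<noteq> (0::complex)" using F(2) by simp
  have Fpoly: "polynomial F" using F(1) homogeneous_imp_polynomial by blast
  have u0p: "pairing u0 p \<noteq> 0" using pD(5) dnz by simp
  then have pnz: "p \<noteq> 0" by auto
  obtain v \<gamma> r1 where arc1: "regular_arc X u0 v \<gamma> r1" "\<gamma> 0 = p"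
    using regular_arc_exists[OF X pD(1) u0p] by blast
  obtain r where arc: "regular_arc X u0 v \<gamma> r" and Fnz: "\<And>s. s \<in> ball 0 r \<Longrightarrow> F (\<gamma> s) \<noteq> 0"
    using regular_arc_neighbourhood[OF arc1(1) Fpoly] arc1(2) pD(2) by metis
  have r0: "0 \<in> ball 0 r" using regular_arcD(1)[OF arc] by simp
  have u0\<gamma>: "pairing u0 (\<gamma> s) = of_nat d" if "s \<in> ball 0 r" for s
    using regular_arc_l(1)[OF arc that] arc1(2) pD(5) by simp
  have u0v: "pairing u0 (v x) = 0" for x by (rule regular_arcD(3)[OF arc])
  have vpnz: "v p \<noteq> 0" using regular_arcD(9)[OF arc r0] arc1(2) by simp
  \<comment> \<open>\<open>mm u x / (d F x)\<close> is the value of \<open>u - (u(x) / d) dF / F\<close> on the tangent vector \<open>v x\<close>\<close>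
  define mm where "mm u x = of_nat d * F x * pairing u (v x) - pairing (gradient F x) (v x) * pairing u x" for u x
  define m where "m u s = mm u (\<gamma> s)" for u s
  have mm_poly: "polynomial (mm u)" for u
    unfolding mm_def[abs_def] using Fpoly regular_arcD(2)[OF arc] by (auto intro!: polynomial_diff polynomial_mult polynomial_pairing_maps)
  have m_hol: "m u holomorphic_on ball 0 r" for u
    unfolding m_def[abs_def] by (rule regular_arc_holomorphic[OF arc mm_poly])
  have m_add: "m (u + c *s w) s = m u s + c * m w s" for u c w s
    by (simp add: m_def mm_def algebra_simps)
  have m_diff: "m (u - c *s w) s = m u s - c * m w s" for u c w s
    by (simp add: m_def mm_def algebra_simps)
  have gradp: "pairing (gradient F p) (v p) = 0"
    using pD(4)[OF regular_arcD(5)[OF arc pD(3)]] u0v by simp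
  have m0: "m u 0 = of_nat d * F p * pairing u (v p)" for u
    using gradp arc1(2) by (simp add: m_def mm_def)
  have crit: "((of_nat d / pairing u (\<gamma> s)) *s \<gamma> s, u) \<in> crit_incidence F X"
    if sb: "s \<in> ball 0 r" and ms: "m u s = 0" and nz: "pairing u (\<gamma> s) \<noteq> 0" for u s
  proof (rule critI[OF X F regular_arc_l(4)[OF arc sb] Fnz[OF sb] nz])
    fix w assume "w \<in> tangent_space X (\<gamma> s)"
    then obtain a b where w: "w = a *s \<gamma> s + b *s v (\<gamma> s)"
      using regular_arc_l(5)[OF arc sb] span_pair_iff by metis
    have "of_nat d * F (\<gamma> s) * pairing u (v (\<gamma> s)) = pairing (gradient F (\<gamma> s)) (v (\<gamma> s)) * pairing u (\<gamma> s)"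
      using ms by (simp add: m_def mm_def)
    then show "of_nat d * F (\<gamma> s) * pairing u w = pairing (gradient F (\<gamma> s)) w * pairing u (\<gamma> s)"
      using gradient_Euler[OF F(1), of "\<gamma> s"] by (simp add: w algebra_simps)
  qed
  have pencil: "\<exists>c. \<forall>s\<in>ball 0 r. m u1 s = c * m u0 s" if u1: "m u1 0 = 0" for u1
  proof -
    obtain w where w: "pairing w (v p) = 1" using pairing_nonzero[OF vpnz] by metis
    obtain pq where pq: "\<And>z. poly pq z = q (u0 + z *s u1)" using polynomial_on_line[OF q(1)] by blast
    \<comment> \<open>the zeros of \<open>R\<close> are the \<open>z\<close> for which \<open>q\<close> or the value at \<open>p\<close> of \<open>u0 + z u1\<close> vanishes\<close>
    define R where "R = pq * [:of_nat d, pairing u1 p:]"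
    have R0: "poly R 0 \<noteq> 0" using u0 dnz by (simp add: R_def pq)
    then have "R \<noteq> 0" by auto
    define Z where "Z = {z. poly R z = 0}"
    have finZ: "finite Z" unfolding Z_def by (rule poly_roots_finite[OF \<open>R \<noteq> 0\<close>])
    have Z0: "0 \<notin> Z" using R0 by (simp add: Z_def)
    have prod: "(pairing w (\<gamma> s) - pairing w p) * (m u1 s * (pairing u1 (v (\<gamma> s)) * (\<Prod>z\<in>Z. m u0 s + z * m u1 s))) = 0"
      if s: "s \<in> ball 0 r" for s
    proof (rule ccontr)
      assume "\<not> ?thesis"
      then have ne: "pairing w (\<gamma> s) \<noteq> pairing w p" "m u1 s \<noteq> 0" "pairing u1 (v (\<gamma> s)) \<noteq> 0"
        "(\<Prod>z\<in>Z. m u0 s + z * m u1 s) \<noteq> 0" by auto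
      define z where "z = - m u0 s / m u1 s"
      define u where "u = u0 + z *s u1"
      have z: "m u0 s + z * m u1 s = 0" using ne(2) by (simp add: z_def)
      then have "z \<notin> Z" using ne(4) finZ by (metis prod_zero)
      moreover have "poly R z = q u * (of_nat d + z * pairing u1 p)"
        by (simp add: R_def pq u_def algebra_simps)
      ultimately have qu: "q u \<noteq> 0" and "of_nat d + z * pairing u1 p \<noteq> 0"
        by (auto simp: Z_def)
      then have up: "pairing u p \<noteq> 0" using pD(5) by (simp add: u_def)
      have mus: "m u s = 0" using z by (simp add: u_def m_add)
      have mu0: "m u 0 = 0" using u1 m0[of u0] u0v by (simp add: u_def m_add)
      show False
      proof (cases "pairing u (\<gamma> s) = 0")
        case True
        then have "pairing u (v (\<gamma> s)) = 0" using mus Fnz[OF s] dnz by (simp add: m_def mm_def)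
        then have "z * pairing u1 (v (\<gamma> s)) = 0" using u0v by (simp add: u_def)
        then have "z = 0" using ne(3) by simp
        then show False using True u0\<gamma>[OF s] dnz by (simp add: u_def)
      next
        case False
        have "(of_nat d / pairing u p) *s p = (of_nat d / pairing u (\<gamma> s)) *s \<gamma> s"
          using crit[OF r0 mu0] crit[OF s mus False] up q(3)[OF qu] arc1(2) by auto
        then have eq: "pairing y ((of_nat d / pairing u p) *s p) = pairing y ((of_nat d / pairing u (\<gamma> s)) *s \<gamma> s)" for y
          by simp
        have "of_nat d / pairing u p = of_nat d / pairing u (\<gamma> s)"
          using eq[of u0] u0\<gamma>[OF s] pD(5) dnz by simp
        then show False using eq[of w] ne(1) dnz False up by simp
      qed
    qed
    have hol: "(\<lambda>s. pairing w (\<gamma> s) - pairing w p) holomorphic_on ball 0 r"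
      "(\<lambda>s. pairing u1 (v (\<gamma> s))) holomorphic_on ball 0 r"
      "(\<lambda>s. \<Prod>z\<in>Z. m u0 s + z * m u1 s) holomorphic_on ball 0 r"
    proof -
      show "(\<lambda>s. pairing w (\<gamma> s) - pairing w p) holomorphic_on ball 0 r"
        by (intro holomorphic_intros regular_arc_holomorphic[OF arc]) simp
      have "polynomial (\<lambda>x. pairing u1 (v x))"
        using regular_arcD(2)[OF arc] by (intro polynomial_pairing_maps) auto
      then show "(\<lambda>s. pairing u1 (v (\<gamma> s))) holomorphic_on ball 0 r"
        by (rule regular_arc_holomorphic[OF arc])
      show "(\<lambda>s. \<Prod>z\<in>Z. m u0 s + z * m u1 s) holomorphic_on ball 0 r"
        by (intro holomorphic_intros m_hol)
    qed
    note split = holomorphic_mult_zero[OF open_ball connected_ball]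
    have "(\<forall>s\<in>ball 0 r. pairing w (\<gamma> s) - pairing w p = 0) \<or>
        (\<forall>s\<in>ball 0 r. m u1 s * (pairing u1 (v (\<gamma> s)) * (\<Prod>z\<in>Z. m u0 s + z * m u1 s)) = 0)"
      by (rule split[OF hol(1) _ prod]) (intro holomorphic_intros m_hol hol)
    moreover have "\<not> (\<forall>s\<in>ball 0 r. pairing w (\<gamma> s) - pairing w p = 0)"
      using regular_arc_moves[OF arc, of w "pairing w p"] w arc1(2) by auto
    ultimately have 1: "\<And>s. s \<in> ball 0 r \<Longrightarrow> m u1 s * (pairing u1 (v (\<gamma> s)) * (\<Prod>z\<in>Z. m u0 s + z * m u1 s)) = 0"
      by blast
    have "(\<forall>s\<in>ball 0 r. m u1 s = 0) \<or>
        (\<forall>s\<in>ball 0 r. pairing u1 (v (\<gamma> s)) * (\<Prod>z\<in>Z. m u0 s + z * m u1 s) = 0)"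
      by (rule split[OF m_hol _ 1]) (intro holomorphic_intros m_hol hol)
    then consider (a) "\<forall>s\<in>ball 0 r. m u1 s = 0"
      | (b) "\<forall>s\<in>ball 0 r. pairing u1 (v (\<gamma> s)) = 0" | (c) "\<forall>s\<in>ball 0 r. (\<Prod>z\<in>Z. m u0 s + z * m u1 s) = 0"
      using split[OF hol(2,3)] by blast
    then show ?thesis
    proof cases
      case a
      then show ?thesis by (intro exI[of _ 0]) simp
    next
      case b
      have "m u1 s = (pairing u1 p / of_nat d) * m u0 s" if s: "s \<in> ball 0 r" for s
      proof -
        have "pairing u1 (\<gamma> s) = pairing u1 p"
          using regular_arc_constant[OF arc _ s, of u1] b arc1(2) by simp
        then show ?thesis using b s u0v u0\<gamma>[OF s] dnz by (simp add: m_def mm_def)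
      qed
      then show ?thesis by blast
    next
      case c
      have "\<exists>z\<in>Z. \<forall>s\<in>ball 0 r. m u0 s + z * m u1 s = 0"
        using c r0 by (intro holomorphic_prod_zero[OF open_ball connected_ball finZ]) (auto intro!: holomorphic_intros m_hol)
      then obtain z where z: "z \<in> Z" "\<And>s. s \<in> ball 0 r \<Longrightarrow> m u0 s + z * m u1 s = 0" by blast
      then have znz: "z \<noteq> 0" using Z0 by blast
      have "m u1 s = (- 1 / z) * m u0 s" if s: "s \<in> ball 0 r" for s
      proof -
        have "m u0 s = - (z * m u1 s)" using z(2)[OF s] by (rule eq_neg_iff_add_eq_0[THEN iffD2])
        then show ?thesis using znz by simp
      qed
      then show ?thesis by blast
    qed
  qed
  define K where "K = {u. \<forall>s\<in>ball 0 r. m u s = 0}"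
  have K_power: "pairing \<kappa> (\<gamma> s) ^ d = (pairing \<kappa> p ^ d / F p) * F (\<gamma> s)" if \<kappa>: "\<kappa> \<in> K" and s: "s \<in> ball 0 r" for \<kappa> s
  proof -
    have "pairing \<kappa> (\<gamma> s) ^ d = (pairing \<kappa> (\<gamma> 0) ^ d / F (\<gamma> 0)) * F (\<gamma> s)"
    proof (rule wronskian_zero[OF open_ball connected_ball regular_arc_derivative[OF arc Fpoly] _ _ r0 Fnz[OF r0] s])
      fix s :: complex assume s: "s \<in> ball 0 r"
      show "((\<lambda>s. pairing \<kappa> (\<gamma> s) ^ d) has_field_derivative
          of_nat d * pairing \<kappa> (\<gamma> s) ^ (d - 1) * pairing \<kappa> (v (\<gamma> s))) (at s)"
        using DERIV_power[OF regular_arc_derivative_pairing[OF arc s, of \<kappa>], where n = d]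
        by (simp add: algebra_simps)
      have "pairing \<kappa> (\<gamma> s) ^ d = pairing \<kappa> (\<gamma> s) ^ (d - 1) * pairing \<kappa> (\<gamma> s)"
        using F(2) by (metis power_minus_mult)
      moreover have "of_nat d * F (\<gamma> s) * pairing \<kappa> (v (\<gamma> s)) =
          pairing (gradient F (\<gamma> s)) (v (\<gamma> s)) * pairing \<kappa> (\<gamma> s)"
        using \<kappa> s by (auto simp: K_def m_def mm_def)
      ultimately show "F (\<gamma> s) * (of_nat d * pairing \<kappa> (\<gamma> s) ^ (d - 1) * pairing \<kappa> (v (\<gamma> s))) =
          pairing (gradient F (\<gamma> s)) (v (\<gamma> s)) * pairing \<kappa> (\<gamma> s) ^ d"
        by (simp add: algebra_simps)
    qed
    then show ?thesis using arc1(2) by simp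
  qed
  have K_zero: "pairing \<kappa> x = 0" if \<kappa>: "\<kappa> \<in> K" "pairing \<kappa> p = 0" and x: "x \<in> affine_cone X" for \<kappa> x
  proof (rule regular_arc_dense[OF X arc homogeneous_pairing _ x])
    fix s :: complex assume "s \<in> ball 0 r"
    then have "pairing \<kappa> (\<gamma> s) ^ d = 0" using K_power[OF \<kappa>(1)] \<kappa>(2) F(2) by (simp add: power_0_left)
    then show "pairing \<kappa> (\<gamma> s) = 0" by simp
  qed
  obtain us where us: "pairing us (v p) = 1" using pairing_nonzero[OF vpnz] by metis
  have mus: "m us 0 \<noteq> 0" using m0[of us] us dnz pD(2) by simp
  \<comment> \<open>\<open>us\<close> and \<open>u0\<close> span the functionals modulo \<open>K\<close>, since subtracting a multiple of \<open>us\<close> makes \<open>m u 0\<close> vanish\<close>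
  have decomp: "\<exists>a b. u - a *s us - b *s u0 \<in> K" for u
  proof -
    let ?a = "m u 0 / m us 0"
    have "m (u - ?a *s us) 0 = 0" using mus by (simp add: m_diff)
    then obtain c where "\<forall>s\<in>ball 0 r. m (u - ?a *s us) s = c * m u0 s" using pencil by blast
    then have "u - ?a *s us - c *s u0 \<in> K" by (simp add: K_def m_diff)
    then show ?thesis by blast
  qed
  have dim_ge: "vec.dim (vec.span (affine_cone X)) \<ge> 3"
    by (rule curve_span_dim_ge_3[OF X deg pD(1) pnz])
  have "\<exists>\<kappa>\<in>K. pairing \<kappa> p \<noteq> 0"
  proof (rule ccontr)
    assume neg: "\<not> ?thesis"
    have "\<exists>c. \<forall>x\<in>affine_cone X. pairing u x = (\<Sum>i\<in>(UNIV::2 set). c i * pairing (if i = 1 then us else u0) x)" for u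
    proof -
      obtain a b where "u - a *s us - b *s u0 \<in> K" using decomp by blast
      then have "pairing (u - a *s us - b *s u0) x = 0" if "x \<in> affine_cone X" for x
        using K_zero that neg by blast
      then show ?thesis
        by (intro exI[of _ "\<lambda>i. if i = 1 then a else b"]) (simp add: sum_2 algebra_simps)
    qed
    then have "vec.dim (vec.span (affine_cone X)) \<le> CARD(2)" by (rule curve_span_dim_le)
    then show False using dim_ge by simp
  qed
  then obtain \<kappa> where \<kappa>: "\<kappa> \<in> K" "pairing \<kappa> p \<noteq> 0" by blast
  have "\<exists>c. \<forall>x\<in>affine_cone X. pairing u x =
      (\<Sum>i\<in>(UNIV::3 set). c i * pairing (if i = 1 then us else if i = 2 then u0 else \<kappa>) x)" for u
  proof -
    obtain a b where ab: "u - a *s us - b *s u0 \<in> K" using decomp by blast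
    let ?k = "u - a *s us - b *s u0"
    let ?c = "pairing ?k p / pairing \<kappa> p"
    have "?k - ?c *s \<kappa> \<in> K" using ab \<kappa>(1) by (simp add: K_def m_diff)
    moreover have "pairing (?k - ?c *s \<kappa>) p = 0" using \<kappa>(2) by simp
    ultimately have "pairing (?k - ?c *s \<kappa>) x = 0" if "x \<in> affine_cone X" for x
      using K_zero that by blast
    then have "pairing u x = a * pairing us x + b * pairing u0 x + ?c * pairing \<kappa> x"
      if "x \<in> affine_cone X" for x
      using that by (simp add: algebra_simps)
    then show ?thesis
      by (intro exI[of _ "\<lambda>i. if i = 1 then a else if i = 2 then b else ?c"]) (simp add: sum_3)
  qed
  then have "vec.dim (vec.span (affine_cone X)) \<le> CARD(3)" by (rule curve_span_dim_le)
  then have dim3: "vec.dim (vec.span (affine_cone X)) = 3" using dim_ge by simp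
  have "d \<noteq> 0" using F(2) by simp
  then obtain c where c: "c ^ d = F p / pairing \<kappa> p ^ d"
    by (metis exists_complex_root)
  have \<alpha>: "F x = pairing (c *s \<kappa>) x ^ d" if x: "x \<in> affine_cone X" for x
  proof -
    have "homogeneous d (\<lambda>x. F x - pairing (c *s \<kappa>) x ^ d)"
      using homogeneous_diff[OF F(1) homogeneous_power[OF homogeneous_pairing, of d "c *s \<kappa>", simplified]] by simp
    moreover have "F (\<gamma> s) - pairing (c *s \<kappa>) (\<gamma> s) ^ d = 0" if s: "s \<in> ball 0 r" for s
      using K_power[OF \<kappa>(1) s] c \<kappa>(2) pD(2) by (simp add: power_mult_distrib)
    ultimately have "F x - pairing (c *s \<kappa>) x ^ d = 0"
      by (rule regular_arc_dense[OF X arc _ _ x])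
    then show ?thesis by simp
  qed
  have "pairing (c *s \<kappa>) p \<noteq> 0"
    using \<alpha>[OF pD(3)] pD(2) F(2) by (auto simp: power_0_left)
  then show thesis using that[OF \<alpha> pD(1) _ dim3] by blast
qed

section \<open>Plane coordinates\<close>

lemma linear_form_vanishing_on_span:
  assumes "\<And>x. x \<in> C \<Longrightarrow> pairing u x = 0" "x \<in> vec.span C"
  shows "pairing u x = 0"
  using assms(2)
proof (induction rule: vec.span_induct)
  case base
  show ?case by (rule vec.subspaceI) simp_all
qed (use assms(1) in blast)

lemma plane_coordinates:
  fixes W :: "(complex ^ 'n) set"
  assumes W: "vec.subspace W" "vec.dim W = 3" and \<alpha>: "y \<in> W" "pairing \<alpha> y \<noteq> 0"
    and \<beta>1: "\<And>c. \<exists>x\<in>W. pairing \<beta>1 x \<noteq> c * pairing \<alpha> x"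
  obtains \<beta>2 w0 w1 w2 where "w0 \<in> W" "w1 \<in> W" "w2 \<in> W"
    "pairing \<alpha> w0 = 1" "pairing \<alpha> w1 = 0" "pairing \<alpha> w2 = 0"
    "pairing \<beta>1 w0 = 0" "pairing \<beta>1 w1 = 1" "pairing \<beta>1 w2 = 0"
    "pairing \<beta>2 w0 = 0" "pairing \<beta>2 w1 = 0" "pairing \<beta>2 w2 = 1"
    "\<And>x. x \<in> W \<Longrightarrow> x = pairing \<beta>1 x *s w1 + pairing \<beta>2 x *s w2 + pairing \<alpha> x *s w0"
proof -
  note sub = vec.subspace_add[OF W(1)] vec.subspace_diff[OF W(1)] vec.subspace_scale[OF W(1)]
  define y0 where "y0 = (1 / pairing \<alpha> y) *s y"
  have y0: "y0 \<in> W" "pairing \<alpha> y0 = 1" using \<alpha> by (auto simp: y0_def intro: sub)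
  obtain x where x: "x \<in> W" "pairing \<beta>1 x \<noteq> pairing \<beta>1 y0 * pairing \<alpha> x" using \<beta>1 by blast
  define z where "z = x - pairing \<alpha> x *s y0"
  have z: "z \<in> W" "pairing \<alpha> z = 0" "pairing \<beta>1 z \<noteq> 0"
    using x y0 by (auto simp: z_def intro: sub)
  define w1 where "w1 = (1 / pairing \<beta>1 z) *s z"
  have w1: "w1 \<in> W" "pairing \<alpha> w1 = 0" "pairing \<beta>1 w1 = 1" using z by (auto simp: w1_def intro: sub)
  define w0 where "w0 = y0 - pairing \<beta>1 y0 *s w1"
  have w0: "w0 \<in> W" "pairing \<alpha> w0 = 1" "pairing \<beta>1 w0 = 0" using y0 w1 by (auto simp: w0_def intro: sub)
  have "\<not> W \<subseteq> vec.span {w0, w1}"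
  proof
    assume "W \<subseteq> vec.span {w0, w1}"
    then have "vec.dim W \<le> card {w0, w1}" by (rule vec.dim_le_card) simp
    also have "\<dots> \<le> 2" by (simp add: card_insert_if)
    finally show False using W(2) by simp
  qed
  then obtain t where t: "t \<in> W" "t \<notin> vec.span {w0, w1}" by blast
  define w2 where "w2 = t - pairing \<beta>1 t *s w1 - pairing \<alpha> t *s w0"
  have w2: "w2 \<in> W" "pairing \<alpha> w2 = 0" "pairing \<beta>1 w2 = 0"
    using t w0 w1 by (auto simp: w2_def intro!: sub)
  have w2n: "w2 \<notin> vec.span {w0, w1}"
  proof
    assume "w2 \<in> vec.span {w0, w1}"
    then have "w2 + pairing \<beta>1 t *s w1 + pairing \<alpha> t *s w0 \<in> vec.span {w0, w1}"
      by (intro vec.span_add vec.span_scale) (auto intro: vec.span_base)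
    then show False using t(2) by (simp add: w2_def)
  qed
  obtain \<beta>2 where \<beta>2: "\<And>w. w \<in> vec.span {w0, w1} \<Longrightarrow> pairing \<beta>2 w = 0" "pairing \<beta>2 w2 = 1"
    using separating_functional[OF vec.subspace_span w2n] by metis
  have \<beta>2w: "pairing \<beta>2 w0 = 0" "pairing \<beta>2 w1 = 0" using \<beta>2(1) by (auto intro: vec.span_base)
  have "w1 \<notin> vec.span {w0}" using w1 w0 by (auto simp: span_singleton_iff)
  moreover have "w0 \<noteq> 0" using w0 by auto
  ultimately have ind: "vec.independent {w1, w0}" "card {w1, w0} = 2"
    using independent_pair[of w0 w1] by (auto simp: insert_commute)
  have nin: "w2 \<notin> {w1, w0}" using w2n by (auto intro: vec.span_base)
  moreover have "w0 \<noteq> w1" using ind(2) by auto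
  ultimately have ind3: "vec.independent {w2, w1, w0}" "card {w2, w1, w0} = 3"
    using ind w2n vec.independent_insert[of w2 "{w1, w0}"] by (auto simp: insert_commute card_insert_if)
  have Wspan: "W \<subseteq> vec.span {w2, w1, w0}"
    using vec.card_ge_dim_independent[of "{w2, w1, w0}" W] ind3 W(2) w0(1) w1(1) w2(1) by auto
  have "x = pairing \<beta>1 x *s w1 + pairing \<beta>2 x *s w2 + pairing \<alpha> x *s w0" if "x \<in> W" for x
  proof -
    have "x \<in> vec.span {w2, w1, w0}" using Wspan that by blast
    then obtain c where "x - c *s w2 \<in> vec.span {w1, w0}" by (auto simp: vec.span_insert[of w2])
    then obtain a b where "x - c *s w2 = a *s w1 + b *s w0" using span_pair_iff by blast
    then have "x = a *s w1 + c *s w2 + b *s w0" by (simp add: algebra_simps)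
    then show ?thesis using w0 w1 w2 \<beta>2(2) \<beta>2w by simp
  qed
  then show thesis using that[OF w0(1) w1(1) w2(1)] w0 w1 w2 \<beta>2w \<beta>2(2) by blast
qed

lemma second_coordinate:
  fixes W :: "(complex ^ 'n) set"
  assumes W: "vec.subspace W" "vec.dim W = 3" and \<alpha>: "y \<in> W" "pairing \<alpha> y \<noteq> 0"
  obtains \<beta> where "\<And>c. \<exists>x\<in>W. pairing \<beta> x \<noteq> c * pairing \<alpha> x"
proof -
  have "\<not> W \<subseteq> vec.span {y}"
  proof
    assume "W \<subseteq> vec.span {y}"
    then have "vec.dim W \<le> card {y}" by (rule vec.dim_le_card) simp
    then show False using W(2) by simp
  qed
  then obtain x where x: "x \<in> W" "x \<notin> vec.span {y}" by blast
  obtain \<beta> where \<beta>: "\<And>w. w \<in> vec.span {y} \<Longrightarrow> pairing \<beta> w = 0" "pairing \<beta> x = 1"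
    using separating_functional[OF vec.subspace_span x(2)] by metis
  have "\<exists>x\<in>W. pairing \<beta> x \<noteq> c * pairing \<alpha> x" for c
  proof (cases "c = 0")
    case True
    then show ?thesis using x(1) \<beta>(2) by (intro bexI[of _ x]) auto
  next
    case False
    have "pairing \<beta> y = 0" using \<beta>(1) vec.span_base by blast
    then show ?thesis using \<alpha> False by (intro bexI[of _ y]) auto
  qed
  then show thesis using that by blast
qed

text \<open>A functional that vanishes on \<open>X\<close> lies in the ideal and is its own differential.\<close>
lemma tangent_space_subset_span:
  assumes X: "irreducible_curve X"
  shows "tangent_space X x \<subseteq> vec.span (affine_cone X)"
proof
  fix v assume v: "v \<in> tangent_space X x"
  show "v \<in> vec.span (affine_cone X)"
  proof (rule ccontr)
    assume "v \<notin> vec.span (affine_cone X)"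
    then obtain u where u: "\<And>w. w \<in> vec.span (affine_cone X) \<Longrightarrow> pairing u w = 0" "pairing u v = 1"
      using separating_functional[OF vec.subspace_span] by metis
    then have "pairing u \<in> vanishing_ideal X" by (auto simp: vanishing_ideal_def intro: vec.span_base)
    then show False using tangentD[OF v] u(2) by fastforce
  qed
qed

section \<open>The dual variety\<close>

text \<open>
  The dual variety is the closure of the set of points \<open>[u]\<close> for nonzero \<open>u\<close> in this set; that the set
  contains \<open>0\<close> makes it stable under scaling.
\<close>
definition tangent_covectors :: "(complex ^ 'n) set set \<Rightarrow> (complex ^ 'n) set" where
  "tangent_covectors X = {u. \<exists>x\<in>cone_reg X. x \<noteq> 0 \<and> (\<forall>v\<in>tangent_space X x. pairing u v = 0)}"

lemma tangent_covectors_scale: "u \<in> tangent_covectors X \<Longrightarrow> c *s u \<in> tangent_covectors X"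
  by (auto simp: tangent_covectors_def)

lemma tangent_covectors_annihilator:
  assumes "u \<in> tangent_covectors X" "irreducible_curve X" "\<And>x. x \<in> affine_cone X \<Longrightarrow> pairing \<kappa> x = 0"
  shows "u + \<kappa> \<in> tangent_covectors X"
proof -
  have "pairing \<kappa> v = 0" if "v \<in> tangent_space X x" for x v
    using linear_form_vanishing_on_span[OF assms(3)] tangent_space_subset_span[OF assms(2)] that by blast
  then show ?thesis using assms(1) by (auto simp: tangent_covectors_def)
qed

lemma dual_variety_eq:
  "dual_variety X = proj_closure {vec.span {u} | u. u \<in> tangent_covectors X \<and> u \<noteq> 0}"
  by (auto simp: dual_variety_def tangent_covectors_def intro!: arg_cong[where f = proj_closure])

lemma tangent_covectors_subset_dual:
  assumes "u \<in> tangent_covectors X"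
  shows "u \<in> affine_cone (dual_variety X)"
proof (cases "u = 0")
  case False
  have "vec.span {u} \<in> dual_variety X"
    unfolding dual_variety_eq proj_closure_def using assms False by blast
  then show ?thesis using vec.span_base[of u "{u}"] by (auto simp: affine_cone_def)
qed (simp add: affine_cone_def)

text \<open>
  The covectors are stable under scaling, so every homogeneous component of \<open>G\<close> vanishes on them
  and hence on the closure.
\<close>
lemma vanishing_ideal_dual:
  assumes G: "polynomial G" and zero: "\<And>u. u \<in> tangent_covectors X \<Longrightarrow> G u = 0"
    and ne: "tangent_covectors X \<noteq> {}"
  shows "G \<in> vanishing_ideal (dual_variety X)"
proof -
  obtain p N where p: "\<And>j. homogeneous j (\<lambda>x. coeff (p x) j)" "\<And>x. degree (p x) \<le> N"
    "\<And>x t. poly (p x) t = G (t *s x)"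
    using homogeneous_components[OF G] by blast
  have pz: "p u = 0" if "u \<in> tangent_covectors X" for u
    using zero[OF tangent_covectors_scale[OF that]] p(3) by (metis poly_all_0_iff_0)
  let ?P = "{vec.span {u} | u. u \<in> tangent_covectors X \<and> u \<noteq> 0}"
  have P: "?P \<subseteq> proj_space" by (auto simp: proj_space_def)
  define S where "S = {f. (\<exists>k. homogeneous k f) \<and> (\<forall>p\<in>?P. \<forall>v\<in>p. f v = (0::complex))}"
  have dual: "dual_variety X = proj_zeros S"
    unfolding dual_variety_eq S_def by (rule proj_closure_eq[OF P])
  have comp: "(\<lambda>x. coeff (p x) j) \<in> S" for j
  proof -
    have "coeff (p (c *s u)) j = 0" if "u \<in> tangent_covectors X" for u c
      using pz[OF tangent_covectors_scale[OF that]] by simp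
    then show ?thesis using p(1)[of j] by (auto simp: span_singleton_iff S_def)
  qed
  have "G y = 0" if y: "y \<in> affine_cone (dual_variety X)" for y
  proof (cases "y = 0")
    case True
    obtain u where "u \<in> tangent_covectors X" using ne by blast
    then show ?thesis using True zero[OF tangent_covectors_scale[of u X 0]] by simp
  next
    case False
    then obtain P where P: "P \<in> dual_variety X" "y \<in> P" using y by (auto simp: affine_cone_def)
    from P(1) have "\<forall>f\<in>S. \<forall>v\<in>P. f v = 0" unfolding dual proj_zeros_def by simp
    then have "coeff (p y) j = 0" for j using bspec[OF _ comp[of j]] P(2) by blast
    then have "p y = 0" by (simp add: poly_eq_iff)
    then show ?thesis using p(3)[of y 1] by simp
  qed
  then show ?thesis using G by (simp add: vanishing_ideal_def)
qed

text \<open>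
  The covector \<open>u\<close> is corrected by multiples of \<open>q\<close> and of \<open>l\<close>, holomorphic along the arc, so that it
  remains orthogonal to \<open>\<gamma>\<close> and to \<open>v(\<gamma>)\<close>, which span the tangent space.
\<close>
lemma tangent_covector_arc:
  fixes X :: "(complex ^ 'n) set set"
  assumes X: "irreducible_curve X" and x0: "x0 \<in> cone_reg X" "x0 \<noteq> 0"
    and u: "\<And>v. v \<in> tangent_space X x0 \<Longrightarrow> pairing u v = 0"
  obtains l v \<gamma> r U where "regular_arc X l v \<gamma> r" "\<gamma> 0 = x0" "U 0 = u"
    "\<And>i. (\<lambda>s. U s $ i) holomorphic_on ball 0 r"
    "\<And>s w. s \<in> ball 0 r \<Longrightarrow> w \<in> tangent_space X (\<gamma> s) \<Longrightarrow> pairing (U s) w = 0"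
proof -
  obtain l where "pairing l x0 = 1" using pairing_nonzero[OF x0(2)] by metis
  then obtain v \<gamma> r1 where arc1: "regular_arc X l v \<gamma> r1" "\<gamma> 0 = x0"
    using regular_arc_exists[OF X x0(1), of l] by auto
  have 0: "0 \<in> ball 0 r1" using regular_arcD(1)[OF arc1(1)] by simp
  obtain q where q: "pairing q (v x0) = 1"
    using pairing_nonzero[OF regular_arcD(9)[OF arc1(1) 0]] arc1(2) by metis
  have polv: "polynomial (\<lambda>x. pairing w (v x))" for w
    using regular_arcD(2)[OF arc1(1)] by (intro polynomial_pairing_maps) auto
  obtain r where arc: "regular_arc X l v \<gamma> r" and nz: "\<And>s. s \<in> ball 0 r \<Longrightarrow> pairing q (v (\<gamma> s)) \<noteq> 0"
    using regular_arc_neighbourhood[OF arc1(1) polv[of q]] q arc1(2) by auto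
  define b where "b s = - pairing u (v (\<gamma> s)) / pairing q (v (\<gamma> s))" for s
  define a where "a s = - (pairing u (\<gamma> s) + b s * pairing q (\<gamma> s)) / pairing l (\<gamma> s)" for s
  define U where "U s = u + b s *s q + a s *s l" for s
  have hol: "(\<lambda>s. pairing w (v (\<gamma> s))) holomorphic_on ball 0 r" "(\<lambda>s. pairing w (\<gamma> s)) holomorphic_on ball 0 r" for w
    by (rule regular_arc_holomorphic[OF arc polv]) (rule regular_arc_holomorphic[OF arc polynomial_pairing(1)])
  have b: "b holomorphic_on ball 0 r"
    unfolding b_def[abs_def] by (intro holomorphic_intros hol nz)
  have a: "a holomorphic_on ball 0 r"
    unfolding a_def[abs_def] by (intro holomorphic_intros hol b regular_arc_l(2)[OF arc])
  have "(\<lambda>s. U s $ i) holomorphic_on ball 0 r" for i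
    unfolding U_def by (auto intro!: holomorphic_intros a b)
  moreover have "pairing (U s) w = 0" if s: "s \<in> ball 0 r" and w: "w \<in> tangent_space X (\<gamma> s)" for s w
  proof -
    obtain y z where w: "w = y *s \<gamma> s + z *s v (\<gamma> s)"
      using w regular_arc_l(5)[OF arc s] span_pair_iff by metis
    have "pairing (U s) (v (\<gamma> s)) = 0"
      using nz[OF s] regular_arcD(3)[OF arc] by (simp add: U_def b_def)
    moreover have "pairing (U s) (\<gamma> s) = 0"
      using regular_arc_l(2)[OF arc s] by (simp add: U_def a_def)
    ultimately show ?thesis by (simp add: w)
  qed
  moreover have "U 0 = u"
  proof -
    have x0C: "x0 \<in> affine_cone X" using x0 cone_reg_iff[OF X] by blast
    have "b 0 = 0" using u[OF regular_arcD(5)[OF arc x0C]] arc1(2) by (simp add: b_def)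
    moreover have "a 0 = 0"
      using u[OF radial_tangent[OF irreducible_curveD(3)[OF X] x0C]] arc1(2) \<open>b 0 = 0\<close> by (simp add: a_def)
    ultimately show ?thesis by (simp add: U_def)
  qed
  ultimately show thesis using that arc arc1(2) by blast
qed

text \<open>Tangency at the points of \<open>X\<close> off a hypersurface \<open>f = 0\<close> is general enough to test polynomials.\<close>
lemma tangent_covectors_dense:
  fixes X :: "(complex ^ 'n) set set"
  assumes X: "irreducible_curve X" and G: "polynomial G"
    and f: "homogeneous k f" "y \<in> affine_cone X" "f y \<noteq> 0"
    and zero: "\<And>x u. x \<in> cone_reg X \<Longrightarrow> x \<noteq> 0 \<Longrightarrow> f x \<noteq> 0 \<Longrightarrow>
      (\<And>v. v \<in> tangent_space X x \<Longrightarrow> pairing u v = 0) \<Longrightarrow> G u = 0"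
    and u: "u \<in> tangent_covectors X"
  shows "G u = 0"
proof -
  obtain x0 where x0: "x0 \<in> cone_reg X" "x0 \<noteq> 0" "\<And>v. v \<in> tangent_space X x0 \<Longrightarrow> pairing u v = 0"
    using u by (auto simp: tangent_covectors_def)
  obtain l v \<gamma> r U where U: "regular_arc X l v \<gamma> r" "\<gamma> 0 = x0" "U 0 = u"
    "\<And>i. (\<lambda>s. U s $ i) holomorphic_on ball 0 r"
    "\<And>s w. s \<in> ball 0 r \<Longrightarrow> w \<in> tangent_space X (\<gamma> s) \<Longrightarrow> pairing (U s) w = 0"
    using tangent_covector_arc[OF X x0] by blast
  have "f (\<gamma> s) * G (U s) = 0" if "s \<in> ball 0 r" for s
    using zero[OF regular_arc_l(4,3)[OF U(1) that] _ U(5)[OF that]] by auto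
  then have "(\<forall>s\<in>ball 0 r. f (\<gamma> s) = 0) \<or> (\<forall>s\<in>ball 0 r. G (U s) = 0)"
    by (rule holomorphic_mult_zero[OF open_ball connected_ball
          regular_arc_holomorphic[OF U(1) homogeneous_imp_polynomial[OF f(1)]] holomorphic_on_polynomial[OF G U(4)]])
  moreover have "\<not> (\<forall>s\<in>ball 0 r. f (\<gamma> s) = 0)"
    using regular_arc_dense[OF X U(1) f(1) _ f(2)] f(3) by blast
  ultimately show ?thesis using regular_arcD(1)[OF U(1)] U(3) by (metis centre_in_ball)
qed

section \<open>Equations of hypersurfaces\<close>

lemma hypersurface_equationD:
  assumes "hypersurface_equation Y g"
  obtains e where "e > 0" "homogeneous e g" "\<exists>u. g u \<noteq> 0"
    "\<And>f. f \<in> vanishing_ideal Y \<longleftrightarrow> (\<exists>h. polynomial h \<and> f = (\<lambda>x. g x * h x))"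
proof -
  obtain e where "e > 0" "homogeneous e g" using assms unfolding hypersurface_equation_def by blast
  moreover have "\<exists>u. g u \<noteq> 0" using assms unfolding hypersurface_equation_def by blast
  moreover have "f \<in> vanishing_ideal Y \<longleftrightarrow> (\<exists>h. polynomial h \<and> f = (\<lambda>x. g x * h x))" for f
    using assms unfolding hypersurface_equation_def by blast
  ultimately show thesis by (rule that)
qed

text \<open>Two generators divide each other, and the units of the polynomial ring are constant.\<close>
lemma hypersurface_equation_unique:
  assumes "hypersurface_equation Y g" "hypersurface_equation Y g'"
  obtains c where "c \<noteq> 0" "g' = (\<lambda>x. c * g x)"
proof -
  obtain e where g: "homogeneous e g" "\<exists>u. g u \<noteq> 0"
    "\<And>f. f \<in> vanishing_ideal Y \<longleftrightarrow> (\<exists>h. polynomial h \<and> f = (\<lambda>x. g x * h x))"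
    using hypersurface_equationD[OF assms(1)] by metis
  obtain e' where g': "homogeneous e' g'" "\<exists>u. g' u \<noteq> 0"
    "\<And>f. f \<in> vanishing_ideal Y \<longleftrightarrow> (\<exists>h. polynomial h \<and> f = (\<lambda>x. g' x * h x))"
    using hypersurface_equationD[OF assms(2)] by metis
  have "g \<in> vanishing_ideal Y" using g(3) by (auto intro!: exI[of _ "\<lambda>_. 1"])
  then obtain h where h: "polynomial h" "g = (\<lambda>x. g' x * h x)" using g'(3) by blast
  have "g' \<in> vanishing_ideal Y" using g'(3) by (auto intro!: exI[of _ "\<lambda>_. 1"])
  then obtain h' where h': "polynomial h'" "g' = (\<lambda>x. g x * h' x)" using g(3) by blast
  have gp: "polynomial g" using g(1) homogeneous_imp_polynomial by blast
  have "g x * (h' x * h x - 1) = 0" for x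
    using fun_cong[OF h(2), of x] fun_cong[OF h'(2), of x] by (simp add: algebra_simps)
  moreover have "polynomial (\<lambda>x. h' x * h x - 1)"
    using h(1) h'(1) by (intro polynomial_diff polynomial_mult polynomial_const)
  ultimately have "\<forall>x. h' x * h x - 1 = 0"
    using polynomial_mult_zero[OF gp, of "\<lambda>x. h' x * h x - 1"] g(2) by blast
  then have one: "h' x * h x = 1" for x by simp
  have "h' x = h' 0" for x
  proof -
    obtain p where p: "\<And>t. poly p t = h (0 + t *s x)" using polynomial_on_line[OF h(1)] by blast
    obtain p' where p': "\<And>t. poly p' t = h' (0 + t *s x)" using polynomial_on_line[OF h'(1)] by blast
    have "poly (p' * p) t = poly 1 t" for t using one by (simp add: p p')
    then have "p' * p = 1" using poly_eq_poly_eq_iff by blast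
    then have "degree p' = 0"
      by (metis add_is_0 degree_1 degree_mult_eq mult_eq_0_iff zero_neq_one)
    then obtain c where "p' = [:c:]" using degree_eq_zeroE by blast
    then show ?thesis using p'[of 1] p'[of 0] by simp
  qed
  then have "g' = (\<lambda>x. h' 0 * g x)" using h'(2) by (auto simp: mult.commute)
  moreover have "h' 0 \<noteq> 0" using one[of 0] by auto
  ultimately show thesis using that by blast
qed

lemma vanishing_order_scale: "c \<noteq> 0 \<Longrightarrow> polynomial g \<Longrightarrow> vanishing_order (\<lambda>x. c * g x) a = vanishing_order g a"
proof -
  assume c: "c \<noteq> 0" and g: "polynomial g"
  have "(deriv ^^ k) (\<lambda>t. c * g (a + t *s v)) 0 = c * (deriv ^^ k) (\<lambda>t. g (a + t *s v)) 0" for k v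
  proof -
    have "(\<lambda>t. g (a + t *s v)) holomorphic_on UNIV"
      by (rule holomorphic_on_polynomial[OF g]) (auto intro!: holomorphic_intros)
    then show ?thesis by (intro higher_deriv_cmult[where A = UNIV]) auto
  qed
  then show ?thesis using c by (simp add: vanishing_order_def)
qed

lemma hypersurface_degree_eq:
  assumes "hypersurface_equation Y g" "homogeneous e g"
  shows "hypersurface_degree Y = e"
  unfolding hypersurface_degree_def
proof (rule the_equality)
  show "\<exists>g. hypersurface_equation Y g \<and> homogeneous e g" using assms by blast
  fix e' assume "\<exists>g. hypersurface_equation Y g \<and> homogeneous e' g"
  then obtain g' where g': "hypersurface_equation Y g'" "homogeneous e' g'" by blast
  obtain c where c: "c \<noteq> 0" "g' = (\<lambda>x. c * g x)" using hypersurface_equation_unique[OF assms(1) g'(1)] by metis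
  obtain u where u: "g u \<noteq> 0" using assms(1) unfolding hypersurface_equation_def by blast
  have "c * (2 ^ e * g u) = 2 ^ e' * (c * g u)"
    using homogeneousD[OF assms(2), of 2 u] homogeneousD[OF g'(2), of 2 u] c(2) by simp
  then have "(2::complex) ^ e = 2 ^ e'" using c(1) u by simp
  then have "norm ((2::complex) ^ e) = norm ((2::complex) ^ e')" by simp
  then show "e' = e" by (simp add: norm_power)
qed

lemma hypersurface_mult_eq:
  assumes "hypersurface_equation Y g"
  shows "hypersurface_mult a Y = vanishing_order g a"
  unfolding hypersurface_mult_def
proof (rule the_equality)
  show "\<exists>g'. hypersurface_equation Y g' \<and> vanishing_order g a = vanishing_order g' a" using assms by blast
  fix k assume "\<exists>g'. hypersurface_equation Y g' \<and> k = vanishing_order g' a"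
  then obtain g' where g': "hypersurface_equation Y g'" "k = vanishing_order g' a" by blast
  obtain c where "c \<noteq> 0" "g' = (\<lambda>x. c * g x)" using hypersurface_equation_unique[OF assms g'(1)] by metis
  moreover have "polynomial g"
    using assms homogeneous_imp_polynomial unfolding hypersurface_equation_def by blast
  ultimately show "k = vanishing_order g a" using g'(2) vanishing_order_scale by metis
qed

text \<open>Without an equation both numbers are the same unspecified value.\<close>
lemma hypersurface_equation_if_mult:
  assumes "int (hypersurface_mult \<alpha> Y) = int (hypersurface_degree Y) - 1"
  shows "\<exists>g. hypersurface_equation Y g"
proof (rule ccontr)
  assume "\<not> ?thesis"
  then have "hypersurface_mult \<alpha> Y = hypersurface_degree Y"
    by (simp add: hypersurface_mult_def hypersurface_degree_def)
  with assms show False by simp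
qed

lemma higher_deriv_poly: "(deriv ^^ k) (poly p) 0 = fact k * coeff p k" for p :: "complex poly"
proof -
  have "deriv (poly p) = poly (pderiv p)" for p :: "complex poly"
    by (auto intro!: DERIV_imp_deriv poly_DERIV)
  then have "(deriv ^^ k) (poly p) = poly ((pderiv ^^ k) p)" for k
    by (induction k) auto
  then show ?thesis
    by (simp add: poly_0_coeff_0 coeff_higher_pderiv pochhammer_fact)
qed

lemma vanishing_order_eq_Least:
  assumes "\<And>v t. poly (p v) t = g (a + t *s v)"
  shows "vanishing_order g a = (LEAST k. \<exists>v. coeff (p v) k \<noteq> 0)"
proof -
  have "(\<lambda>t. g (a + t *s v)) = poly (p v)" for v using assms by auto
  then show ?thesis by (simp add: vanishing_order_def higher_deriv_poly)
qed

lemma homogeneous_on_line: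
  assumes "homogeneous e f"
  obtains p where "degree p \<le> e" "\<And>t. poly p t = f (a + t *s b)"
proof -
  obtain M c where M: "finite M" "\<forall>m\<in>M. sum m UNIV = e" "f = (\<lambda>x. \<Sum>m\<in>M. c m * monomial_fun m x)"
    using assms unfolding homogeneous_def by blast
  define p where "p = (\<Sum>m\<in>M. smult (c m) (\<Prod>i\<in>UNIV. [:a $ i, b $ i:] ^ m i))"
  have "degree (smult (c m) (\<Prod>i\<in>UNIV. [:a $ i, b $ i:] ^ m i)) \<le> e" if "m \<in> M" for m
  proof -
    have "degree ([:a $ i, b $ i:] ^ m i) \<le> m i" for i
      using degree_power_le[of "[:a $ i, b $ i:]" "m i"] by (auto split: if_splits)
    then have "(\<Sum>i\<in>UNIV. degree ([:a $ i, b $ i:] ^ m i)) \<le> e"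
      using sum_mono[of UNIV "\<lambda>i. degree ([:a $ i, b $ i:] ^ m i)" m] M(2) that by simp
    then have "degree (\<Prod>i\<in>UNIV. [:a $ i, b $ i:] ^ m i) \<le> e"
      using degree_prod_sum_le[of UNIV "\<lambda>i. [:a $ i, b $ i:] ^ m i"] by simp
    then show ?thesis using degree_smult_le order_trans by blast
  qed
  then have "degree p \<le> e" unfolding p_def by (intro degree_sum_le M(1))
  moreover have "poly p t = f (a + t *s b)" for t
    by (simp add: p_def poly_sum poly_prod M(3) monomial_fun_def)
  ultimately show thesis using that by blast
qed

text \<open>
  By homogeneity, \<open>g (v + t \<alpha>) = t\<^sup>e g (\<alpha> + v / t)\<close>: the term of order \<open>k\<close> at \<open>\<alpha>\<close> becomes the term of
  degree \<open>e - k\<close> in \<open>t\<close>, so that order \<open>e - 1\<close> at \<open>\<alpha>\<close> leaves a term linear in \<open>t\<close> and a constant one.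
\<close>
lemma order_pred_degree_imp_linear:
  fixes g :: "complex ^ 'n \<Rightarrow> complex"
  assumes g: "homogeneous e g" "e > 0" "g u0 \<noteq> 0" and ord: "vanishing_order g \<alpha> = e - 1"
  shows "g (u + t *s \<alpha>) = g u + t * pairing \<alpha> (gradient g u)" "\<exists>u. pairing \<alpha> (gradient g u) \<noteq> 0"
proof -
  have "\<forall>v. \<exists>p. degree p \<le> e \<and> (\<forall>t. poly p t = g (\<alpha> + t *s v))"
    using homogeneous_on_line[OF g(1)] by metis
  then obtain p where p: "\<And>v. degree (p v) \<le> e" "\<And>v t. poly (p v) t = g (\<alpha> + t *s v)" by metis
  have Least: "e - 1 = (LEAST k. \<exists>v. coeff (p v) k \<noteq> 0)"
    using ord vanishing_order_eq_Least[of p g \<alpha>] p(2) by simp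
  have low: "coeff (p v) k = 0" if "k < e - 1" for k v
    using not_less_Least[of k "\<lambda>k. \<exists>v. coeff (p v) k \<noteq> 0"] that Least by auto
  have "\<exists>k v. coeff (p v) k \<noteq> 0"
  proof (rule ccontr)
    assume "\<not> ?thesis"
    then have "p (u0 - \<alpha>) = 0" by (simp add: poly_eq_iff)
    then show False using p(2)[of "u0 - \<alpha>" 1] g(3) by simp
  qed
  then have ex: "\<exists>v. coeff (p v) (e - 1) \<noteq> 0"
    using LeastI_ex[of "\<lambda>k. \<exists>v. coeff (p v) k \<noteq> 0"] Least by simp
  have pv: "g (\<alpha> + s *s v) = coeff (p v) (e - 1) * s ^ (e - 1) + coeff (p v) e * s ^ e" for v s
  proof -
    have "g (\<alpha> + s *s v) = (\<Sum>j\<le>e. coeff (p v) j * s ^ j)"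
      using p(2)[of v s] poly_eq_sum_atMost[OF p(1)] by simp
    also have "\<dots> = (\<Sum>j\<in>{e - 1, e}. coeff (p v) j * s ^ j)"
      using low by (intro sum.mono_neutral_right) auto
    finally show ?thesis using g(2) by simp
  qed
  have lin: "g (v + t *s \<alpha>) = coeff (p v) e + t * coeff (p v) (e - 1)" for v t
  proof -
    obtain P where P: "\<And>t. poly P t = g (v + t *s \<alpha>)"
      using polynomial_on_line[OF homogeneous_imp_polynomial[OF g(1)]] by blast
    have "poly P t = poly [:coeff (p v) e, coeff (p v) (e - 1):] t" if "t \<noteq> 0" for t
    proof -
      have eq: "v + t *s \<alpha> = t *s (\<alpha> + (1 / t) *s v)" using that by (simp add: vector_add_ldistrib)
      have "g (v + t *s \<alpha>) = t ^ e * g (\<alpha> + (1 / t) *s v)"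
        unfolding eq by (rule homogeneousD[OF g(1)])
      also have "\<dots> = coeff (p v) (e - 1) * (t ^ e * (1 / t) ^ (e - 1)) + coeff (p v) e * (t ^ e * (1 / t) ^ e)"
        by (simp only: pv distrib_left mult_ac)
      also have "t ^ e * (1 / t) ^ e = 1" using that by (simp add: power_divide)
      also have "t ^ e * (1 / t) ^ (e - 1) = t"
      proof -
        have "t ^ e = t * t ^ (e - 1)" using g(2) by (metis power_minus_mult mult.commute)
        then show ?thesis using that by (simp add: power_divide)
      qed
      finally show ?thesis by (simp add: P mult.commute)
    qed
    then have "P - [:coeff (p v) e, coeff (p v) (e - 1):] = 0"
      by (intro poly_zero_if_zero_off_0) simp
    then show ?thesis using P[of t] by simp
  qed
  have grad: "pairing \<alpha> (gradient g v) = coeff (p v) (e - 1)" for v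
  proof -
    have "((\<lambda>t. g (v + t *s \<alpha>)) has_field_derivative pairing (gradient g (v + 0 *s \<alpha>)) \<alpha>) (at 0)"
      by (rule gradient_line[OF homogeneous_imp_polynomial[OF g(1)]])
    moreover have "((\<lambda>t. g (v + t *s \<alpha>)) has_field_derivative coeff (p v) (e - 1)) (at 0)"
      unfolding lin by (auto intro!: derivative_eq_intros)
    ultimately show ?thesis using DERIV_unique pairing_commute by (metis add.right_neutral vec.scale_zero_left)
  qed
  show "g (u + t *s \<alpha>) = g u + t * pairing \<alpha> (gradient g u)"
    using lin[of u t] lin[of u 0] grad by simp
  show "\<exists>u. pairing \<alpha> (gradient g u) \<noteq> 0" using ex grad by simp
qed

section \<open>Contact points from the equation of the dual curve\<close>

text \<open>
  Biduality for plane curves: the gradient of an equation of the dual curve at a tangent line is the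
  point of contact. Along an arc of tangents \<open>U\<close> of \<open>X\<close>, the vector \<open>\<xi> = \<nabla>g(U)\<close> pairs to zero with \<open>U\<close>,
  with \<open>U'\<close> and with all functionals that vanish on \<open>X\<close>; away from inflection points these
  conditions determine \<open>\<xi>\<close> up to a factor, and the inflection points are isolated on the arc.
\<close>
lemma gradient_dual_equation:
  fixes X :: "(complex ^ 'n) set set"
  assumes X: "irreducible_curve X" and dim3: "vec.dim (vec.span (affine_cone X)) = 3"
    and g: "homogeneous e g" "e > 0" "\<And>u. u \<in> tangent_covectors X \<Longrightarrow> g u = 0"
    and x: "x \<in> cone_reg X" "pairing \<alpha> x \<noteq> 0"
    and u: "\<And>v. v \<in> tangent_space X x \<Longrightarrow> pairing u v = 0" "y \<in> vec.span (affine_cone X)" "pairing u y \<noteq> 0"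
  shows "pairing \<alpha> x *s gradient g u = pairing \<alpha> (gradient g u) *s x"
proof -
  let ?C = "affine_cone X" and ?a = "pairing \<alpha> x"
  have gp: "polynomial g" using g(1) homogeneous_imp_polynomial by blast
  have xC: "x \<in> ?C" using x(1) cone_reg_iff[OF X] by blast
  obtain v \<gamma> r where arc: "regular_arc X \<alpha> v \<gamma> r" "\<gamma> 0 = x"
    using regular_arc_exists[OF X x] by blast
  have r0: "0 \<in> ball 0 r" using regular_arcD(1)[OF arc(1)] by simp
  have xW: "x \<in> vec.span ?C" using xC vec.span_base by blast
  obtain \<beta>1 where \<beta>1: "\<And>c. \<exists>x\<in>vec.span ?C. pairing \<beta>1 x \<noteq> c * pairing \<alpha> x"
    using second_coordinate[OF vec.subspace_span dim3 xW x(2)] by blast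
  obtain \<beta>2 w0 w1 w2 where w: "w0 \<in> vec.span ?C" "w1 \<in> vec.span ?C" "w2 \<in> vec.span ?C"
    "pairing \<alpha> w0 = 1" "pairing \<alpha> w1 = 0" "pairing \<alpha> w2 = 0"
    "pairing \<beta>1 w0 = 0" "pairing \<beta>1 w1 = 1" "pairing \<beta>1 w2 = 0"
    "pairing \<beta>2 w0 = 0" "pairing \<beta>2 w1 = 0" "pairing \<beta>2 w2 = 1"
    and coords: "\<And>x. x \<in> vec.span ?C \<Longrightarrow> x = pairing \<beta>1 x *s w1 + pairing \<beta>2 x *s w2 + pairing \<alpha> x *s w0"
    using plane_coordinates[OF vec.subspace_span dim3 xW x(2) \<beta>1] by metis
  have \<alpha>v: "pairing \<alpha> (v z) = 0" for z by (rule regular_arcD(3)[OF arc(1)])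
  have \<alpha>\<gamma>: "pairing \<alpha> (\<gamma> s) = ?a" if "s \<in> ball 0 r" for s
    using regular_arc_l(1)[OF arc(1) that] arc(2) by simp
  have v_span: "v z \<in> vec.span ?C" if "z \<in> ?C" for z
    using regular_arcD(5)[OF arc(1) that] tangent_space_subset_span[OF X] by blast
  have v_coords: "v z = pairing \<beta>1 (v z) *s w1 + pairing \<beta>2 (v z) *s w2" if "z \<in> ?C" for z
    using coords[OF v_span[OF that]] \<alpha>v[of z] by simp
  \<comment> \<open>\<open>tl z\<close> is the tangent line at \<open>z\<close>, as the cross product of \<open>z\<close> and \<open>v z\<close> in the plane\<close>
  define h where "h z = (pairing \<beta>1 (v z) * pairing \<beta>2 z - pairing \<beta>2 (v z) * pairing \<beta>1 z) / ?a" for z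
  define tl where "tl z = pairing \<beta>2 (v z) *s \<beta>1 - pairing \<beta>1 (v z) *s \<beta>2 + h z *s \<alpha>" for z
  obtain c where c: "c \<noteq> 0" "\<And>w. w \<in> vec.span ?C \<Longrightarrow> pairing u w = c * pairing (tl x) w"
  proof -
    have vx: "v x \<noteq> 0" using regular_arcD(9)[OF arc(1) r0] arc(2) by simp
    have uv: "pairing u w1 * pairing \<beta>1 (v x) + pairing u w2 * pairing \<beta>2 (v x) = 0"
    proof -
      have "pairing u (v x) = pairing u (pairing \<beta>1 (v x) *s w1 + pairing \<beta>2 (v x) *s w2)"
        using v_coords[OF xC] by simp
      then show ?thesis
        using u(1)[OF regular_arcD(5)[OF arc(1) xC]] by (simp add: algebra_simps)
    qed
    have ux: "pairing u w1 * pairing \<beta>1 x + pairing u w2 * pairing \<beta>2 x + pairing u w0 * ?a = 0"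
    proof -
      have "pairing u x = pairing u (pairing \<beta>1 x *s w1 + pairing \<beta>2 x *s w2 + ?a *s w0)"
        using coords[OF xW] by simp
      then show ?thesis
        using u(1)[OF radial_tangent[OF irreducible_curveD(3)[OF X] xC]] by (simp add: algebra_simps)
    qed
    define c where "c = (if pairing \<beta>2 (v x) \<noteq> 0 then pairing u w1 / pairing \<beta>2 (v x) else - pairing u w2 / pairing \<beta>1 (v x))"
    have "pairing \<beta>2 (v x) \<noteq> 0 \<or> pairing \<beta>1 (v x) \<noteq> 0" using v_coords[OF xC] vx by auto
    then have c1: "pairing u w1 = c * pairing \<beta>2 (v x)" and c2: "pairing u w2 = - c * pairing \<beta>1 (v x)"
      using uv by (auto simp: c_def field_simps eq_neg_iff_add_eq_0)
    have hx: "h x * ?a = pairing \<beta>1 (v x) * pairing \<beta>2 x - pairing \<beta>2 (v x) * pairing \<beta>1 x"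
      using x(2) by (simp add: h_def)
    have "pairing u w0 * ?a = c * (h x * ?a)"
      unfolding hx using ux by (simp add: c1 c2 algebra_simps eq_neg_iff_add_eq_0)
    then have c0: "pairing u w0 = c * h x" using x(2) by simp
    have eq: "pairing u z = c * pairing (tl x) z" if "z \<in> vec.span ?C" for z
    proof -
      have "pairing u z = pairing u (pairing \<beta>1 z *s w1 + pairing \<beta>2 z *s w2 + pairing \<alpha> z *s w0)"
        using coords[OF that] by simp
      then show ?thesis by (simp add: c0 c1 c2 tl_def algebra_simps)
    qed
    moreover have "c \<noteq> 0" using eq[of y] u(2,3) by auto
    ultimately show thesis using that by blast
  qed
  \<comment> \<open>\<open>u\<close> itself agrees with a multiple of \<open>tl x\<close> only on the plane of \<open>X\<close>\<close>
  define \<kappa> where "\<kappa> = u - c *s tl x"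
  have \<kappa>: "pairing \<kappa> z = 0" if "z \<in> vec.span ?C" for z using c(2)[OF that] by (simp add: \<kappa>_def)
  define U where "U s = c *s tl (\<gamma> s) + \<kappa>" for s
  have U_tangent: "U s \<in> tangent_covectors X" if s: "s \<in> ball 0 r" for s
  proof -
    have "pairing (tl (\<gamma> s)) (v (\<gamma> s)) = 0" by (simp add: tl_def \<alpha>v algebra_simps)
    moreover have "pairing (tl (\<gamma> s)) (\<gamma> s) = 0"
    proof -
      have h: "h (\<gamma> s) * ?a = pairing \<beta>1 (v (\<gamma> s)) * pairing \<beta>2 (\<gamma> s) - pairing \<beta>2 (v (\<gamma> s)) * pairing \<beta>1 (\<gamma> s)"
        using x(2) by (simp add: h_def)
      have "pairing (tl (\<gamma> s)) (\<gamma> s) = pairing \<beta>2 (v (\<gamma> s)) * pairing \<beta>1 (\<gamma> s)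
          - pairing \<beta>1 (v (\<gamma> s)) * pairing \<beta>2 (\<gamma> s) + h (\<gamma> s) * ?a"
        by (simp add: tl_def \<alpha>\<gamma>[OF s])
      then show ?thesis unfolding h by simp
    qed
    ultimately have "\<forall>z\<in>tangent_space X (\<gamma> s). pairing (tl (\<gamma> s)) z = 0"
      using regular_arc_l(5)[OF arc(1) s] by (auto simp: span_pair_iff)
    then have "tl (\<gamma> s) \<in> tangent_covectors X"
      using regular_arc_l(3,4)[OF arc(1) s] by (auto simp: tangent_covectors_def)
    then show ?thesis
      unfolding U_def by (intro tangent_covectors_annihilator[OF tangent_covectors_scale X] \<kappa>) (auto intro: vec.span_base)
  qed
  define \<xi> where "\<xi> s = gradient g (U s)" for s
  have \<xi>_N: "pairing k (\<xi> s) = 0" if s: "s \<in> ball 0 r" and k: "\<And>z. z \<in> ?C \<Longrightarrow> pairing k z = 0" for k s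
  proof -
    have "U s + t *s k \<in> tangent_covectors X" for t
      by (rule tangent_covectors_annihilator[OF U_tangent[OF s] X]) (simp add: k)
    then have "(\<lambda>t. g (U s + t *s k)) = (\<lambda>_. 0)" using g(3) by auto
    then have "pairing (gradient g (U s + 0 *s k)) k = 0"
      using gradient_line[OF gp, of "U s" k 0] DERIV_unique DERIV_const by metis
    then show ?thesis by (simp add: \<xi>_def pairing_commute[of k])
  qed
  have \<xi>_span: "\<xi> s \<in> vec.span ?C" if s: "s \<in> ball 0 r" for s
  proof (rule ccontr)
    assume "\<xi> s \<notin> vec.span ?C"
    then obtain k where "\<And>z. z \<in> vec.span ?C \<Longrightarrow> pairing k z = 0" "pairing k (\<xi> s) = 1"
      using separating_functional[OF vec.subspace_span] by metis
    then show False using \<xi>_N[OF s, of k] vec.span_base by fastforce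
  qed
  have \<kappa>\<xi>: "pairing \<kappa> (\<xi> s) = 0" if "s \<in> ball 0 r" for s by (rule \<kappa>[OF \<xi>_span[OF that]])
  have polv: "polynomial (\<lambda>z. pairing b (v z))" for b
    using regular_arcD(2)[OF arc(1)] by (intro polynomial_pairing_maps) auto
  define b1 b2 x1 x2 where "b1 s = pairing \<beta>1 (v (\<gamma> s))" and "b2 s = pairing \<beta>2 (v (\<gamma> s))"
    and "x1 s = pairing \<beta>1 (\<gamma> s)" and "x2 s = pairing \<beta>2 (\<gamma> s)" for s
  define b1' b2' where "b1' s = pairing (gradient (\<lambda>z. pairing \<beta>1 (v z)) (\<gamma> s)) (v (\<gamma> s))"
    and "b2' s = pairing (gradient (\<lambda>z. pairing \<beta>2 (v z)) (\<gamma> s)) (v (\<gamma> s))" for s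
  have derivs: "(b1 has_field_derivative b1' s) (at s)" "(b2 has_field_derivative b2' s) (at s)"
    "(x1 has_field_derivative b1 s) (at s)" "(x2 has_field_derivative b2 s) (at s)" if s: "s \<in> ball 0 r" for s
    unfolding b1_def[abs_def] b2_def[abs_def] x1_def[abs_def] x2_def[abs_def] b1'_def b2'_def
    using regular_arc_derivative[OF arc(1) polv s] regular_arc_derivative_pairing[OF arc(1) s] by simp_all
  have hol: "b1 holomorphic_on ball 0 r" "b2 holomorphic_on ball 0 r" "x1 holomorphic_on ball 0 r" "x2 holomorphic_on ball 0 r"
    unfolding holomorphic_on_open[OF open_ball] using derivs by blast+
  have hol': "b1' holomorphic_on ball 0 r" "b2' holomorphic_on ball 0 r"
  proof -
    have "polynomial (\<lambda>z. pairing (gradient (\<lambda>z. pairing b (v z)) z) (v z))" for b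
      using polynomial_gradient[OF polv] regular_arcD(2)[OF arc(1)] by (intro polynomial_pairing_maps) auto
    then show "b1' holomorphic_on ball 0 r" "b2' holomorphic_on ball 0 r"
      unfolding b1'_def[abs_def] b2'_def[abs_def] by (auto intro: regular_arc_holomorphic[OF arc(1)])
  qed
  have U_eq: "U s = c *s (b2 s *s \<beta>1 - b1 s *s \<beta>2 + ((b1 s * x2 s - b2 s * x1 s) / ?a) *s \<alpha>) + \<kappa>" for s
    by (simp add: U_def tl_def h_def b1_def b2_def x1_def x2_def)
  define U' where "U' s = c *s (b2' s *s \<beta>1 - b1' s *s \<beta>2 + ((b1' s * x2 s - b2' s * x1 s) / ?a) *s \<alpha>)" for s
  have U_deriv: "((\<lambda>s. U s $ i) has_field_derivative U' s $ i) (at s)" if s: "s \<in> ball 0 r" for s i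
    unfolding U_eq U'_def using x(2)
    by (auto intro!: derivative_eq_intros derivs[OF s] simp: field_simps)
  have U_hol: "(\<lambda>s. U s $ i) holomorphic_on ball 0 r" for i
    unfolding holomorphic_on_open[OF open_ball] using U_deriv by blast
  define y1 y2 y0 where "y1 s = pairing \<beta>1 (\<xi> s)" and "y2 s = pairing \<beta>2 (\<xi> s)" and "y0 s = pairing \<alpha> (\<xi> s)" for s
  have y_hol: "y1 holomorphic_on ball 0 r" "y2 holomorphic_on ball 0 r" "y0 holomorphic_on ball 0 r"
  proof -
    have "polynomial (\<lambda>z. pairing b (gradient g z))" for b
      using polynomial_gradient[OF gp] by (intro polynomial_pairing_maps) auto
    then have "(\<lambda>s. pairing b (\<xi> s)) holomorphic_on ball 0 r" for b
      unfolding \<xi>_def by (rule holomorphic_on_polynomial[OF _ U_hol])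
    then show "y1 holomorphic_on ball 0 r" "y2 holomorphic_on ball 0 r" "y0 holomorphic_on ball 0 r"
      unfolding y1_def[abs_def] y2_def[abs_def] y0_def[abs_def] by blast+
  qed
  have eq1: "b2 s * y1 s - b1 s * y2 s + (b1 s * x2 s - b2 s * x1 s) / ?a * y0 s = 0" if s: "s \<in> ball 0 r" for s
  proof -
    have "pairing (U s) (\<xi> s) = 0"
      using gradient_Euler[OF g(1), of "U s"] g(3)[OF U_tangent[OF s]] by (simp add: \<xi>_def pairing_commute)
    then have "c * (b2 s * y1 s - b1 s * y2 s + (b1 s * x2 s - b2 s * x1 s) / ?a * y0 s) = 0"
      unfolding U_eq pairing_linear y1_def y2_def y0_def \<kappa>\<xi>[OF s] by simp
    then show ?thesis using c(1) by simp
  qed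
  have eq2: "b2' s * y1 s - b1' s * y2 s + (b1' s * x2 s - b2' s * x1 s) / ?a * y0 s = 0" if s: "s \<in> ball 0 r" for s
  proof -
    have "((\<lambda>s. g (U s)) has_field_derivative pairing (gradient g (U s)) (U' s)) (at s)"
      by (rule gradient_chain[OF gp U_deriv[OF s]])
    moreover have "((\<lambda>s. g (U s)) has_field_derivative 0) (at s)"
      by (rule has_field_derivative_transform_within_open[OF DERIV_const[of 0] open_ball s])
        (simp add: g(3)[OF U_tangent])
    ultimately have "pairing (\<xi> s) (U' s) = 0" using DERIV_unique unfolding \<xi>_def by blast
    then have "pairing (U' s) (\<xi> s) = 0" by (simp add: pairing_commute)
    then have "c * (b2' s * y1 s - b1' s * y2 s + (b1' s * x2 s - b2' s * x1 s) / ?a * y0 s) = 0"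
      unfolding U'_def pairing_linear y1_def y2_def y0_def .
    then show ?thesis using c(1) by simp
  qed
  \<comment> \<open>\<open>\<omega>\<close> vanishes at inflection points; if it vanished identically, \<open>X\<close> would be a line\<close>
  define \<omega> where "\<omega> s = b1 s * b2' s - b1' s * b2 s" for s
  have \<omega>_hol: "\<omega> holomorphic_on ball 0 r"
    unfolding \<omega>_def[abs_def] by (intro holomorphic_intros hol hol')
  have \<omega>: "\<not> (\<forall>s\<in>ball 0 r. \<omega> s = 0)"
  proof
    assume \<omega>0: "\<forall>s\<in>ball 0 r. \<omega> s = 0"
    have nz: "b1 0 \<noteq> 0 \<or> b2 0 \<noteq> 0"
      using v_coords[OF xC] regular_arcD(9)[OF arc(1) r0] arc(2) by (auto simp: b1_def b2_def)
    have "\<exists>p q. (p \<noteq> 0 \<or> q \<noteq> 0) \<and> (\<forall>s\<in>ball 0 r. p * b1 s + q * b2 s = 0)"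
    proof (cases "b1 0 = 0")
      case False
      have "b2 s = (b2 0 / b1 0) * b1 s" if "s \<in> ball 0 r" for s
        using wronskian_zero[OF open_ball connected_ball derivs(1,2) _ r0 False that] \<omega>0 by (simp add: \<omega>_def)
      then show ?thesis by (intro exI[of _ "- (b2 0 / b1 0)"] exI[of _ 1]) auto
    next
      case True
      then have nz2: "b2 0 \<noteq> 0" using nz by simp
      have "b1 s = (b1 0 / b2 0) * b2 s" if "s \<in> ball 0 r" for s
        using wronskian_zero[OF open_ball connected_ball derivs(2,1) _ r0 nz2 that] \<omega>0 by (simp add: \<omega>_def algebra_simps)
      then show ?thesis by (intro exI[of _ 1] exI[of _ "- (b1 0 / b2 0)"]) auto
    qed
    then obtain p q where pq: "p \<noteq> 0 \<or> q \<noteq> 0" "\<And>s. s \<in> ball 0 r \<Longrightarrow> p * b1 s + q * b2 s = 0" by blast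
    define \<delta> where "\<delta> = p *s \<beta>1 + q *s \<beta>2"
    have const: "pairing \<delta> (\<gamma> s) = pairing \<delta> x" if "s \<in> ball 0 r" for s
      using regular_arc_constant[OF arc(1) _ that, of \<delta>] pq(2) arc(2) by (simp add: \<delta>_def b1_def b2_def)
    define \<delta>' where "\<delta>' = \<delta> - (pairing \<delta> x / ?a) *s \<alpha>"
    have "pairing \<delta>' z = 0" if "z \<in> ?C" for z
    proof (rule regular_arc_dense[OF X arc(1) homogeneous_pairing _ that])
      fix s :: complex assume "s \<in> ball 0 r"
      then show "pairing \<delta>' (\<gamma> s) = 0" using const \<alpha>\<gamma> x(2) by (simp add: \<delta>'_def)
    qed
    then have "pairing \<delta>' z = 0" if "z \<in> vec.span ?C" for z
      using linear_form_vanishing_on_span that by blast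
    from this[OF w(2)] this[OF w(3)] show False using pq(1) w by (simp add: \<delta>'_def \<delta>_def)
  qed
  have "(y1 s - x1 s * y0 s / ?a) * \<omega> s = 0 \<and> (y2 s - x2 s * y0 s / ?a) * \<omega> s = 0" if s: "s \<in> ball 0 r" for s
  proof -
    define A where "A = y1 s - x1 s * y0 s / ?a"
    define B where "B = y2 s - x2 s * y0 s / ?a"
    have 1: "b2 s * A = b1 s * B"
      using eq1[OF s] x(2) by (simp add: A_def B_def field_simps)
    have 2: "b2' s * A = b1' s * B"
      using eq2[OF s] x(2) by (simp add: A_def B_def field_simps)
    have "A * \<omega> s = b1 s * (b2' s * A) - b1' s * (b2 s * A)" by (simp add: \<omega>_def algebra_simps)
    also have "\<dots> = 0" unfolding 1 2 by simp
    finally have "A * \<omega> s = 0" .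
    moreover have "B * \<omega> s = b2' s * (b1 s * B) - b2 s * (b1' s * B)" by (simp add: \<omega>_def algebra_simps)
    moreover have "\<dots> = 0" unfolding 1[symmetric] 2[symmetric] by simp
    ultimately show ?thesis by (simp add: A_def B_def)
  qed
  then have prods: "\<And>s. s \<in> ball 0 r \<Longrightarrow> (y1 s - x1 s * y0 s / ?a) * \<omega> s = 0"
    "\<And>s. s \<in> ball 0 r \<Longrightarrow> (y2 s - x2 s * y0 s / ?a) * \<omega> s = 0" by blast+
  have h1: "(\<lambda>s. y1 s - x1 s * y0 s / ?a) holomorphic_on ball 0 r" "(\<lambda>s. y2 s - x2 s * y0 s / ?a) holomorphic_on ball 0 r"
    by (intro holomorphic_intros y_hol hol x(2))+
  have y1: "y1 0 = x1 0 * y0 0 / ?a"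
    using holomorphic_mult_zero[OF open_ball connected_ball h1(1) \<omega>_hol prods(1)] \<omega> r0 by fastforce
  have y2: "y2 0 = x2 0 * y0 0 / ?a"
    using holomorphic_mult_zero[OF open_ball connected_ball h1(2) \<omega>_hol prods(2)] \<omega> r0 by fastforce
  have U0: "U 0 = u" by (simp add: U_def \<kappa>_def arc(2))
  have "?a *s \<xi> 0 = ?a *s (y1 0 *s w1 + y2 0 *s w2 + y0 0 *s w0)"
    using coords[OF \<xi>_span[OF r0]] by (simp add: y1_def y2_def y0_def)
  also have "\<dots> = y0 0 *s (x1 0 *s w1 + x2 0 *s w2 + ?a *s w0)"
    using x(2) by (simp add: y1 y2 vec_eq_iff field_simps)
  also have "x1 0 *s w1 + x2 0 *s w2 + ?a *s w0 = x"
    using coords[OF xW] by (simp add: x1_def x2_def arc(2))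
  finally show ?thesis by (simp add: \<xi>_def U0 y0_def)
qed

section \<open>Rational functions with prescribed poles\<close>

text \<open>
  Rational functions whose denominator is a power of \<open>q\<close>. They form a ring, so that a rational
  identity in \<open>u\<close> becomes a polynomial identity after multiplication by \<open>q\<^sup>N\<close>.
\<close>
definition rational_off :: "(complex ^ 'n \<Rightarrow> complex) \<Rightarrow> (complex ^ 'n \<Rightarrow> complex) \<Rightarrow> bool" where
  "rational_off q \<phi> \<longleftrightarrow> (\<exists>N H. polynomial H \<and> (\<forall>u. q u \<noteq> 0 \<longrightarrow> \<phi> u * q u ^ N = H u))"

lemma rational_off_polynomial: "polynomial f \<Longrightarrow> rational_off q f"
  unfolding rational_off_def by (intro exI[of _ 0] exI[of _ f]) simp

lemma rational_off_inverse:
  assumes "polynomial h" "\<And>u. q u = f u * h u"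
  shows "rational_off q (\<lambda>u. inverse (f u))"
  unfolding rational_off_def
  by (intro exI[of _ 1] exI[of _ h]) (use assms in auto)

lemma rational_off_add:
  assumes q: "polynomial q" and "rational_off q \<phi>" "rational_off q \<psi>"
  shows "rational_off q (\<lambda>u. \<phi> u + \<psi> u)"
proof -
  obtain N H M K where H: "polynomial H" "\<And>u. q u \<noteq> 0 \<Longrightarrow> \<phi> u * q u ^ N = H u"
    and K: "polynomial K" "\<And>u. q u \<noteq> 0 \<Longrightarrow> \<psi> u * q u ^ M = K u"
    using assms(2,3) unfolding rational_off_def by blast
  have "(\<phi> u + \<psi> u) * q u ^ (N + M) = H u * q u ^ M + K u * q u ^ N" if "q u \<noteq> 0" for u
  proof -
    have "(\<phi> u + \<psi> u) * q u ^ (N + M) = (\<phi> u * q u ^ N) * q u ^ M + (\<psi> u * q u ^ M) * q u ^ N"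
      by (simp add: power_add algebra_simps)
    then show ?thesis unfolding H(2)[OF that] K(2)[OF that] .
  qed
  moreover have "polynomial (\<lambda>u. H u * q u ^ M + K u * q u ^ N)"
    using H(1) K(1) q by (intro polynomial_add polynomial_mult polynomial_power)
  ultimately show ?thesis unfolding rational_off_def by blast
qed

lemma rational_off_mult:
  assumes "rational_off q \<phi>" "rational_off q \<psi>"
  shows "rational_off q (\<lambda>u. \<phi> u * \<psi> u)"
proof -
  obtain N H M K where H: "polynomial H" "\<And>u. q u \<noteq> 0 \<Longrightarrow> \<phi> u * q u ^ N = H u"
    and K: "polynomial K" "\<And>u. q u \<noteq> 0 \<Longrightarrow> \<psi> u * q u ^ M = K u"
    using assms unfolding rational_off_def by blast
  have "(\<phi> u * \<psi> u) * q u ^ (N + M) = H u * K u" if "q u \<noteq> 0" for u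
    using H(2)[OF that, symmetric] K(2)[OF that, symmetric] by (simp add: power_add)
  moreover have "polynomial (\<lambda>u. H u * K u)" using H(1) K(1) by (rule polynomial_mult)
  ultimately show ?thesis unfolding rational_off_def by blast
qed

lemma rational_off_compose:
  assumes "polynomial q" "polynomial f" and M: "\<And>i. rational_off q (\<lambda>u. M u $ i)"
  shows "rational_off q (\<lambda>u. f (M u))"
  using assms(2)
  by (induction rule: polynomial_induct)
    (auto intro: rational_off_polynomial M rational_off_add[OF assms(1)] rational_off_mult)

lemma rational_off_generically_nonzero:
  assumes q: "polynomial q" and \<phi>: "rational_off q \<phi>" and u: "q u \<noteq> 0" "\<phi> u \<noteq> 0"
  shows "generically (\<lambda>u. q u \<noteq> 0 \<and> \<phi> u \<noteq> 0)"
proof -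
  obtain N H where H: "polynomial H" "\<And>u. q u \<noteq> 0 \<Longrightarrow> \<phi> u * q u ^ N = H u"
    using \<phi> unfolding rational_off_def by blast
  have "H u \<noteq> 0" using H(2)[OF u(1)] u by auto
  then have "generically (\<lambda>u. q u * H u \<noteq> 0)"
    using generically_nonzero[of "\<lambda>u. q u * H u" u] q H(1) u(1) by auto
  then show ?thesis
    by (rule generically_mono) (use H(2) in force)
qed

section \<open>Plane curves on which \<open>F\<close> is a power of a linear form\<close>

locale power_on_plane_curve =
  fixes X :: "(complex ^ 'n) set set" and F :: "complex ^ 'n \<Rightarrow> complex"
    and \<alpha> :: "complex ^ 'n" and d :: nat
  assumes X: "irreducible_curve X"
    and dim3: "vec.dim (vec.span (affine_cone X)) = 3"
    and F: "homogeneous d F" "d > 0"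
    and F\<alpha>: "x \<in> affine_cone X \<Longrightarrow> F x = pairing \<alpha> x ^ d"
    and \<alpha>_nz: "\<exists>y\<in>affine_cone X. pairing \<alpha> y \<noteq> 0"
begin

lemma d_nz: "of_nat d \<noteq> (0::complex)" using F(2) by simp

lemma gradient_F:
  assumes "x \<in> affine_cone X" "v \<in> tangent_space X x"
  shows "pairing (gradient F x) v = of_nat d * pairing \<alpha> x ^ (d - 1) * pairing \<alpha> v"
proof -
  have Fp: "polynomial F" using F(1) homogeneous_imp_polynomial by blast
  have pw: "polynomial (\<lambda>x. pairing \<alpha> x ^ d)" by (rule polynomial_power) simp
  have "(\<lambda>x. F x - pairing \<alpha> x ^ d) \<in> vanishing_ideal X"
    using Fp pw F\<alpha> by (auto simp: vanishing_ideal_def intro!: polynomial_diff)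
  then have "pairing (gradient (\<lambda>x. F x - pairing \<alpha> x ^ d) x) v = 0" by (rule tangentD[OF assms(2)])
  then show ?thesis by (simp add: gradient_diff[OF Fp pw] gradient_power)
qed

text \<open>
  Since \<open>F\<close> and \<open>\<alpha>\<^sup>d\<close> have the same differential on tangent spaces, \<open>x\<close> is critical for \<open>u\<close> when
  \<open>u\<close> and \<open>(d / \<alpha>(x)) \<alpha>\<close> agree on the tangent space.
\<close>
lemma crit_alpha:
  assumes "(x, u) \<in> crit_incidence F X"
  shows "pairing \<alpha> x \<noteq> 0" "v \<in> tangent_space X x \<Longrightarrow> pairing u v * pairing \<alpha> x = of_nat d * pairing \<alpha> v"
proof -
  note D = critD[OF X F(1) assms]
  show nz: "pairing \<alpha> x \<noteq> 0" using D(2) F\<alpha>[OF D(3)] F(2) by (auto simp: power_0_left)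
  assume v: "v \<in> tangent_space X x"
  have "pairing \<alpha> x ^ d = pairing \<alpha> x ^ (d - 1) * pairing \<alpha> x" using F(2) by (metis power_minus_mult)
  then have "pairing \<alpha> x ^ (d - 1) * (pairing u v * pairing \<alpha> x) = F x * pairing u v"
    unfolding F\<alpha>[OF D(3)] by (simp only: mult_ac)
  also have "\<dots> = pairing \<alpha> x ^ (d - 1) * (of_nat d * pairing \<alpha> v)"
    unfolding D(4)[OF v, symmetric] gradient_F[OF D(3) v] by (simp only: mult_ac)
  finally show "pairing u v * pairing \<alpha> x = of_nat d * pairing \<alpha> v" using nz by simp
qed

lemma crit_from_alpha:
  assumes x: "x \<in> cone_reg X" "pairing \<alpha> x \<noteq> 0" and u: "pairing u x \<noteq> 0"
    and eq: "\<And>v. v \<in> tangent_space X x \<Longrightarrow> pairing u v * pairing \<alpha> x = pairing \<alpha> v * pairing u x"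
  shows "((of_nat d / pairing u x) *s x, u) \<in> crit_incidence F X"
proof (rule critI[OF X F x(1) _ u])
  have xC: "x \<in> affine_cone X" using x(1) cone_reg_iff[OF X] by blast
  show "F x \<noteq> 0" using F\<alpha>[OF xC] x(2) by simp
  fix v assume v: "v \<in> tangent_space X x"
  have "pairing \<alpha> x ^ d = pairing \<alpha> x ^ (d - 1) * pairing \<alpha> x" using F(2) by (metis power_minus_mult)
  then have "of_nat d * F x * pairing u v = of_nat d * pairing \<alpha> x ^ (d - 1) * (pairing u v * pairing \<alpha> x)"
    using F\<alpha>[OF xC] by (simp add: algebra_simps)
  also have "\<dots> = pairing (gradient F x) v * pairing u x"
    unfolding eq[OF v] gradient_F[OF xC v] by (simp add: algebra_simps)
  finally show "of_nat d * F x * pairing u v = pairing (gradient F x) v * pairing u x" .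
qed

lemma direction_exists:
  obtains w where "w \<in> vec.span (affine_cone X)" "pairing \<alpha> w = 0" "w \<noteq> 0"
proof -
  obtain y where y: "y \<in> vec.span (affine_cone X)" "pairing \<alpha> y \<noteq> 0" using \<alpha>_nz vec.span_base by metis
  obtain \<beta> where \<beta>: "\<And>c. \<exists>x\<in>vec.span (affine_cone X). pairing \<beta> x \<noteq> c * pairing \<alpha> x"
    using second_coordinate[OF vec.subspace_span dim3 y] by blast
  obtain x where x: "x \<in> vec.span (affine_cone X)" "pairing \<beta> x \<noteq> pairing \<beta> y / pairing \<alpha> y * pairing \<alpha> x"
    using \<beta> by blast
  let ?w = "x - (pairing \<alpha> x / pairing \<alpha> y) *s y"
  have "?w \<in> vec.span (affine_cone X)" using x y by (intro vec.span_diff vec.span_scale)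
  moreover have "pairing \<alpha> ?w = 0" using y by simp
  moreover have "?w \<noteq> 0"
  proof
    assume "?w = 0"
    then have "pairing \<beta> ?w = 0" by (simp only: pairing_linear)
    then show False using x(2) by (simp add: mult.commute)
  qed
  ultimately show thesis using that by blast
qed

end

section \<open>Dual equations that are linear in one direction\<close>

text \<open>
  The plane case: \<open>F\<close> is the \<open>d\<close>-th power of \<open>\<alpha>\<close> on the curve, and an equation \<open>g\<close> of the dual variety
  is affine-linear in the direction \<open>\<alpha>\<close>, that is, \<open>\<alpha>\<close> has multiplicity one less than the degree.
\<close>
locale linear_dual_equation = power_on_plane_curve +
  fixes g :: "complex ^ 'n \<Rightarrow> complex" and e :: nat
  assumes g: "homogeneous e g" "e > 0"
    and g_ideal: "f \<in> vanishing_ideal (dual_variety X) \<longleftrightarrow> (\<exists>h. polynomial h \<and> f = (\<lambda>x. g x * h x))"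
    and g_zero: "g u = 0 \<Longrightarrow> u \<in> affine_cone (dual_variety X)"
    and g_linear: "g (u + t *s \<alpha>) = g u + t * pairing \<alpha> (gradient g u)"
    and slope_nz: "\<exists>u. pairing \<alpha> (gradient g u) \<noteq> 0"
begin

definition A :: "complex ^ 'n \<Rightarrow> complex" where "A u = pairing \<alpha> (gradient g u)"

text \<open>By \<open>crit_formula\<close> below, this is the only possible critical point for \<open>u\<close>.\<close>
definition M :: "complex ^ 'n \<Rightarrow> complex ^ 'n" where
  "M u = of_nat d *s (inverse (g u) *s gradient g u - inverse (A u) *s gradient A u)"

lemma g_polynomial: "polynomial g" using g(1) homogeneous_imp_polynomial by blast

lemma A_polynomial: "polynomial A"
  unfolding A_def[abs_def] using polynomial_gradient[OF g_polynomial] by (intro polynomial_pairing_maps) auto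

lemma g_line: "g (u + t *s \<alpha>) = g u + t * A u" by (simp add: A_def g_linear)

lemma A_shift: "A (u + t *s \<alpha>) = A u"
proof -
  have "u + (t + 1) *s \<alpha> = (u + t *s \<alpha>) + 1 *s \<alpha>" by (simp add: vec_eq_iff algebra_simps)
  then have "g (u + (t + 1) *s \<alpha>) = g ((u + t *s \<alpha>) + 1 *s \<alpha>)" by (simp only:)
  then have "g u + (t + 1) * A u = g u + t * A u + 1 * A (u + t *s \<alpha>)"
    unfolding g_line[of u "t + 1"] g_line[of "u + t *s \<alpha>" 1] g_line[of u t] .
  then show ?thesis by (simp add: algebra_simps)
qed

lemma A_homogeneous: "homogeneous (e - 1) A"
  by (rule homogeneousI_nonzero[OF A_polynomial]) (simp add: A_def gradient_scale[OF g])

lemma gradient_shift: "gradient g (u + t *s \<alpha>) = gradient g u + t *s gradient A u"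
proof (rule gradient_eqI)
  fix v
  have "((\<lambda>s. g (u + s *s v) + t * A (u + s *s v)) has_field_derivative
      pairing (gradient g (u + 0 *s v)) v + t * pairing (gradient A (u + 0 *s v)) v) (at 0)"
    by (intro DERIV_add DERIV_cmult gradient_line g_polynomial A_polynomial)
  moreover have "g (u + s *s v) + t * A (u + s *s v) = g (u + t *s \<alpha> + s *s v)" for s
    using g_line[of "u + s *s v" t] by (simp add: add_ac)
  ultimately show "((\<lambda>s. g (u + t *s \<alpha> + s *s v)) has_field_derivative pairing (gradient g u + t *s gradient A u) v) (at 0)"
    by simp
qed

lemma tangent_covector_zero: "u \<in> tangent_covectors X \<Longrightarrow> g u = 0"
proof -
  assume u: "u \<in> tangent_covectors X"
  have "g \<in> vanishing_ideal (dual_variety X)" using g_ideal by (auto intro!: exI[of _ "\<lambda>_. 1"])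
  then show "g u = 0" using vanishing_idealD tangent_covectors_subset_dual[OF u] by blast
qed

text \<open>
  A critical point \<open>x\<close> for \<open>u\<close> is the point of contact of the tangent line \<open>u - (d / \<alpha> x) \<alpha>\<close>; this is
  the only tangent line in the pencil spanned by \<open>u\<close> and \<open>\<alpha>\<close>, other than \<open>\<alpha>\<close>.
\<close>
lemma crit_formula:
  assumes crit: "(x, u) \<in> crit_incidence F X" and A: "A u \<noteq> 0"
    and w: "w \<in> vec.span (affine_cone X)" "pairing \<alpha> w = 0" "pairing u w \<noteq> 0"
  shows "pairing \<alpha> x = of_nat d * A u * inverse (g u)" "x = M u"
proof -
  note D = critD[OF X F(1) crit] and nz = crit_alpha(1)[OF crit]
  define t where "t = - (of_nat d / pairing \<alpha> x)"
  have tangent: "pairing (u + t *s \<alpha>) v = 0" if "v \<in> tangent_space X x" for v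
    using crit_alpha(2)[OF crit that] nz by (simp add: t_def field_simps)
  have "x \<noteq> 0" using nz by auto
  then have "u + t *s \<alpha> \<in> tangent_covectors X" using D(1) tangent by (auto simp: tangent_covectors_def)
  then have g0: "g u + t * A u = 0" using tangent_covector_zero g_line by metis
  have t: "t \<noteq> 0" using nz d_nz by (simp add: t_def)
  then have gu: "g u \<noteq> 0" using g0 A by auto
  have ax: "pairing \<alpha> x * g u = of_nat d * A u"
    using g0 nz by (simp add: t_def field_simps)
  then show "pairing \<alpha> x = of_nat d * A u * inverse (g u)" using gu by (simp add: field_simps)
  have "pairing \<alpha> x *s gradient g (u + t *s \<alpha>) = pairing \<alpha> (gradient g (u + t *s \<alpha>)) *s x"
    by (rule gradient_dual_equation[OF X dim3 g tangent_covector_zero D(1) nz tangent w(1)]) (use w in simp_all)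
  then have eq: "pairing \<alpha> x *s (gradient g u + t *s gradient A u) = A u *s x"
    unfolding gradient_shift[symmetric] using A_shift[of u t] by (simp add: A_def)
  have "A u * x $ i = A u * M u $ i" for i
  proof -
    have e1: "A u * x $ i = pairing \<alpha> x * gradient g u $ i + (pairing \<alpha> x * t) * gradient A u $ i"
      using arg_cong[OF eq, of "\<lambda>y. y $ i"] by (simp add: algebra_simps)
    have e2: "pairing \<alpha> x * t = - of_nat d" using nz by (simp add: t_def)
    have e3: "pairing \<alpha> x = of_nat d * A u / g u" using ax gu by (simp add: field_simps)
    show ?thesis
      unfolding e1 e2 unfolding e3 using A gu by (simp add: M_def field_simps)
  qed
  then show "x = M u" using A by (simp add: vec_eq_iff)
qed

lemma tangent_covectors_nonempty: "tangent_covectors X \<noteq> {}"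
proof
  assume empty: "tangent_covectors X = {}"
  obtain w where w: "w \<in> vec.span (affine_cone X)" "pairing \<alpha> w = 0" "w \<noteq> 0" using direction_exists .
  obtain y where y: "pairing y w \<noteq> 0" using pairing_nonzero[OF w(3)] by (metis zero_neq_one)
  have "\<exists>u. A u * pairing u w \<noteq> 0"
    using polynomial_mult_zero[OF A_polynomial, of "\<lambda>u. pairing u w"] slope_nz y by (auto simp: A_def)
  then obtain u where u: "A u \<noteq> 0" "pairing u w \<noteq> 0" by auto
  let ?z = "u + (- g u / A u) *s \<alpha>"
  have "g ?z = g u + (- g u / A u) * A u" by (rule g_line)
  then have "g ?z = 0" using u(1) by simp
  then have "?z \<in> affine_cone (dual_variety X)" by (rule g_zero)
  moreover have "?z \<noteq> 0"
  proof
    assume "?z = 0"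
    then have "pairing ?z w = 0" by (simp only: pairing_linear)
    then show False using u w by simp
  qed
  ultimately have "dual_variety X \<noteq> {}" by (auto simp: affine_cone_def)
  moreover have "dual_variety X = proj_zeros {f. \<exists>k. homogeneous k f}"
    unfolding dual_variety_eq empty by (subst proj_closure_eq) auto
  moreover have "homogeneous 0 (\<lambda>_. 1)" by (simp add: homogeneous_iff)
  ultimately show False unfolding proj_zeros_def proj_space_def
    by (auto dest!: spec[of _ "\<lambda>_. 1"] intro: vec.span_base)
qed

text \<open>
  Adding to a tangent covector any nonzero multiple of \<open>\<alpha>\<close> gives a functional with a critical point.
  By linearity of \<open>g\<close> in the direction \<open>\<alpha>\<close>, every \<open>u\<close> with \<open>A u \<noteq> 0\<close> is of the form zero of \<open>g\<close> plus
  multiple of \<open>\<alpha>\<close>.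
\<close>
lemma crit_covectors_dense:
  assumes G: "polynomial G" and zero: "\<And>x u. (x, u) \<in> crit_incidence F X \<Longrightarrow> G u = 0"
  shows "G u = 0"
proof -
  have shifted: "G (w + c *s \<alpha>) = 0" if w: "w \<in> affine_cone (dual_variety X)" for w c
  proof -
    have Gc: "polynomial (\<lambda>w. G (w + c *s \<alpha>))"
      by (rule polynomial_compose[OF G]) (auto intro!: polynomial_add)
    have zero_c: "G (u + c *s \<alpha>) = 0"
      if x: "x \<in> cone_reg X" "pairing \<alpha> x \<noteq> 0" and u: "\<And>v. v \<in> tangent_space X x \<Longrightarrow> pairing u v = 0" for x u
    proof -
      obtain p where p: "\<And>t. poly p t = G (u + t *s \<alpha>)" using polynomial_on_line[OF G] by blast
      have "poly p t = 0" if "t \<noteq> 0" for t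
      proof -
        have "x \<in> tangent_space X x"
          using radial_tangent[OF irreducible_curveD(3)[OF X]] x(1) cone_reg_iff[OF X] by blast
        then have "pairing (u + t *s \<alpha>) x = t * pairing \<alpha> x" using u by simp
        then have "((of_nat d / pairing (u + t *s \<alpha>) x) *s x, u + t *s \<alpha>) \<in> crit_incidence F X"
          using that x u by (intro crit_from_alpha) auto
        then show ?thesis using zero p by metis
      qed
      then have "p = 0" by (rule poly_zero_if_zero_off_0)
      then show ?thesis using p[of c] by simp
    qed
    obtain y where y: "y \<in> affine_cone X" "pairing \<alpha> y \<noteq> 0" using \<alpha>_nz by blast
    have "(\<lambda>w. G (w + c *s \<alpha>)) \<in> vanishing_ideal (dual_variety X)"
    proof (rule vanishing_ideal_dual[OF Gc _ tangent_covectors_nonempty])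
      fix u assume "u \<in> tangent_covectors X"
      then show "G (u + c *s \<alpha>) = 0"
        using tangent_covectors_dense[OF X Gc homogeneous_pairing y] zero_c by blast
    qed
    then show ?thesis using vanishing_idealD[OF _ w] by blast
  qed
  have "A u * G u = 0" for u
  proof (cases "A u = 0")
    case False
    let ?t = "- g u / A u"
    have "g (u + ?t *s \<alpha>) = g u + ?t * A u" by (rule g_line)
    then have "g (u + ?t *s \<alpha>) = 0" using False by simp
    then have "G (u + ?t *s \<alpha> + (- ?t) *s \<alpha>) = 0" by (intro shifted g_zero)
    moreover have "u + ?t *s \<alpha> + (- ?t) *s \<alpha> = u" by (simp add: vec_eq_iff)
    ultimately show ?thesis by simp
  qed simp
  then show ?thesis using polynomial_mult_zero[OF A_polynomial G] slope_nz by (auto simp: A_def)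
qed

text \<open>
  Everything that distinguishes critical points is a rational identity or a nonvanishing condition
  in \<open>u\<close>, so it passes from the dense set of \<open>u\<close> that have a critical point to general \<open>u\<close>.
\<close>
lemma generic_critical_point:
  "generically (\<lambda>u. g u \<noteq> 0 \<and> A u \<noteq> 0 \<and> pairing \<alpha> (M u) = of_nat d * A u * inverse (g u) \<and>
    (\<forall>x. (x, u) \<in> crit_incidence F X \<longleftrightarrow> x = M u))"
proof -
  obtain w where w: "w \<in> vec.span (affine_cone X)" "pairing \<alpha> w = 0" "w \<noteq> 0" using direction_exists .
  obtain y where y: "pairing y w \<noteq> 0" using pairing_nonzero[OF w(3)] by (metis zero_neq_one)
  \<comment> \<open>\<open>u(w) \<noteq> 0\<close> ensures that \<open>u\<close> is no multiple of \<open>\<alpha>\<close> on the plane of \<open>X\<close>\<close>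
  define q where "q u = g u * (A u * pairing u w)" for u
  have yp: "polynomial (\<lambda>u. pairing u w)" by simp
  have Ayp: "polynomial (\<lambda>u. A u * pairing u w)" using A_polynomial yp by (rule polynomial_mult)
  have qp: "polynomial q" unfolding q_def[abs_def] by (rule polynomial_mult[OF g_polynomial Ayp])
  have g_ex: "\<exists>u. g u \<noteq> 0"
  proof (rule ccontr)
    assume "\<not> ?thesis"
    then have "g = (\<lambda>_. 0)" by auto
    then show False using slope_nz by simp
  qed
  have q_ex: "\<exists>u. q u \<noteq> 0"
    using polynomial_mult_zero[OF A_polynomial yp] polynomial_mult_zero[OF g_polynomial Ayp] slope_nz y g_ex
    unfolding q_def A_def by metis
  have formula: "pairing \<alpha> x = of_nat d * A u * inverse (g u)" "x = M u"
    if "(x, u) \<in> crit_incidence F X" "q u \<noteq> 0" for x u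
    using crit_formula[OF that(1) _ w(1,2)] that(2) by (auto simp: q_def)
  have M_rat: "rational_off q (\<lambda>u. M u $ i)" for i
  proof -
    have "rational_off q (\<lambda>u. inverse (g u))"
      by (rule rational_off_inverse[OF Ayp]) (simp add: q_def)
    moreover have "rational_off q (\<lambda>u. inverse (A u))"
      by (rule rational_off_inverse[where h = "\<lambda>u. g u * pairing u w"])
        (auto simp: q_def intro!: polynomial_mult g_polynomial)
    ultimately have "rational_off q (\<lambda>u. of_nat d * (inverse (g u) * gradient g u $ i + (- 1) * (inverse (A u) * gradient A u $ i)))"
      by (intro rational_off_mult rational_off_add[OF qp] rational_off_polynomial[OF polynomial_const]
          rational_off_polynomial[OF polynomial_gradient] g_polynomial A_polynomial)
    moreover have "M u $ i = of_nat d * (inverse (g u) * gradient g u $ i + (- 1) * (inverse (A u) * gradient A u $ i))" for u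
      by (simp add: M_def algebra_simps)
    ultimately show ?thesis by (simp only:)
  qed
  have transfer: "\<phi> u = 0" if \<phi>: "rational_off q \<phi>" and "\<And>x u. (x, u) \<in> crit_incidence F X \<Longrightarrow> q u \<noteq> 0 \<Longrightarrow> \<phi> u = 0"
    and u: "q u \<noteq> 0" for \<phi> u
  proof -
    obtain N H where H: "polynomial H" "\<And>u. q u \<noteq> 0 \<Longrightarrow> \<phi> u * q u ^ N = H u"
      using \<phi> unfolding rational_off_def by blast
    have "q v * H v = 0" if "(x, v) \<in> crit_incidence F X" for x v
      using that \<open>\<And>x u. (x, u) \<in> crit_incidence F X \<Longrightarrow> q u \<noteq> 0 \<Longrightarrow> \<phi> u = 0\<close>[OF that] H(2)[of v]
      by (cases "q v = 0") auto
    then have "q u * H u = 0"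
      using crit_covectors_dense[of "\<lambda>u. q u * H u"] qp H(1) by (metis polynomial_mult)
    then show ?thesis using H(2)[OF u] u by auto
  qed
  have M_cone: "M u \<in> affine_cone X" if "q u \<noteq> 0" for u
    unfolding mem_affine_cone_iff[OF irreducible_curveD(1,2)[OF X]]
  proof
    fix f assume f: "f \<in> vanishing_ideal X"
    show "f (M u) = 0"
    proof (rule transfer[OF rational_off_compose[OF qp vanishing_ideal_polynomial[OF f] M_rat] _ that])
      fix x u assume xu: "(x, u) \<in> crit_incidence F X" "q u \<noteq> 0"
      then show "f (M u) = 0" using vanishing_idealD[OF f critD(3)[OF X F(1) xu(1)]] formula(2)[OF xu] by simp
    qed
  qed
  have M_alpha: "pairing \<alpha> (M u) = of_nat d * A u * inverse (g u)" if "q u \<noteq> 0" for u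
  proof -
    have "rational_off q (\<lambda>u. inverse (g u))"
      by (rule rational_off_inverse[OF Ayp]) (simp add: q_def)
    then have "rational_off q (\<lambda>u. pairing \<alpha> (M u) + (- of_nat d) * (A u * inverse (g u)))"
      by (intro rational_off_mult rational_off_add[OF qp] rational_off_polynomial[OF polynomial_const]
          rational_off_polynomial[OF A_polynomial] rational_off_compose[OF qp polynomial_pairing(1) M_rat])
    then have "pairing \<alpha> (M u) + (- of_nat d) * (A u * inverse (g u)) = 0"
      by (rule transfer[OF _ _ that]) (use formula in \<open>simp add: mult.assoc\<close>)
    then show ?thesis by simp
  qed
  have M_pair: "pairing u (M u) = of_nat d" if "q u \<noteq> 0" for u
  proof -
    have "rational_off q (\<lambda>u. \<Sum>i\<in>I. u $ i * M u $ i)" for I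
    proof (induction I rule: infinite_finite_induct)
      case (insert i I)
      have "rational_off q (\<lambda>u. u $ i * M u $ i + (\<Sum>i\<in>I. u $ i * M u $ i))"
        by (intro rational_off_mult rational_off_add[OF qp] rational_off_polynomial[OF polynomial_coord] M_rat insert)
      then show ?case using insert by simp
    qed (simp_all add: rational_off_polynomial)
    then have "rational_off q (\<lambda>u. pairing u (M u) + (- of_nat d))"
      unfolding pairing_def by (intro rational_off_add[OF qp] rational_off_polynomial[OF polynomial_const])
    then have "pairing u (M u) + (- of_nat d) = 0"
    proof (rule transfer[OF _ _ that])
      fix x u assume xu: "(x, u) \<in> crit_incidence F X" "q u \<noteq> 0"
      then show "pairing u (M u) + - of_nat d = 0"
        using critD(5)[OF X F(1) xu(1)] formula(2)[OF xu] by simp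
    qed
    then show ?thesis by simp
  qed
  \<comment> \<open>regularity of \<open>M u\<close> is witnessed by the vector field of an arc through one critical point\<close>
  have "\<exists>x0 u0. (x0, u0) \<in> crit_incidence F X \<and> q u0 \<noteq> 0"
    using crit_covectors_dense[OF qp] q_ex by blast
  then obtain x0 u0 where x0: "(x0, u0) \<in> crit_incidence F X" "q u0 \<noteq> 0" by blast
  obtain v \<gamma> r where arc: "regular_arc X \<alpha> v \<gamma> r" "\<gamma> 0 = x0"
    using regular_arc_exists[OF X critD(1)[OF X F(1) x0(1)] crit_alpha(1)[OF x0(1)]] by blast
  have "v x0 \<noteq> 0" using regular_arcD(9)[OF arc(1), of 0] regular_arcD(1)[OF arc(1)] arc(2) by simp
  then obtain j where j: "v x0 $ j \<noteq> 0" by (metis vec_eq_iff zero_index)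
  have v_rat: "rational_off q (\<lambda>u. v (M u) $ i)" for i
    by (rule rational_off_compose[OF qp regular_arcD(2)[OF arc(1)] M_rat])
  have M_tangent: "pairing u (v (M u)) = 0" if "q u \<noteq> 0" for u
  proof -
    have "rational_off q (\<lambda>u. \<Sum>i\<in>I. u $ i * v (M u) $ i)" for I
    proof (induction I rule: infinite_finite_induct)
      case (insert i I)
      have "rational_off q (\<lambda>u. u $ i * v (M u) $ i + (\<Sum>i\<in>I. u $ i * v (M u) $ i))"
        by (intro rational_off_mult rational_off_add[OF qp] rational_off_polynomial[OF polynomial_coord] v_rat insert)
      then show ?case using insert by simp
    qed (simp_all add: rational_off_polynomial)
    then have "rational_off q (\<lambda>u. pairing u (v (M u)))" unfolding pairing_def .
    then show ?thesis
    proof (rule transfer[OF _ _ that])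
      fix x u assume xu: "(x, u) \<in> crit_incidence F X" "q u \<noteq> 0"
      have "pairing u (v x) * pairing \<alpha> x = 0"
        using crit_alpha(2)[OF xu(1) regular_arcD(5)[OF arc(1) critD(3)[OF X F(1) xu(1)]]]
          regular_arcD(3)[OF arc(1)] by simp
      then show "pairing u (v (M u)) = 0" using crit_alpha(1)[OF xu(1)] formula(2)[OF xu] by simp
    qed
  qed
  have crit: "(M u, u) \<in> crit_incidence F X" if u: "q u \<noteq> 0" "v (M u) $ j \<noteq> 0" for u
  proof -
    have nz: "pairing \<alpha> (M u) \<noteq> 0" using M_alpha[OF u(1)] u(1) d_nz by (auto simp: q_def)
    have vnz: "v (M u) \<noteq> 0" using u(2) by auto
    note R = regular_arcD(6,7)[OF arc(1) M_cone[OF u(1)] nz vnz]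
    have "((of_nat d / pairing u (M u)) *s M u, u) \<in> crit_incidence F X"
    proof (rule crit_from_alpha[OF R(1) nz])
      show "pairing u (M u) \<noteq> 0" using M_pair[OF u(1)] d_nz by simp
      fix z assume "z \<in> tangent_space X (M u)"
      then obtain a b where "z = a *s M u + b *s v (M u)" using R(2) span_pair_iff by blast
      then show "pairing u z * pairing \<alpha> (M u) = pairing \<alpha> z * pairing u (M u)"
        using M_tangent[OF u(1)] regular_arcD(3)[OF arc(1)] by simp
    qed
    then show ?thesis using M_pair[OF u(1)] d_nz by simp
  qed
  have "v (M u0) $ j \<noteq> 0" using j formula(2)[OF x0] by simp
  then have "generically (\<lambda>u. q u \<noteq> 0 \<and> v (M u) $ j \<noteq> 0)"
    by (rule rational_off_generically_nonzero[OF qp v_rat x0(2)])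
  then show ?thesis
    by (rule generically_mono) (use crit formula(2) M_alpha in \<open>auto simp: q_def\<close>)
qed

lemma MLD_eq_1: "MLD F X = 1"
proof -
  have "zariski_dense (snd ` crit_incidence F X)"
    unfolding zariski_dense_def
  proof safe
    fix q assume "polynomial q" "\<forall>u\<in>snd ` crit_incidence F X. q u = 0"
    then have "q u = 0" for u using crit_covectors_dense[of q u] by force
    then show "q = (\<lambda>_. 0)" by blast
  qed
  moreover have "generically (\<lambda>u. finite {x. (x, u) \<in> crit_incidence F X} \<and> card {x. (x, u) \<in> crit_incidence F X} = 1)"
    by (rule generically_mono[OF generic_critical_point]) auto
  ultimately show ?thesis by (simp add: MLD_def generic_card_eq)
qed

definition \<Psi> :: "complex ^ 'n \<Rightarrow> complex" where
  "\<Psi> u = of_nat d ^ d * pairing \<alpha> (log_gradient g u) ^ d"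

lemma Psi_eq: "\<Psi> u = of_nat d ^ d * A u ^ d / g u ^ d"
  by (simp add: \<Psi>_def log_gradient_def A_def field_simps power_mult_distrib power_inverse)

lemma log_gradient_Psi:
  assumes "g u \<noteq> 0" "A u \<noteq> 0"
  shows "- log_gradient \<Psi> u = M u"
proof -
  have grad: "gradient \<Psi> u = (of_nat d * \<Psi> u) *s (inverse (A u) *s gradient A u - inverse (g u) *s gradient g u)"
  proof (rule gradient_eqI)
    fix v
    let ?a = "\<lambda>t. A (u + t *s v)" and ?g = "\<lambda>t. g (u + t *s v)"
    have "((\<lambda>t. of_nat d ^ d * (?a t / ?g t) ^ d) has_field_derivative
      of_nat d ^ d * (of_nat d * (?a 0 / ?g 0) ^ (d - 1) *
        ((pairing (gradient A (u + 0 *s v)) v * ?g 0 - ?a 0 * pairing (gradient g (u + 0 *s v)) v) / (?g 0 * ?g 0)))) (at 0)"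
      using DERIV_cmult[OF DERIV_power[OF DERIV_divide[OF gradient_line[OF A_polynomial, of u v 0]
            gradient_line[OF g_polynomial, of u v 0]], where n = d], of "of_nat d ^ d"] assms
      by (simp add: mult_ac)
    moreover have "(\<lambda>t. of_nat d ^ d * (?a t / ?g t) ^ d) = (\<lambda>t. \<Psi> (u + t *s v))"
      by (simp add: Psi_eq power_divide)
    moreover have "of_nat d ^ d * (of_nat d * (?a 0 / ?g 0) ^ (d - 1) *
        ((pairing (gradient A (u + 0 *s v)) v * ?g 0 - ?a 0 * pairing (gradient g (u + 0 *s v)) v) / (?g 0 * ?g 0)))
      = pairing ((of_nat d * \<Psi> u) *s (inverse (A u) *s gradient A u - inverse (g u) *s gradient g u)) v"
    proof -
      let ?r = "(A u / g u) ^ (d - 1)" and ?x = "pairing (gradient A u) v" and ?y = "pairing (gradient g u) v"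
      have pw: "(A u / g u) ^ d = ?r * (A u / g u)" using F(2) by (metis power_minus_mult)
      have Psi: "\<Psi> u = of_nat d ^ d * (?r * (A u / g u))"
        unfolding pw[symmetric] by (simp add: Psi_eq power_divide)
      have quot: "(?x * g u - A u * ?y) / (g u * g u) = (A u / g u) * (inverse (A u) * ?x - inverse (g u) * ?y)"
        using assms by (simp add: field_simps)
      have zero: "u + 0 *s v = u" by simp
      show ?thesis
        unfolding pairing_linear Psi zero quot by (simp only: mult_ac)
    qed
    ultimately show "((\<lambda>t. \<Psi> (u + t *s v)) has_field_derivative
        pairing ((of_nat d * \<Psi> u) *s (inverse (A u) *s gradient A u - inverse (g u) *s gradient g u)) v) (at 0)"
      by simp
  qed
  have "\<Psi> u \<noteq> 0" using assms d_nz by (simp add: Psi_eq)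
  then have inv: "inverse (\<Psi> u) * (of_nat d * \<Psi> u) = of_nat d" by simp
  show ?thesis
    unfolding log_gradient_def grad vec.scale_scale inv by (simp add: M_def vec_eq_iff algebra_simps)
qed

lemma Psi_solution:
  "homaloidal_solution_of F X \<Psi>"
  "homaloidal_solution_of F X \<Phi> \<Longrightarrow> generically (\<lambda>u. \<Phi> u = \<Psi> u)"
proof -
  have gen: "generically (\<lambda>u. \<Psi> u \<noteq> 0 \<and> - log_gradient \<Psi> u = M u \<and> MLE F X u = M u \<and> F (M u) = \<Psi> u)"
  proof (rule generically_mono[OF generic_critical_point])
    fix u assume u: "g u \<noteq> 0 \<and> A u \<noteq> 0 \<and> pairing \<alpha> (M u) = of_nat d * A u * inverse (g u) \<and>
      (\<forall>x. (x, u) \<in> crit_incidence F X \<longleftrightarrow> x = M u)"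
    then have "M u \<in> affine_cone X" using critD(3)[OF X F(1)] by blast
    then have "F (M u) = \<Psi> u"
      using F\<alpha> u by (simp add: Psi_eq power_mult_distrib power_inverse field_simps)
    moreover have "MLE F X u = M u" unfolding MLE_def using u by simp
    moreover have "\<Psi> u \<noteq> 0" using u d_nz by (simp add: Psi_eq)
    ultimately show "\<Psi> u \<noteq> 0 \<and> - log_gradient \<Psi> u = M u \<and> MLE F X u = M u \<and> F (M u) = \<Psi> u"
      using log_gradient_Psi u by simp
  qed
  have "homogeneous_rational \<Psi>"
    unfolding homogeneous_rational_def
  proof (intro exI conjI)
    show "homogeneous ((e - 1) * d) (\<lambda>u. of_nat d ^ d * A u ^ d)"
      by (rule homogeneous_cmult[OF homogeneous_power[OF A_homogeneous]])
    show "homogeneous (e * d) (\<lambda>u. g u ^ d)" by (rule homogeneous_power[OF g(1)])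
    obtain u where "g u \<noteq> 0" using generically_ex[OF generic_critical_point] by blast
    then have "g u ^ d \<noteq> 0" by simp
    then show "(\<lambda>u. g u ^ d) \<noteq> (\<lambda>_. 0)" by metis
    show "generically (\<lambda>u. \<Psi> u = of_nat d ^ d * A u ^ d / g u ^ d)"
      by (rule generically_mono[OF gen]) (rule Psi_eq)
  qed
  then show "homaloidal_solution_of F X \<Psi>"
    unfolding homaloidal_solution_of_def homaloidal_solution_def
    by (intro conjI generically_mono[OF gen]) auto
  assume "homaloidal_solution_of F X \<Phi>"
  then have "generically (\<lambda>u. \<Phi> u = F (- log_gradient \<Phi> u) \<and> MLE F X u = - log_gradient \<Phi> u)"
    unfolding homaloidal_solution_of_def homaloidal_solution_def by (intro generically_conj) auto
  from generically_conj[OF this gen] show "generically (\<lambda>u. \<Phi> u = \<Psi> u)"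
    by (rule generically_mono) auto
qed

end

lemma linear_dual_equationI:
  fixes X :: "(complex ^ 'n) set set"
  assumes X: "irreducible_curve X" and span: "proj_span_dim X = 2"
    and F: "homogeneous d F" "d > 0" "\<exists>x\<in>affine_cone X. F x \<noteq> 0"
    and mult: "int (hypersurface_mult \<alpha> (dual_variety X)) = int (hypersurface_degree (dual_variety X)) - 1"
    and power: "(\<lambda>x. F x - pairing \<alpha> x ^ d) \<in> vanishing_ideal X"
    and eq: "hypersurface_equation (dual_variety X) g"
  obtains e where "linear_dual_equation X F \<alpha> d g e"
proof -
  obtain e where e: "e > 0" "homogeneous e g" "\<exists>u. g u \<noteq> 0"
    "\<And>f. f \<in> vanishing_ideal (dual_variety X) \<longleftrightarrow> (\<exists>h. polynomial h \<and> f = (\<lambda>x. g x * h x))"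
    by (rule hypersurface_equationD[OF eq]) (rule that)
  obtain u0 where u0: "g u0 \<noteq> 0" using e(3) by blast
  have "int (vanishing_order g \<alpha>) = int e - 1"
    using mult hypersurface_mult_eq[OF eq] hypersurface_degree_eq[OF eq e(2)] by simp
  then have ord: "vanishing_order g \<alpha> = e - 1" by simp
  note lin = order_pred_degree_imp_linear[OF e(2,1) u0 ord]
  have dim3: "vec.dim (vec.span (affine_cone X)) = 3" using span by (simp add: proj_span_dim_def)
  have F\<alpha>: "F x = pairing \<alpha> x ^ d" if "x \<in> affine_cone X" for x
    using vanishing_idealD[OF power that] by simp
  obtain y where y: "y \<in> affine_cone X" "F y \<noteq> 0" using F(3) by blast
  then have "pairing \<alpha> y \<noteq> 0" using F\<alpha>[OF y(1)] F(2) by auto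
  then have \<alpha>nz: "\<exists>y\<in>affine_cone X. pairing \<alpha> y \<noteq> 0" using y(1) by blast
  have zero: "u \<in> affine_cone (dual_variety X)" if "g u = 0" for u
  proof (cases "u = 0")
    case False
    have "dual_variety X = proj_zeros {g}" using eq unfolding hypersurface_equation_def by blast
    moreover have "vec.span {u} \<in> proj_zeros {g}"
      using proj_zeros_span_iff[of "{g}" u] False that e(2) by blast
    ultimately show ?thesis using vec.span_base[of u "{u}"] by (auto simp: affine_cone_def)
  qed (simp add: affine_cone_def)
  have "linear_dual_equation X F \<alpha> d g e"
    by (unfold_locales; fact X dim3 F(1,2) F\<alpha> \<alpha>nz e(1,2,4) zero lin)
  then show thesis by (rule that)
qed

section \<open>Holomorphic functions with finite fibres are rational\<close>

text \<open>
  By the great Picard theorem, \<open>f\<close> or \<open>1 / f\<close> has a limit at the singularity, so that it is removable or a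
  pole.
\<close>
lemma finite_fibres_at_singularity:
  fixes f :: "complex \<Rightarrow> complex"
  assumes e: "e > 0" and f: "f holomorphic_on ball a e - {a}"
    and fin: "\<And>c. finite {z \<in> ball a e - {a}. f z = c}"
  obtains n h r where "0 < r" "r \<le> e" "h holomorphic_on ball a r"
    "\<And>z. z \<in> ball a r \<Longrightarrow> z \<noteq> a \<Longrightarrow> f z * (z - a) ^ n = h z"
proof -
  have a: "a \<in> ball a e" using e by simp
  show thesis
  proof (cases "\<exists>l. (f \<longlongrightarrow> l) (at a)")
    case True
    then obtain l where "(f \<longlongrightarrow> l) (at a)" by blast
    then have "(\<lambda>y. if y = a then l else f y) holomorphic_on ball a e"
      using removable_singularity[OF f open_ball] by blast
    then show thesis using that[of e _ 0] e by simp
  next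
    case no_limit: False
    have "\<exists>l. ((inverse \<circ> f) \<longlongrightarrow> l) (at a)"
    proof (rule ccontr)
      assume "\<not> ?thesis"
      then obtain b where b: "\<And>w. w \<noteq> b \<Longrightarrow> infinite {x. x \<in> ball a e - {a} \<and> f x = w}"
        using great_Picard_infinite[OF open_ball a f] no_limit by blast
      then show False using b[of "b + 1"] fin[of "b + 1"] by simp
    qed
    then obtain l where l: "((inverse \<circ> f) \<longlongrightarrow> l) (at a)" by blast
    have "l = 0"
    proof (rule ccontr)
      assume "l \<noteq> 0"
      then have "((\<lambda>z. inverse ((inverse \<circ> f) z)) \<longlongrightarrow> inverse l) (at a)" by (rule tendsto_inverse[OF l])
      then show False using no_limit by simp
    qed
    define Z where "Z = {z \<in> ball a e - {a}. f z = 0}"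
    have "open (ball a e - Z)"
      using fin[of 0] unfolding Z_def by (intro open_Diff open_ball finite_imp_closed)
    moreover have "a \<in> ball a e - Z" using e by (simp add: Z_def)
    ultimately have "\<forall>\<^sub>F z in at a. inverse (f z) \<noteq> 0"
      unfolding eventually_at_topological by (intro exI[of _ "ball a e - Z"]) (auto simp: Z_def)
    then have "filterlim (\<lambda>z. inverse (f z)) (at 0) (at a)"
      using l \<open>l = 0\<close> by (simp add: filterlim_at o_def)
    then have "is_pole f a" unfolding is_pole_def using filterlim_inverse_at_iff by blast
    from zorder_exist_pole[OF f open_ball a this]
    obtain r where r: "r > 0" "cball a r \<subseteq> ball a e" "zor_poly f a holomorphic_on cball a r"
      "\<And>w. w \<in> cball a r - {a} \<Longrightarrow> f w = zor_poly f a w / (w - a) ^ nat (- zorder f a)" by blast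
    show thesis
    proof (rule that[of "min r e" "zor_poly f a" "nat (- zorder f a)"])
      show "0 < min r e" "min r e \<le> e" using r(1) e by auto
      show "zor_poly f a holomorphic_on ball a (min r e)"
        by (rule holomorphic_on_subset[OF r(3)]) auto
      fix z assume "z \<in> ball a (min r e)" "z \<noteq> a"
      then show "f z * (z - a) ^ nat (- zorder f a) = zor_poly f a z" using r(4)[of z] by simp
    qed
  qed
qed

text \<open>
  None of the finitely many singularities, infinity included, is essential. Clearing the poles gives
  an entire function of polynomial growth, which is a polynomial by Liouville's theorem.
\<close>
lemma rational_if_finite_fibres:
  fixes f :: "complex \<Rightarrow> complex"
  assumes Z: "finite Z" and f: "f holomorphic_on - Z" and fin: "\<And>c. finite {z \<in> - Z. f z = c}"
  obtains P Q where "Q \<noteq> 0" "\<And>z. z \<notin> Z \<Longrightarrow> f z * poly Q z = poly P z"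
proof -
  have openZ: "open (- Z)" using Z by (simp add: finite_imp_closed open_Compl)
  have "\<exists>n h r. 0 < r \<and> ball a r \<inter> Z = {a} \<and> h holomorphic_on ball a r \<and>
      (\<forall>z\<in>ball a r. z \<noteq> a \<longrightarrow> f z * (z - a) ^ n = h z)" if a: "a \<in> Z" for a
  proof -
    obtain e where e: "e > 0" "\<forall>x\<in>Z. x \<noteq> a \<longrightarrow> e \<le> dist a x" using finite_set_avoid[OF Z] by blast
    then have sub: "ball a e - {a} \<subseteq> - Z" by force
    have ff: "finite {z \<in> ball a e - {a}. f z = c}" for c
      by (rule finite_subset[OF _ fin[of c]]) (use sub in blast)
    obtain n h r where r: "0 < r" "r \<le> e" "h holomorphic_on ball a r"
      "\<And>z. z \<in> ball a r \<Longrightarrow> z \<noteq> a \<Longrightarrow> f z * (z - a) ^ n = h z"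
      by (rule finite_fibres_at_singularity[OF e(1) holomorphic_on_subset[OF f sub] ff]) (rule that)
    have "ball a r \<inter> Z = {a}"
      using sub a r(1,2) subset_ball[OF r(2), of a] by auto
    then show ?thesis using r by blast
  qed
  then have "\<forall>a. \<exists>n h r. a \<in> Z \<longrightarrow> 0 < r \<and> ball a r \<inter> Z = {a} \<and> h holomorphic_on ball a r \<and>
      (\<forall>z\<in>ball a r. z \<noteq> a \<longrightarrow> f z * (z - a) ^ n = h z)" by blast
  then obtain n h r where loc: "\<And>a. a \<in> Z \<Longrightarrow> 0 < r a" "\<And>a. a \<in> Z \<Longrightarrow> ball a (r a) \<inter> Z = {a}"
    "\<And>a. a \<in> Z \<Longrightarrow> h a holomorphic_on ball a (r a)"
    "\<And>a z. a \<in> Z \<Longrightarrow> z \<in> ball a (r a) \<Longrightarrow> z \<noteq> a \<Longrightarrow> f z * (z - a) ^ n a = h a z" by metis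
  define Q where "Q = (\<Prod>a\<in>Z. [:- a, 1:] ^ n a)"
  have Qz: "poly Q z = (\<Prod>a\<in>Z. (z - a) ^ n a)" for z by (simp add: Q_def poly_prod)
  have Q0: "Q \<noteq> 0" using Z by (simp add: Q_def)
  define E where "E z = (if z \<in> Z then h z z * (\<Prod>b\<in>Z - {z}. (z - b) ^ n b) else f z * poly Q z)" for z
  have "E field_differentiable at z" for z
  proof (cases "z \<in> Z")
    case False
    have "(\<lambda>z. f z * poly Q z) holomorphic_on - Z" by (intro holomorphic_intros f)
    then have "E holomorphic_on - Z" by (rule holomorphic_transform) (simp add: E_def)
    then show ?thesis using holomorphic_on_imp_differentiable_at[OF _ openZ] False by blast
  next
    case True
    have "(\<lambda>w. h z w * (\<Prod>b\<in>Z - {z}. (w - b) ^ n b)) holomorphic_on ball z (r z)"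
      by (intro holomorphic_intros loc(3)[OF True])
    then have "E holomorphic_on ball z (r z)"
    proof (rule holomorphic_transform)
      fix w assume w: "w \<in> ball z (r z)"
      show "h z w * (\<Prod>b\<in>Z - {z}. (w - b) ^ n b) = E w"
      proof (cases "w = z")
        case True
        then show ?thesis using \<open>z \<in> Z\<close> by (simp add: E_def)
      next
        case False
        then have "w \<notin> Z" using w loc(2)[OF True] by blast
        then have "E w = f w * ((w - z) ^ n z * (\<Prod>b\<in>Z - {z}. (w - b) ^ n b))"
          using prod.remove[OF Z True, of "\<lambda>b. (w - b) ^ n b"] by (simp add: E_def Qz)
        then show ?thesis using loc(4)[OF True w False] by (simp add: mult.assoc[symmetric])
      qed
    qed
    then show ?thesis using holomorphic_on_imp_differentiable_at[OF _ open_ball] loc(1)[OF True] by simp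
  qed
  then have E_hol: "E holomorphic_on UNIV"
    by (simp add: holomorphic_on_def field_differentiable_at_within)
  obtain K where K: "K > 0" "\<And>b. b \<in> Z \<Longrightarrow> norm b \<le> K"
    using finite_imp_bounded[OF Z] bounded_pos by metis
  define e where "e = inverse K"
  have e: "e > 0" using K(1) by (simp add: e_def)
  have out: "inverse s \<notin> Z" if "s \<in> ball 0 e - {0}" for s
  proof
    assume "inverse s \<in> Z"
    then have "inverse (norm s) \<le> K" using K(2)[of "inverse s"] by (simp add: norm_inverse)
    moreover have "K < inverse (norm s)"
      using that K(1) less_imp_inverse_less[of "norm s" e] by (simp add: e_def)
    ultimately show False by simp
  qed
  have hol: "(f \<circ> inverse) holomorphic_on ball 0 e - {0}"
    by (rule holomorphic_on_compose_gen[OF _ f]) (use out in \<open>auto intro!: holomorphic_intros\<close>)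
  have fib: "finite {s \<in> ball 0 e - {0}. (f \<circ> inverse) s = c}" for c
  proof (rule finite_subset)
    show "{s \<in> ball 0 e - {0}. (f \<circ> inverse) s = c} \<subseteq> inverse ` {z \<in> - Z. f z = c}"
    proof
      fix s assume s: "s \<in> {s \<in> ball 0 e - {0}. (f \<circ> inverse) s = c}"
      then have "inverse s \<in> {z \<in> - Z. f z = c}" using out[of s] by auto
      then show "s \<in> inverse ` {z \<in> - Z. f z = c}" by (rule rev_image_eqI) simp
    qed
  qed (use fin in simp)
  obtain m k \<rho> where \<rho>: "0 < \<rho>" "\<rho> \<le> e" "k holomorphic_on ball 0 \<rho>"
    "\<And>s. s \<in> ball 0 \<rho> \<Longrightarrow> s \<noteq> 0 \<Longrightarrow> (f \<circ> inverse) s * (s - 0) ^ m = k s"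
    by (rule finite_fibres_at_singularity[OF e hol fib]) (rule that)
  \<comment> \<open>near infinity, \<open>f\<close> grows at most like \<open>z\<^sup>m\<close>\<close>
  define N where "N = m + degree Q"
  have cont: "continuous_on (cball 0 (\<rho> / 2)) (\<lambda>s. k s * poly (reflect_poly Q) s)"
  proof (intro continuous_intros)
    have "cball 0 (\<rho> / 2) \<subseteq> ball (0::complex) \<rho>" using \<rho>(1) by auto
    then show "continuous_on (cball 0 (\<rho> / 2)) k"
      using holomorphic_on_imp_continuous_on[OF \<rho>(3)] continuous_on_subset by blast
  qed
  then obtain C where C: "\<And>s. s \<in> cball 0 (\<rho> / 2) \<Longrightarrow> norm (k s * poly (reflect_poly Q) s) \<le> C"
    using compact_imp_bounded[OF compact_continuous_image[OF cont compact_cball]]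
    unfolding bounded_iff by blast
  have growth: "norm (E z) \<le> C * norm z ^ N" if z: "2 / \<rho> \<le> norm z" for z
  proof -
    have "0 < 2 / \<rho>" using \<rho>(1) by simp
    then have "0 < norm z" using z by linarith
    then have znz: "z \<noteq> 0" by simp
    let ?s = "inverse z"
    have "inverse (norm z) \<le> inverse (2 / \<rho>)" by (rule le_imp_inverse_le[OF z \<open>0 < 2 / \<rho>\<close>])
    then have s: "?s \<in> cball 0 (\<rho> / 2)" by (simp add: norm_inverse)
    moreover have "\<rho> / 2 < \<rho>" using \<rho>(1) by simp
    ultimately have s': "?s \<in> ball 0 \<rho>" by simp
    have snz: "?s \<noteq> 0" using znz by simp
    have zZ: "z \<notin> Z" using out[of ?s] s' snz \<rho>(2) by simp
    have zs: "z ^ j * ?s ^ j = 1" for j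
      using znz by (simp flip: power_mult_distrib)
    have ks: "k ?s = f z * ?s ^ m" using \<rho>(4)[OF s' snz] by simp
    have refl: "poly (reflect_poly Q) ?s = ?s ^ degree Q * poly Q z"
      using poly_reflect_poly_nz[OF snz, of Q] by simp
    have "k ?s * poly (reflect_poly Q) ?s * z ^ N =
        f z * poly Q z * (z ^ m * ?s ^ m) * (z ^ degree Q * ?s ^ degree Q)"
      unfolding ks refl N_def power_add by (simp only: mult_ac)
    then have "E z = k ?s * poly (reflect_poly Q) ?s * z ^ N"
      unfolding zs using zZ by (simp add: E_def)
    then show ?thesis
      using C[OF s] by (simp add: norm_mult norm_power mult_right_mono)
  qed
  define P where "P = (\<Sum>j\<le>N. monom ((deriv ^^ j) E 0 / fact j) j)"
  have "E z = poly P z" for z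
    using Liouville_polynomial[OF E_hol growth] by (simp add: P_def poly_sum poly_monom)
  then have "f z * poly Q z = poly P z" if "z \<notin> Z" for z
    using that unfolding E_def by metis
  then show thesis using that Q0 by blast
qed

section \<open>Binary forms\<close>

text \<open>The homogenization of \<open>p\<close> to degree \<open>n\<close> in the variables \<open>u(w1)\<close> and \<open>u(w2)\<close>, where \<open>z = u(w2) / u(w1)\<close>.\<close>
definition binary_form :: "complex ^ 'n \<Rightarrow> complex ^ 'n \<Rightarrow> complex poly \<Rightarrow> nat \<Rightarrow> complex ^ 'n \<Rightarrow> complex" where
  "binary_form w1 w2 p n u = (\<Sum>i\<le>n. coeff p i * (pairing u w2 ^ i * pairing u w1 ^ (n - i)))"

lemma binary_form_homogeneous: "homogeneous n (binary_form w1 w2 p n)"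
  unfolding homogeneous_iff
proof safe
  show "polynomial (binary_form w1 w2 p n)"
    unfolding binary_form_def[abs_def]
    by (intro polynomial_sum polynomial_mult polynomial_power polynomial_pairing polynomial_const)
  fix c u
  have scale: "pairing (c *s u) w2 ^ i * pairing (c *s u) w1 ^ (n - i) = c ^ n * (pairing u w2 ^ i * pairing u w1 ^ (n - i))"
    if "i \<le> n" for i
  proof -
    have "c ^ i * c ^ (n - i) = c ^ n" using that by (simp flip: power_add)
    then show ?thesis by (simp add: power_mult_distrib algebra_simps)
  qed
  show "binary_form w1 w2 p n (c *s u) = c ^ n * binary_form w1 w2 p n u"
    unfolding binary_form_def sum_distrib_left
    by (intro sum.cong refl) (simp only: scale atMost_iff mult_ac)
qed

lemma binary_form_polynomial: "polynomial (binary_form w1 w2 p n)"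
  using binary_form_homogeneous homogeneous_imp_polynomial by blast

lemma binary_form_eq_poly:
  assumes "degree p \<le> n" "pairing u w1 \<noteq> 0"
  shows "binary_form w1 w2 p n u = pairing u w1 ^ n * poly p (pairing u w2 / pairing u w1)"
  unfolding poly_eq_sum_atMost[OF assms(1)] binary_form_def sum_distrib_left
proof (rule sum.cong)
  fix i assume "i \<in> {..n}"
  then show "coeff p i * (pairing u w2 ^ i * pairing u w1 ^ (n - i)) =
      pairing u w1 ^ n * (coeff p i * (pairing u w2 / pairing u w1) ^ i)"
    using assms(2) by (simp add: power_diff power_divide field_simps)
qed simp

lemma binary_form_shift:
  "pairing a w1 = 0 \<Longrightarrow> pairing a w2 = 0 \<Longrightarrow> binary_form w1 w2 p n (u + s *s a) = binary_form w1 w2 p n u"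
  by (simp add: binary_form_def)

lemma polynomials_equal_off_hyperplane:
  assumes "polynomial f" "polynomial g" "w \<noteq> 0" "\<And>u. pairing u w \<noteq> 0 \<Longrightarrow> f u = g u"
  shows "f u = g u"
proof -
  have "\<exists>u. pairing u w \<noteq> 0" using pairing_nonzero[OF assms(3)] by (metis zero_neq_one)
  moreover have "pairing u w * (f u - g u) = 0" for u using assms(4)[of u] by auto
  ultimately show ?thesis
    using polynomial_mult_zero[of "\<lambda>u. pairing u w" "\<lambda>u. f u - g u"] assms(1,2)
    by (auto intro: polynomial_diff)
qed

text \<open>Division with remainder by the linear form is the expansion at a point of the hyperplane in the direction \<open>a\<close>.\<close>
lemma linear_form_divides:
  fixes K :: "complex ^ 'n \<Rightarrow> complex"
  assumes K: "polynomial K" and w: "w \<noteq> 0" and zero: "\<And>u. pairing u w = 0 \<Longrightarrow> K u = 0"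
  obtains H where "polynomial H" "\<And>u. K u = pairing u w * H u"
proof -
  obtain a where a: "pairing a w = 1" using pairing_nonzero[OF w] by metis
  obtain p N where p: "\<And>j. polynomial (\<lambda>x. coeff (p x) j)" "\<And>x. degree (p x) \<le> N"
    "\<And>x t. poly (p x) t = K ((x - pairing x w *s a) + t *s a)"
    by (rule polynomial_on_lines[OF K, of "\<lambda>x. x - pairing x w *s a" "\<lambda>_. a"])
      (auto intro!: polynomial_diff polynomial_mult)
  have "coeff (p u) 0 = 0" for u
  proof -
    have "poly (p u) 0 = 0" using zero a by (simp add: p(3))
    then show ?thesis by (simp add: poly_0_coeff_0)
  qed
  then have "K u = pairing u w * (\<Sum>j<N. coeff (p u) (Suc j) * pairing u w ^ j)" for u
  proof -
    have "K u = poly (p u) (pairing u w)" by (simp add: p(3))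
    also have "\<dots> = (\<Sum>j\<le>N. coeff (p u) j * pairing u w ^ j)" by (rule poly_eq_sum_atMost[OF p(2)])
    also have "\<dots> = (\<Sum>j<N. coeff (p u) (Suc j) * pairing u w ^ Suc j)"
      using \<open>\<And>u. coeff (p u) 0 = 0\<close> by (simp add: sum.atMost_shift)
    finally show ?thesis by (simp add: sum_distrib_left algebra_simps)
  qed
  moreover have "polynomial (\<lambda>u. \<Sum>j<N. coeff (p u) (Suc j) * pairing u w ^ j)"
    by (intro polynomial_sum polynomial_mult polynomial_power polynomial_pairing p(1))
  ultimately show thesis using that by blast
qed

text \<open>The hyperplane is irreducible and \<open>g\<close> does not vanish on it, so that \<open>K\<close> does.\<close>
lemma cancel_linear_form:
  fixes g G K :: "complex ^ 'n \<Rightarrow> complex"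
  assumes g: "polynomial g" and K: "polynomial K" and w: "w \<noteq> 0"
    and eq: "\<And>u. pairing u w * G u = g u * K u" and nz: "pairing a w = 0" "g a \<noteq> 0" and G: "polynomial G"
  obtains H where "polynomial H" "\<And>u. G u = g u * H u"
proof -
  have "(\<forall>u\<in>{u. pairing u w = 0}. g u = 0) \<or> (\<forall>u\<in>{u. pairing u w = 0}. K u = 0)"
  proof (rule polynomial_mult_zero_on[OF g K])
    fix u assume "u \<in> {u. pairing u w = 0}"
    then show "g u * K u = 0" using eq[of u] by simp
  qed simp
  then have "\<And>u. pairing u w = 0 \<Longrightarrow> K u = 0" using nz by blast
  then obtain H where H: "polynomial H" "\<And>u. K u = pairing u w * H u"
    using linear_form_divides[OF K w] by blast
  have "G u = g u * H u" for u
    by (rule polynomials_equal_off_hyperplane[OF G _ w])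
      (use eq H g in \<open>auto intro: polynomial_mult\<close>)
  then show thesis using that H(1) by blast
qed

text \<open>
  A binary form splits into linear factors, and these can be cancelled one by one. A degree
  smaller than \<open>n\<close> means that \<open>w1\<close>, the root at infinity, is among them.
\<close>
lemma cancel_binary_form:
  fixes g G K :: "complex ^ 'n \<Rightarrow> complex"
  assumes g: "polynomial g" and w: "w1 \<noteq> 0" "\<And>r. w2 - r *s w1 \<noteq> 0"
    and q: "q \<noteq> 0" "degree q \<le> n"
    and roots: "\<And>r. poly q r = 0 \<Longrightarrow> \<exists>a. pairing a (w2 - r *s w1) = 0 \<and> g a \<noteq> 0"
    and infinity: "degree q < n \<Longrightarrow> \<exists>a. pairing a w1 = 0 \<and> g a \<noteq> 0"
    and K: "polynomial K" and G: "polynomial G"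
    and eq: "\<And>u. binary_form w1 w2 q n u * G u = g u * K u"
  shows "\<exists>H. polynomial H \<and> (\<forall>u. G u = g u * H u)"
  using q roots infinity K eq
proof (induction n arbitrary: q K)
  case 0
  then have "coeff q 0 \<noteq> 0" by (metis le_zero_eq leading_coeff_0_iff)
  then have "G u = g u * (K u * inverse (coeff q 0))" for u
    using 0(6)[of u] by (simp add: binary_form_def field_simps)
  moreover have "polynomial (\<lambda>u. K u * inverse (coeff q 0))"
    using 0(5) by (intro polynomial_mult polynomial_const)
  ultimately show ?case by blast
next
  case (Suc n)
  show ?case
  proof (cases "degree q \<le> n")
    case True
    have "binary_form w1 w2 q (Suc n) u = pairing u w1 * binary_form w1 w2 q n u" for u
      by (rule polynomials_equal_off_hyperplane[OF binary_form_polynomial _ w(1)])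
        (auto simp: binary_form_eq_poly True le_SucI intro!: polynomial_mult binary_form_polynomial)
    then have eq': "pairing u w1 * (binary_form w1 w2 q n u * G u) = g u * K u" for u
      using Suc.prems(6)[of u] by (simp add: mult.assoc)
    have "degree q < Suc n" using True by simp
    from Suc.prems(4)[OF this] obtain a where a: "pairing a w1 = 0" "g a \<noteq> 0" by blast
    have "polynomial (\<lambda>u. binary_form w1 w2 q n u * G u)" by (intro polynomial_mult binary_form_polynomial G)
    from cancel_linear_form[OF g Suc.prems(5) w(1) eq' a this]
    obtain H where H: "polynomial H" "\<And>u. binary_form w1 w2 q n u * G u = g u * H u" by blast
    show ?thesis
      using Suc.IH[OF Suc.prems(1) True Suc.prems(3) _ H] a by blast
  next
    case False
    then have deg: "degree q = Suc n" using Suc.prems(2) by simp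
    have "coeff q (Suc n) \<noteq> 0" using deg Suc.prems(1) by (metis leading_coeff_0_iff)
    then have "\<exists>i\<in>{1..Suc n}. coeff q i \<noteq> 0" by auto
    then obtain r where "(\<Sum>i\<le>Suc n. coeff q i * r ^ i) = 0"
      using fundamental_theorem_of_algebra[of "coeff q" "Suc n"] by metis
    then have r: "poly q r = 0" using poly_eq_sum_atMost[of q "Suc n" r] deg by simp
    then obtain q' where q': "q = [:- r, 1:] * q'" by (auto simp: poly_eq_0_iff_dvd)
    then have q'0: "q' \<noteq> 0" using Suc.prems(1) by auto
    have "degree q = Suc (degree q')"
      unfolding q' using q'0 by (subst degree_mult_eq) auto
    then have deg': "degree q' = n" using deg by simp
    have "binary_form w1 w2 q (Suc n) u = pairing u (w2 - r *s w1) * binary_form w1 w2 q' n u" for u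
    proof (rule polynomials_equal_off_hyperplane[OF binary_form_polynomial _ w(1)])
      fix u assume u: "pairing u w1 \<noteq> 0"
      have root: "poly q z = (z - r) * poly q' z" for z by (simp add: q' algebra_simps)
      then show "binary_form w1 w2 q (Suc n) u = pairing u (w2 - r *s w1) * binary_form w1 w2 q' n u"
        unfolding binary_form_eq_poly[OF eq_refl[OF deg] u] binary_form_eq_poly[OF eq_refl[OF deg'] u] root
        using u by (simp add: field_simps)
    qed (auto intro!: polynomial_mult binary_form_polynomial polynomial_diff)
    then have eq': "pairing u (w2 - r *s w1) * (binary_form w1 w2 q' n u * G u) = g u * K u" for u
      using Suc.prems(6)[of u] by (simp add: mult.assoc)
    obtain a where a: "pairing a (w2 - r *s w1) = 0" "g a \<noteq> 0" using Suc.prems(3)[OF r] by blast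
    have "polynomial (\<lambda>u. binary_form w1 w2 q' n u * G u)" by (intro polynomial_mult binary_form_polynomial G)
    from cancel_linear_form[OF g Suc.prems(5) w(2) eq' a this]
    obtain H where H: "polynomial H" "\<And>u. binary_form w1 w2 q' n u * G u = g u * H u" by blast
    show ?thesis
    proof (rule Suc.IH[OF q'0 _ _ _ H])
      show "degree q' \<le> n" using deg' by simp
      show "\<exists>a. pairing a (w2 - s *s w1) = 0 \<and> g a \<noteq> 0" if "poly q' s = 0" for s
        using Suc.prems(3)[of s] that by (simp add: q')
      show "\<exists>a. pairing a w1 = 0 \<and> g a \<noteq> 0" if "degree q' < n" using that deg' by simp
    qed
  qed
qed

section \<open>The dual curve of a curve with unique critical points\<close>

context power_on_plane_curve
begin

text \<open>In the plane of \<open>X\<close>, the tangent space has codimension one and is therefore the kernel of \<open>u\<close>.\<close>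
lemma tangent_if_annihilated:
  assumes x: "x \<in> cone_reg X" and u: "\<And>v. v \<in> tangent_space X x \<Longrightarrow> pairing u v = 0"
    and w: "w \<in> vec.span (affine_cone X)" "pairing u w = 0"
    and y: "y \<in> vec.span (affine_cone X)" "pairing u y \<noteq> 0"
  shows "w \<in> tangent_space X x"
proof (rule ccontr)
  let ?T = "tangent_space X x" and ?W = "vec.span (affine_cone X)"
  assume wT: "w \<notin> ?T"
  obtain B where B: "B \<subseteq> ?T" "vec.independent B" "?T \<subseteq> vec.span B" "card B = vec.dim ?T"
    using vec.basis_exists by metis
  have "vec.span B \<subseteq> ?T" using B(1) subspace_tangent_space vec.span_minimal by blast
  then have wB: "w \<notin> vec.span B" using wT by blast
  then have "w \<notin> B" using vec.span_base by blast
  have "finite B" using B(2) vec.finiteI_independent by blast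
  then have "card (insert w B) = 3" using B(4) x cone_reg_iff[OF X] \<open>w \<notin> B\<close> by simp
  moreover have "vec.independent (insert w B)" using wB B(2) by (rule vec.independent_insertI)
  moreover have "insert w B \<subseteq> ?W" using w(1) B(1) tangent_space_subset_span[OF X] by blast
  ultimately have "?W \<subseteq> vec.span (insert w B)"
    using vec.card_ge_dim_independent[of "insert w B" ?W] dim3 by simp
  moreover have "pairing u z = 0" if "z \<in> insert w B" for z using that w(2) u B(1) by blast
  ultimately show False using linear_form_vanishing_on_span[of "insert w B" u y] y by blast
qed

text \<open>
  The tangent lines of a plane curve have no common point: projecting from it, the curve would be
  constant.
\<close>
lemma no_common_point_of_tangents:
  assumes arc: "regular_arc X l v \<gamma> r" and w: "w \<noteq> 0"
    and tangent: "\<And>s. s \<in> ball 0 r \<Longrightarrow> w \<in> tangent_space X (\<gamma> s)"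
  shows False
proof -
  have r0: "0 \<in> ball 0 r" using regular_arcD(1)[OF arc] by simp
  have wr: "pairing a (\<gamma> s) * pairing b (v (\<gamma> s)) = pairing a (v (\<gamma> s)) * pairing b (\<gamma> s)"
    if s: "s \<in> ball 0 r" and ab: "pairing a w = 0" "pairing b w = 0" for a b s
  proof -
    obtain y z where yz: "w = y *s \<gamma> s + z *s v (\<gamma> s)"
      using tangent[OF s] regular_arc_l(5)[OF arc s] span_pair_iff by blast
    have "y \<noteq> 0 \<or> z \<noteq> 0" using yz w by auto
    moreover have "y * pairing a (\<gamma> s) + z * pairing a (v (\<gamma> s)) = 0" "y * pairing b (\<gamma> s) + z * pairing b (v (\<gamma> s)) = 0"
      using ab yz by simp_all
    ultimately show ?thesis by algebra
  qed
  have "\<exists>s\<in>ball 0 r. \<gamma> s \<notin> vec.span {w}"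
  proof (rule ccontr)
    assume "\<not> ?thesis"
    then have in_span: "\<And>s. s \<in> ball 0 r \<Longrightarrow> \<exists>c. \<gamma> s = c *s w" by (auto simp: span_singleton_iff)
    obtain c0 where c0: "\<gamma> 0 = c0 *s w" using in_span[OF r0] by blast
    have lw: "pairing l w \<noteq> 0" using c0 regular_arcD(4)[OF arc] by auto
    obtain a where a: "pairing a (v (\<gamma> 0)) = 1"
      using pairing_nonzero[OF regular_arcD(9)[OF arc r0]] by metis
    obtain s where s: "s \<in> ball 0 r" "pairing a (\<gamma> s) \<noteq> pairing a (\<gamma> 0)"
      using regular_arc_moves[OF arc, of a "pairing a (\<gamma> 0)"] a by auto
    obtain c where c: "\<gamma> s = c *s w" using in_span[OF s(1)] by blast
    have "c * pairing l w = c0 * pairing l w" using regular_arc_l(1)[OF arc s(1)] c c0 by simp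
    then show False using s(2) c c0 lw by simp
  qed
  then obtain s1 where s1: "s1 \<in> ball 0 r" "\<gamma> s1 \<notin> vec.span {w}" by blast
  obtain a where a: "\<And>z. z \<in> vec.span {w} \<Longrightarrow> pairing a z = 0" "pairing a (\<gamma> s1) = 1"
    using separating_functional[OF vec.subspace_span s1(2)] by metis
  have aw: "pairing a w = 0" using a(1) vec.span_base by blast
  obtain p where p: "pairing p w = 1" using pairing_nonzero[OF w] by metis
  have "\<exists>c. \<forall>x\<in>affine_cone X. pairing u x = (\<Sum>i\<in>(UNIV::2 set). c i * pairing (if i = 1 then p else a) x)" for u
  proof -
    define b where "b = u - pairing u w *s p"
    have bw: "pairing b w = 0" using p by (simp add: b_def)
    define c where "c = pairing b (\<gamma> s1) / pairing a (\<gamma> s1)"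
    have "pairing b (\<gamma> s) = c * pairing a (\<gamma> s)" if s: "s \<in> ball 0 r" for s
      unfolding c_def
      by (rule wronskian_zero[OF open_ball connected_ball regular_arc_derivative_pairing[OF arc]
            regular_arc_derivative_pairing[OF arc] wr[OF _ aw bw] s1(1) _ s]) (use a(2) in simp_all)
    then have on_arc: "pairing (b - c *s a) (\<gamma> s) = 0" if "s \<in> ball 0 r" for s using that by simp
    have "pairing u x = pairing u w * pairing p x + c * pairing a x" if "x \<in> affine_cone X" for x
      using regular_arc_dense[OF X arc homogeneous_pairing on_arc that] by (simp add: b_def algebra_simps)
    then show ?thesis
      by (intro exI[of _ "\<lambda>i. if i = 1 then pairing u w else c"]) (simp add: sum_2)
  qed
  then have "vec.dim (vec.span (affine_cone X)) \<le> CARD(2)" by (rule curve_span_dim_le)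
  then show False using dim3 by simp
qed

end

text \<open>
  The functionals \<open>\<beta>1 + z \<beta>2\<close> are, up to the choice of a multiple of \<open>\<alpha>\<close>, the lines of the plane through
  a point that moves on the line \<open>\<alpha> = 0\<close>. That critical points are unique means that a general such
  point lies on just one tangent line other than \<open>\<alpha> = 0\<close>; \<open>contact z\<close> is its point of contact.
\<close>
locale unique_critical_points = power_on_plane_curve +
  fixes q :: "complex ^ 'n \<Rightarrow> complex" and \<beta>1 \<beta>2 w0 w1 w2 :: "complex ^ 'n"
  assumes deg: "curve_degree X > 1"
    and q: "polynomial q" "q \<beta>1 \<noteq> 0"
    and unique: "q u \<noteq> 0 \<Longrightarrow> \<exists>!x. (x, u) \<in> crit_incidence F X"
    and w: "w0 \<in> vec.span (affine_cone X)" "w1 \<in> vec.span (affine_cone X)" "w2 \<in> vec.span (affine_cone X)"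
    and \<alpha>w: "pairing \<alpha> w0 = 1" "pairing \<alpha> w1 = 0" "pairing \<alpha> w2 = 0"
    and \<beta>1w: "pairing \<beta>1 w0 = 0" "pairing \<beta>1 w1 = 1" "pairing \<beta>1 w2 = 0"
    and \<beta>2w: "pairing \<beta>2 w0 = 0" "pairing \<beta>2 w1 = 0" "pairing \<beta>2 w2 = 1"
    and coords: "x \<in> vec.span (affine_cone X) \<Longrightarrow>
      x = pairing \<beta>1 x *s w1 + pairing \<beta>2 x *s w2 + pairing \<alpha> x *s w0"
begin

definition B :: "complex \<Rightarrow> complex ^ 'n" where "B z = \<beta>1 + z *s \<beta>2"

definition bad :: "complex set" where "bad = {z. q (B z) = 0}"

text \<open>
  The tangent line at \<open>x\<close> passes through the point where \<open>B z\<close> and \<open>\<alpha>\<close> vanish; \<open>x\<close> is normalized by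
  \<open>\<alpha>(x) = 1\<close>.
\<close>
definition touches :: "complex \<Rightarrow> complex ^ 'n \<Rightarrow> bool" where
  "touches z x \<longleftrightarrow> x \<in> cone_reg X \<and> pairing \<alpha> x = 1 \<and>
    (\<forall>v\<in>tangent_space X x. pairing \<alpha> v = 0 \<longrightarrow> pairing (B z) v = 0)"

definition contact :: "complex \<Rightarrow> complex ^ 'n" where "contact z = (THE x. touches z x)"

lemma finite_bad: "finite bad"
  unfolding bad_def B_def by (rule finite_zeros_on_line[OF q(1), where t = 0]) (use q(2) in simp)

lemma pairing_coords:
  assumes "x \<in> vec.span (affine_cone X)"
  shows "pairing u x = pairing \<beta>1 x * pairing u w1 + pairing \<beta>2 x * pairing u w2 + pairing \<alpha> x * pairing u w0"
  using arg_cong[OF coords[OF assms], of "pairing u"] by simp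

lemma tangent_in_span: "v \<in> tangent_space X x \<Longrightarrow> v \<in> vec.span (affine_cone X)"
  using tangent_space_subset_span[OF X] by blast

lemma touches_ex:
  assumes "z \<notin> bad"
  shows "\<exists>x. touches z x"
proof -
  obtain x where x: "(x, B z) \<in> crit_incidence F X" using unique[of "B z"] assms by (auto simp: bad_def)
  note nz = crit_alpha(1)[OF x]
  have c: "1 / pairing \<alpha> x \<noteq> 0" using nz by simp
  have "touches z ((1 / pairing \<alpha> x) *s x)"
    unfolding touches_def
  proof (intro conjI ballI impI)
    show "(1 / pairing \<alpha> x) *s x \<in> cone_reg X" by (rule cone_reg_scale[OF X critD(1)[OF X F(1) x] c])
    show "pairing \<alpha> ((1 / pairing \<alpha> x) *s x) = 1" using nz by simp
    fix v assume v: "v \<in> tangent_space X ((1 / pairing \<alpha> x) *s x)" "pairing \<alpha> v = 0"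
    then have "v \<in> tangent_space X x" using tangent_space_scale[OF irreducible_curveD(3)[OF X] c] by simp
    from crit_alpha(2)[OF x this] show "pairing (B z) v = 0" using v(2) nz by simp
  qed
  then show ?thesis by blast
qed

lemma touches_crit:
  assumes t: "touches z x" and nz: "pairing (B z + s *s \<alpha>) x \<noteq> 0"
  shows "((of_nat d / pairing (B z + s *s \<alpha>) x) *s x, B z + s *s \<alpha>) \<in> crit_incidence F X"
proof (rule crit_from_alpha[OF _ _ nz])
  have x: "x \<in> cone_reg X" "pairing \<alpha> x = 1" using t by (auto simp: touches_def)
  show "x \<in> cone_reg X" by (rule x)
  show "pairing \<alpha> x \<noteq> 0" using x by simp
  have xT: "x \<in> tangent_space X x"
    using radial_tangent[OF irreducible_curveD(3)[OF X]] x(1) cone_reg_iff[OF X] by blast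
  fix v assume v: "v \<in> tangent_space X x"
  have "v - pairing \<alpha> v *s x \<in> tangent_space X x"
    by (intro vec.subspace_diff vec.subspace_scale subspace_tangent_space v xT)
  moreover have "pairing \<alpha> (v - pairing \<alpha> v *s x) = 0" using x(2) by simp
  ultimately have "pairing (B z) (v - pairing \<alpha> v *s x) = 0"
    using t unfolding touches_def by blast
  then show "pairing (B z + s *s \<alpha>) v * pairing \<alpha> x = pairing \<alpha> v * pairing (B z + s *s \<alpha>) x"
    using x(2) by (simp add: algebra_simps)
qed

text \<open>
  Adding \<open>s \<alpha>\<close> to \<open>B z\<close> does not affect tangency but makes both points critical for the same functional,
  for all but finitely many \<open>s\<close>.
\<close>
lemma touches_unique:
  assumes z: "z \<notin> bad" and x: "touches z x" and y: "touches z y"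
  shows "x = y"
proof -
  have "finite ({s. q (B z + s *s \<alpha>) = 0} \<union> {- pairing (B z) x, - pairing (B z) y})"
    using finite_zeros_on_line[OF q(1), of "B z" 0 \<alpha>] z by (simp add: bad_def)
  then obtain s where s: "s \<notin> {s. q (B z + s *s \<alpha>) = 0} \<union> {- pairing (B z) x, - pairing (B z) y}"
    using ex_new_if_finite[OF infinite_UNIV_char_0] by blast
  let ?u = "B z + s *s \<alpha>"
  have ax: "pairing \<alpha> x = 1" "pairing \<alpha> y = 1" using x y by (auto simp: touches_def)
  have ne: "pairing ?u x \<noteq> 0" "pairing ?u y \<noteq> 0"
    using s ax by (auto simp: eq_neg_iff_add_eq_0 add.commute)
  have "q ?u \<noteq> 0" using s by simp
  then have eq: "(of_nat d / pairing ?u x) *s x = (of_nat d / pairing ?u y) *s y"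
    using unique touches_crit[OF x ne(1)] touches_crit[OF y ne(2)] by blast
  have "pairing \<alpha> ((of_nat d / pairing ?u x) *s x) = pairing \<alpha> ((of_nat d / pairing ?u y) *s y)"
    by (simp only: eq)
  then have c: "of_nat d / pairing ?u x = of_nat d / pairing ?u y"
    unfolding pairing_linear(8) ax mult_1_right .
  moreover have "of_nat d / pairing ?u y \<noteq> 0" using ne d_nz by simp
  ultimately show ?thesis using eq by (metis vec.scale_cancel_left)
qed

lemma contact_eq: "z \<notin> bad \<Longrightarrow> touches z x \<Longrightarrow> contact z = x"
  unfolding contact_def using touches_unique by (intro the_equality) blast+

lemma contact_touches: "z \<notin> bad \<Longrightarrow> touches z (contact z)"
  using touches_ex contact_eq by blast

lemma touches_on_arc:
  assumes arc: "regular_arc X \<alpha> v \<gamma> r" "pairing \<alpha> (\<gamma> 0) = 1" and s: "s \<in> ball 0 r"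
  shows "touches z (\<gamma> s) \<longleftrightarrow> pairing (B z) (v (\<gamma> s)) = 0"
proof
  have v: "v (\<gamma> s) \<in> tangent_space X (\<gamma> s)"
    by (rule regular_arcD(5)[OF arc(1) regular_arcD(8)[OF arc(1) s]])
  assume "touches z (\<gamma> s)"
  then show "pairing (B z) (v (\<gamma> s)) = 0" using v regular_arcD(3)[OF arc(1)] by (auto simp: touches_def)
next
  assume 0: "pairing (B z) (v (\<gamma> s)) = 0"
  show "touches z (\<gamma> s)"
    unfolding touches_def
  proof (intro conjI ballI impI)
    show "\<gamma> s \<in> cone_reg X" by (rule regular_arc_l(4)[OF arc(1) s])
    show a: "pairing \<alpha> (\<gamma> s) = 1" using regular_arc_l(1)[OF arc(1) s] arc(2) by simp
    fix y assume y: "y \<in> tangent_space X (\<gamma> s)" "pairing \<alpha> y = 0"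
    obtain b c where "y = b *s \<gamma> s + c *s v (\<gamma> s)" using y(1) regular_arc_l(5)[OF arc(1) s] span_pair_iff by blast
    moreover from this have "b = 0" using y(2) a regular_arcD(3)[OF arc(1)] by simp
    ultimately show "pairing (B z) y = 0" using 0 by simp
  qed
qed

lemma tangent_direction:
  assumes v: "v \<in> tangent_space X x" "v \<noteq> 0" "pairing \<alpha> v = 0" "pairing (B z) v = 0"
  shows "pairing \<beta>2 v \<noteq> 0"
proof
  assume "pairing \<beta>2 v = 0"
  moreover from this have "pairing \<beta>1 v = 0" using v(4) by (simp add: B_def)
  moreover have "v \<in> vec.span (affine_cone X)" using v(1) tangent_space_subset_span[OF X] by blast
  ultimately have "v = 0" using coords[of v] v(3) by simp
  with v(2) show False by blast
qed

lemma arc_at_contact: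
  assumes z: "z \<notin> bad"
  obtains v \<gamma> r where "regular_arc X \<alpha> v \<gamma> r" "\<gamma> 0 = contact z" "pairing \<alpha> (\<gamma> 0) = 1"
    "pairing (B z) (v (contact z)) = 0" "pairing \<beta>2 (v (contact z)) \<noteq> 0"
proof -
  have t: "contact z \<in> cone_reg X" "pairing \<alpha> (contact z) = 1"
    using contact_touches[OF z] by (auto simp: touches_def)
  then have "pairing \<alpha> (contact z) \<noteq> 0" by simp
  then obtain v \<gamma> r where arc: "regular_arc X \<alpha> v \<gamma> r" "\<gamma> 0 = contact z"
    using regular_arc_exists[OF X t(1)] by blast
  have r0: "0 \<in> ball 0 r" using regular_arcD(1)[OF arc(1)] by simp
  have a1: "pairing \<alpha> (\<gamma> 0) = 1" using arc(2) t(2) by simp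
  have B0: "pairing (B z) (v (contact z)) = 0"
    using touches_on_arc[OF arc(1) a1 r0] contact_touches[OF z] arc(2) by simp
  have "pairing \<beta>2 (v (contact z)) \<noteq> 0"
  proof (rule tangent_direction[OF _ _ _ B0])
    show "v (contact z) \<in> tangent_space X (contact z)"
      using regular_arcD(5)[OF arc(1)] t(1) cone_reg_iff[OF X] by blast
    show "v (contact z) \<noteq> 0" using regular_arcD(9)[OF arc(1) r0] arc(2) by simp
    show "pairing \<alpha> (v (contact z)) = 0" by (rule regular_arcD(3)[OF arc(1)])
  qed
  then show thesis using that arc a1 B0 by blast
qed

lemma contact_inj: "inj_on contact (- bad)"
proof (rule inj_onI)
  fix z z' assume z: "z \<in> - bad" and z': "z' \<in> - bad" and eq: "contact z = contact z'"
  then obtain v \<gamma> r where arc: "regular_arc X \<alpha> v \<gamma> r" "\<gamma> 0 = contact z" "pairing \<alpha> (\<gamma> 0) = 1"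
    "pairing (B z) (v (contact z)) = 0" "pairing \<beta>2 (v (contact z)) \<noteq> 0"
    using arc_at_contact[of z] by blast
  have r0: "0 \<in> ball 0 r" using regular_arcD(1)[OF arc(1)] by simp
  have "touches z' (\<gamma> 0)" using contact_touches[of z'] z' eq arc(2) by simp
  then have "pairing (B z') (v (contact z)) = 0" using touches_on_arc[OF arc(1,3) r0] arc(2) by simp
  then have "(z - z') * pairing \<beta>2 (v (contact z)) = 0"
    using arc(4) unfolding B_def pairing_linear by algebra
  then show "z = z'" using arc(5) by simp
qed

text \<open>
  On an arc through a point of contact, the parameter \<open>z = \<zeta> s\<close> of the tangent line is holomorphic in
  \<open>s\<close>. It is injective by uniqueness of the point of contact, so that it has a holomorphic inverse.
\<close>
lemma contact_holomorphic: "(\<lambda>z. pairing b (contact z)) holomorphic_on - bad"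
proof -
  have "(\<lambda>z. pairing b (contact z)) field_differentiable at z0" if z0: "z0 \<notin> bad" for z0
  proof -
    obtain v \<gamma> r1 where arc1: "regular_arc X \<alpha> v \<gamma> r1" "\<gamma> 0 = contact z0" "pairing \<alpha> (\<gamma> 0) = 1"
      "pairing (B z0) (v (contact z0)) = 0" "pairing \<beta>2 (v (contact z0)) \<noteq> 0"
      using arc_at_contact[OF z0] by blast
    have polv: "polynomial (\<lambda>x. pairing w (v x))" for w
      using regular_arcD(2)[OF arc1(1)] by (intro polynomial_pairing_maps) auto
    obtain r2 where arc2: "regular_arc X \<alpha> v \<gamma> r2" and nz: "\<And>s. s \<in> ball 0 r2 \<Longrightarrow> pairing \<beta>2 (v (\<gamma> s)) \<noteq> 0"
      using regular_arc_neighbourhood[OF arc1(1) polv[of \<beta>2]] arc1(2,5) by auto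
    define \<zeta> where "\<zeta> s = - pairing \<beta>1 (v (\<gamma> s)) / pairing \<beta>2 (v (\<gamma> s))" for s
    have \<zeta>_hol: "\<zeta> holomorphic_on ball 0 r2"
      unfolding \<zeta>_def[abs_def] by (intro holomorphic_intros regular_arc_holomorphic[OF arc2 polv] nz)
    have r20: "0 \<in> ball 0 r2" using regular_arcD(1)[OF arc2] by simp
    have B_iff: "pairing (B z) (v (\<gamma> s)) = 0 \<longleftrightarrow> z = \<zeta> s" if s: "s \<in> ball 0 r2" for z s
      using nz[OF s] by (auto simp: B_def \<zeta>_def field_simps eq_neg_iff_add_eq_0)
    have \<zeta>0: "\<zeta> 0 = z0" using B_iff[OF r20, of z0] arc1(2,4) by simp
    have "open (- bad)" using finite_bad by (simp add: finite_imp_closed open_Compl)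
    then have "open (ball 0 r2 \<inter> \<zeta> -` (- bad))"
      by (rule continuous_open_preimage[OF holomorphic_on_imp_continuous_on[OF \<zeta>_hol] open_ball])
    moreover have "0 \<in> ball 0 r2 \<inter> \<zeta> -` (- bad)" using r20 \<zeta>0 z0 by simp
    ultimately obtain e where e: "e > 0" "ball 0 e \<subseteq> ball 0 r2 \<inter> \<zeta> -` (- bad)"
      by (metis openE)
    have contact_\<zeta>: "contact (\<zeta> s) = \<gamma> s" if s: "s \<in> ball 0 e" for s
    proof -
      have "s \<in> ball 0 r2" "\<zeta> s \<notin> bad" using e(2) s by auto
      then show ?thesis
        using contact_eq[of "\<zeta> s" "\<gamma> s"] touches_on_arc[OF arc2 arc1(3)] B_iff by simp
    qed
    have f_hol: "(\<lambda>s. pairing \<beta>2 (\<gamma> s)) holomorphic_on ball 0 e"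
      using holomorphic_on_subset[OF regular_arc_holomorphic[OF arc2 polynomial_pairing(1)]] e(2) by blast
    have "deriv (\<lambda>s. pairing \<beta>2 (\<gamma> s)) 0 = pairing \<beta>2 (v (\<gamma> 0))"
      by (rule DERIV_imp_deriv[OF regular_arc_derivative_pairing[OF arc2 r20]])
    then have d0: "deriv (\<lambda>s. pairing \<beta>2 (\<gamma> s)) 0 \<noteq> 0" using nz[OF r20] by simp
    have e0: "0 \<in> ball 0 e" using e(1) by simp
    obtain r where r: "r > 0" "ball 0 r \<subseteq> ball (0::complex) e" "inj_on (\<lambda>s. pairing \<beta>2 (\<gamma> s)) (ball 0 r)"
      by (rule has_complex_derivative_locally_injective[OF f_hol e0 open_ball d0]) (rule that)
    have \<zeta>_inj: "inj_on \<zeta> (ball 0 r)"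
    proof (rule inj_onI)
      fix s t assume st: "s \<in> ball 0 r" "t \<in> ball 0 r" "\<zeta> s = \<zeta> t"
      then have "s \<in> ball 0 e" "t \<in> ball 0 e" using r(2) by blast+
      then have "\<gamma> s = \<gamma> t" using contact_\<zeta> st(3) by metis
      then show "s = t" using inj_onD[OF r(3) _ st(1,2)] by simp
    qed
    have \<zeta>_hol': "\<zeta> holomorphic_on ball 0 r"
      by (rule holomorphic_on_subset[OF \<zeta>_hol]) (rule subset_trans[OF r(2) subset_trans[OF e(2) Int_lower1]])
    obtain g where g: "g holomorphic_on \<zeta> ` ball 0 r" "\<And>s. s \<in> ball 0 r \<Longrightarrow> g (\<zeta> s) = s"
      by (rule holomorphic_has_inverse[OF \<zeta>_hol' open_ball \<zeta>_inj]) (rule that)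
    have open_image: "open (\<zeta> ` ball 0 r)" by (rule open_mapping_thm3[OF \<zeta>_hol' open_ball \<zeta>_inj])
    have "((\<lambda>s. pairing b (\<gamma> s)) \<circ> g) holomorphic_on \<zeta> ` ball 0 r"
    proof (rule holomorphic_on_compose_gen[OF g(1) regular_arc_holomorphic[OF arc2 polynomial_pairing(1)]])
      show "g ` \<zeta> ` ball 0 r \<subseteq> ball 0 r2"
      proof clarify
        fix s assume s: "s \<in> ball (0::complex) r"
        then have "s \<in> ball 0 r2" using r(2) e(2) by blast
        then show "g (\<zeta> s) \<in> ball 0 r2" using g(2)[OF s] by simp
      qed
    qed
    then have "(\<lambda>z. pairing b (contact z)) holomorphic_on \<zeta> ` ball 0 r"
    proof (rule holomorphic_transform)
      fix z assume "z \<in> \<zeta> ` ball 0 r"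
      then obtain s where s: "s \<in> ball 0 r" "z = \<zeta> s" by blast
      then have "s \<in> ball 0 e" using r(2) by blast
      then show "((\<lambda>s. pairing b (\<gamma> s)) \<circ> g) z = pairing b (contact z)"
        using contact_\<zeta>[of s] g(2)[OF s(1)] s(2) by simp
    qed
    moreover have "z0 \<in> \<zeta> ` ball 0 r" using \<zeta>0 r(1) by (metis centre_in_ball image_eqI)
    ultimately show ?thesis using holomorphic_on_imp_differentiable_at[OF _ open_image] by blast
  qed
  then show ?thesis by (simp add: holomorphic_on_def field_differentiable_at_within)
qed

text \<open>
  The points of the plane with given values of \<open>\<alpha>\<close> and of \<open>b\<close> form a line, which meets the curve in finitely
  many points.
\<close>
lemma contact_fibre:
  assumes b: "b = \<beta>1 \<and> y = w1 \<and> y' = w2 \<or> b = \<beta>2 \<and> y = w2 \<and> y' = w1"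
  shows "finite {z \<in> - bad. pairing b (contact z) = c}"
proof -
  let ?p = "c *s y + w0" and ?b' = "if b = \<beta>1 then \<beta>2 else \<beta>1"
  have "\<beta>1 \<noteq> \<beta>2" using \<beta>1w(2) \<beta>2w(2) by auto
  then have b': "b = \<beta>1 \<and> y = w1 \<and> y' = w2 \<and> ?b' = \<beta>2 \<or> b = \<beta>2 \<and> y = w2 \<and> y' = w1 \<and> ?b' = \<beta>1"
    using b by auto
  have p: "?p \<noteq> 0" using \<alpha>w b by (metis add.right_neutral mult_zero_right pairing_linear(10) pairing_linear(2) pairing_linear(8) add_0 zero_neq_one)
  have y': "y' \<notin> vec.span {?p}"
  proof
    assume "y' \<in> vec.span {?p}"
    then obtain k where k: "y' = k *s ?p" using span_singleton_iff by blast
    have "pairing \<alpha> y' = k * pairing \<alpha> ?p" unfolding k by (rule pairing_linear(8))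
    then have "k = 0" using \<alpha>w b by auto
    then have "y' = 0" using k by simp
    then show False using b \<beta>1w \<beta>2w by auto
  qed
  have fin: "finite {t. ?p + t *s y' \<in> affine_cone X}" by (rule finite_line_curve[OF X deg p y'])
  have "contact ` {z \<in> - bad. pairing b (contact z) = c} \<subseteq> (\<lambda>t. ?p + t *s y') ` {t. ?p + t *s y' \<in> affine_cone X}"
  proof safe
    fix z assume z: "z \<notin> bad" and c: "c = pairing b (contact z)"
    have t: "contact z \<in> affine_cone X" "pairing \<alpha> (contact z) = 1"
      using contact_touches[OF z] cone_reg_iff[OF X] by (auto simp: touches_def)
    have "contact z = pairing \<beta>1 (contact z) *s w1 + pairing \<beta>2 (contact z) *s w2 + w0"
      using coords[of "contact z"] t vec.span_base by fastforce
    then have "contact z = pairing b (contact z) *s y + w0 + pairing ?b' (contact z) *s y'"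
      using b' by (auto simp: add_ac)
    then show "contact z \<in> (\<lambda>t. pairing b (contact z) *s y + w0 + t *s y') `
        {t. pairing b (contact z) *s y + w0 + t *s y' \<in> affine_cone X}"
      using t(1) by (intro image_eqI[of _ _ "pairing ?b' (contact z)"]) auto
  qed
  then have "finite (contact ` {z \<in> - bad. pairing b (contact z) = c})"
    using fin finite_subset finite_imageI by blast
  then show ?thesis
    by (rule finite_imageD) (rule inj_on_subset[OF contact_inj], blast)
qed

text \<open>The tangent line at \<open>contact z\<close> is \<open>\<beta>1 + z \<beta>2 + offset z \<alpha>\<close>.\<close>
definition offset :: "complex \<Rightarrow> complex" where "offset z = - pairing (B z) (contact z)"

text \<open>A representation whose denominator has minimal degree is in lowest terms.\<close>
lemma offset_rational:
  obtains P Q S where "Q \<noteq> 0" "finite S" "bad \<subseteq> S" "\<And>z. z \<notin> S \<Longrightarrow> offset z * poly Q z = - poly P z"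
    "\<And>r. poly P r = 0 \<Longrightarrow> poly Q r \<noteq> 0"
proof -
  have fibre: "finite {z \<in> - bad. pairing \<beta>1 (contact z) = c}" "finite {z \<in> - bad. pairing \<beta>2 (contact z) = c}" for c
    by (rule contact_fibre[of \<beta>1 w1 w2], simp) (rule contact_fibre[of \<beta>2 w2 w1], simp)
  obtain P1 Q1 where 1: "Q1 \<noteq> 0" "\<And>z. z \<notin> bad \<Longrightarrow> pairing \<beta>1 (contact z) * poly Q1 z = poly P1 z"
    by (rule rational_if_finite_fibres[OF finite_bad contact_holomorphic fibre(1)]) (rule that)
  obtain P2 Q2 where 2: "Q2 \<noteq> 0" "\<And>z. z \<notin> bad \<Longrightarrow> pairing \<beta>2 (contact z) * poly Q2 z = poly P2 z"
    by (rule rational_if_finite_fibres[OF finite_bad contact_holomorphic fibre(2)]) (rule that)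
  define R where "R P Q \<longleftrightarrow> Q \<noteq> 0 \<and> (\<exists>S. finite S \<and> bad \<subseteq> S \<and> (\<forall>z. z \<notin> S \<longrightarrow> offset z * poly Q z = - poly P z))" for P Q
  have "R (P1 * Q2 + [:0, 1:] * P2 * Q1) (Q1 * Q2)"
  proof -
    have "offset z * poly (Q1 * Q2) z = - poly (P1 * Q2 + [:0, 1:] * P2 * Q1) z" if "z \<notin> bad" for z
      unfolding offset_def B_def using 1(2)[OF that, symmetric] 2(2)[OF that, symmetric] by (simp add: algebra_simps)
    then show ?thesis unfolding R_def using 1(1) 2(1) finite_bad by auto
  qed
  then have "\<exists>k. \<exists>P Q. R P Q \<and> degree Q = k" by blast
  then obtain k where k: "\<exists>P Q. R P Q \<and> degree Q = k" "\<And>j. j < k \<Longrightarrow> \<not> (\<exists>P Q. R P Q \<and> degree Q = j)"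
    using exists_least_iff[of "\<lambda>k. \<exists>P Q. R P Q \<and> degree Q = k"] by blast
  then obtain P Q where PQ: "R P Q" "degree Q = k" by blast
  obtain S where S: "Q \<noteq> 0" "finite S" "bad \<subseteq> S" "\<And>z. z \<notin> S \<Longrightarrow> offset z * poly Q z = - poly P z"
    using PQ(1) unfolding R_def by blast
  have "poly Q r \<noteq> 0" if Pr: "poly P r = 0" for r
  proof
    assume "poly Q r = 0"
    then obtain Q' where Q': "Q = [:- r, 1:] * Q'" by (auto simp: poly_eq_0_iff_dvd)
    obtain P' where P': "P = [:- r, 1:] * P'" using Pr by (auto simp: poly_eq_0_iff_dvd)
    have Q'0: "Q' \<noteq> 0" using S(1) Q' by auto
    have "offset z * poly Q' z = - poly P' z" if "z \<notin> insert r S" for z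
    proof -
      have "poly Q z = (z - r) * poly Q' z" "poly P z = (z - r) * poly P' z"
        by (simp_all add: Q' P' algebra_simps)
      then have "(z - r) * (offset z * poly Q' z) = (z - r) * (- poly P' z)"
        using S(4)[of z] that by (metis insertCI mult.left_commute mult_minus_right)
      then show ?thesis using that by (metis insertI1 mult_cancel_left right_minus_eq)
    qed
    then have "R P' Q'" unfolding R_def using Q'0 S(2,3) by (intro conjI exI[of _ "insert r S"]) auto
    moreover have "degree Q' < k"
      using PQ(2) unfolding Q' using Q'0 by (subst (asm) degree_mult_eq) auto
    ultimately show False using k(2) by blast
  qed
  then show thesis using that S by blast
qed

end

text \<open>
  The fraction \<open>- P / Q\<close> in lowest terms. Its denominator and numerator, made homogeneous in the
  coordinates \<open>u(w1)\<close> and \<open>u(w2)\<close>, are the coefficients of the equation \<open>g\<close> of the dual curve.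
\<close>
locale offset_fraction = unique_critical_points +
  fixes P Q :: "complex poly" and S :: "complex set"
  assumes Q_nz: "Q \<noteq> 0" and S: "finite S" "bad \<subseteq> S"
    and offset: "z \<notin> S \<Longrightarrow> offset z * poly Q z = - poly P z"
    and reduced: "poly P r = 0 \<Longrightarrow> poly Q r \<noteq> 0"
begin

definition e :: nat where "e = max (degree P) (degree Q + 1)"

definition b where "b = binary_form w1 w2 Q (e - 1)"

definition g where
  "g u = binary_form w1 w2 P e u + pairing u w0 * b u"

lemma e: "e > 0" "degree P \<le> e" "degree Q \<le> e - 1" by (auto simp: e_def)

lemma w1nz: "w1 \<noteq> 0" using \<beta>1w by auto

lemma w2nz: "w2 - r *s w1 \<noteq> 0"
proof
  assume "w2 - r *s w1 = 0"
  then have "pairing \<beta>2 (w2 - r *s w1) = 0" by (simp only: pairing_linear)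
  then show False using \<beta>2w by simp
qed

lemma b_poly: "polynomial b" unfolding b_def by (rule binary_form_polynomial)

lemma g_poly: "polynomial g"
  unfolding g_def[abs_def] by (intro polynomial_add polynomial_mult b_poly binary_form_polynomial) simp

lemma g_hom: "homogeneous e g"
  unfolding homogeneous_iff
proof (intro conjI allI g_poly)
  fix c :: complex and u
  have "c * c ^ (e - 1) = c ^ e" using e(1) by (simp flip: power_Suc)
  moreover have "g (c *s u) = c ^ e * binary_form w1 w2 P e u + (c * c ^ (e - 1)) * (pairing u w0 * b u)"
    unfolding g_def b_def pairing_linear homogeneousD[OF binary_form_homogeneous] by (simp only: mult_ac)
  ultimately show "g (c *s u) = c ^ e * g u" by (simp add: g_def distrib_left)
qed

lemma g_line: "g (u + s *s \<alpha>) = g u + s * b u"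
  using \<alpha>w by (simp add: g_def b_def binary_form_shift algebra_simps)

lemma g_eq:
  assumes u: "pairing u w1 \<noteq> 0" and z: "z = pairing u w2 / pairing u w1"
  shows "g u = pairing u w1 ^ (e - 1) * (pairing u w1 * poly P z + pairing u w0 * poly Q z)"
    "b u = pairing u w1 ^ (e - 1) * poly Q z"
proof -
  have "pairing u w1 ^ e = pairing u w1 ^ (e - 1) * pairing u w1" using e(1) by (rule power_minus_mult[symmetric])
  then show "g u = pairing u w1 ^ (e - 1) * (pairing u w1 * poly P z + pairing u w0 * poly Q z)"
    "b u = pairing u w1 ^ (e - 1) * poly Q z"
    unfolding g_def b_def binary_form_eq_poly[OF e(2) u] binary_form_eq_poly[OF e(3) u] z
    by (simp_all only: distrib_left mult_ac)
qed

lemma g_zero: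
  assumes "pairing u w0 = 0" "pairing u w1 = 0" "pairing u w2 = 0"
  shows "g u = 0"
proof -
  have "binary_form w1 w2 P e u = 0"
    unfolding binary_form_def using assms e(1) by (intro sum.neutral) (auto simp: power_0_left)
  then show ?thesis using assms by (simp add: g_def)
qed

text \<open>General tangent lines are multiples of \<open>\<beta>1 + z \<beta>2 + offset z \<alpha>\<close>, on which \<open>g\<close> vanishes by construction.\<close>
lemma g_general:
  assumes x: "x \<in> cone_reg X" "pairing \<alpha> x \<noteq> 0" and u: "\<And>v. v \<in> tangent_space X x \<Longrightarrow> pairing u v = 0"
    and y: "pairing u w1 \<noteq> 0" "pairing u w2 / pairing u w1 \<notin> S"
  shows "g u = 0"
proof -
  define z where "z = pairing u w2 / pairing u w1"
  have zS: "z \<notin> S" "z \<notin> bad" using y(2) S(2) by (auto simp: z_def)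
  have uz: "pairing u w2 = z * pairing u w1" using y(1) by (simp add: z_def)
  let ?x = "(1 / pairing \<alpha> x) *s x"
  have c: "1 / pairing \<alpha> x \<noteq> 0" using x(2) by simp
  have T: "tangent_space X ?x = tangent_space X x" by (rule tangent_space_scale[OF irreducible_curveD(3)[OF X] c])
  have "touches z ?x"
    unfolding touches_def T
  proof (intro conjI ballI impI)
    show "?x \<in> cone_reg X" by (rule cone_reg_scale[OF X x(1) c])
    show "pairing \<alpha> ?x = 1" using x(2) by simp
    fix v assume v: "v \<in> tangent_space X x" "pairing \<alpha> v = 0"
    have "pairing u w1 * pairing (B z) v = 0"
      using pairing_coords[OF tangent_in_span[OF v(1)], of u] u[OF v(1)] v(2) uz by (simp add: B_def algebra_simps)
    then show "pairing (B z) v = 0" using y(1) by simp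
  qed
  then have contact: "contact z = ?x" by (rule contact_eq[OF zS(2)])
  have xC: "?x \<in> affine_cone X" using cone_reg_scale[OF X x(1) c] cone_reg_iff[OF X] by blast
  have "pairing u ?x = 0" using u radial_tangent[OF irreducible_curveD(3)[OF X] xC] unfolding T by blast
  moreover have "pairing \<alpha> ?x = 1" using x(2) by simp
  moreover have "pairing u ?x = pairing \<beta>1 ?x * pairing u w1 + pairing \<beta>2 ?x * pairing u w2 + pairing \<alpha> ?x * pairing u w0"
    by (rule pairing_coords[OF vec.span_base[OF xC]])
  moreover have "pairing (B z) ?x = pairing \<beta>1 ?x + z * pairing \<beta>2 ?x" by (simp only: B_def pairing_linear(1,7))
  ultimately have "pairing u w0 = - pairing u w1 * pairing (B z) ?x"
    using uz by algebra
  then have "pairing u w0 = pairing u w1 * offset z" by (simp add: offset_def contact)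
  then have "pairing u w1 * poly P z + pairing u w0 * poly Q z = pairing u w1 * (poly P z + offset z * poly Q z)"
    by (simp add: algebra_simps)
  then show ?thesis unfolding g_eq(1)[OF y(1) z_def] using offset[OF zS(1)] by simp
qed

text \<open>
  A tangent line is carried along an arc through its point of contact. The lines of the arc are
  general, so that \<open>g\<close> vanishes on them, unless all pass through one of finitely many points, which \<open>no_common_point_of_tangents\<close> excludes.
\<close>
lemma g_tangent:
  assumes u: "u \<in> tangent_covectors X"
  shows "g u = 0"
proof (rule ccontr)
  assume gu: "g u \<noteq> 0"
  obtain x0 where x0: "x0 \<in> cone_reg X" "x0 \<noteq> 0" "\<And>v. v \<in> tangent_space X x0 \<Longrightarrow> pairing u v = 0"
    using u by (auto simp: tangent_covectors_def)
  obtain l v \<gamma> r U where U: "regular_arc X l v \<gamma> r" "\<gamma> 0 = x0" "U 0 = u"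
    "\<And>i. (\<lambda>s. U s $ i) holomorphic_on ball 0 r"
    "\<And>s w. s \<in> ball 0 r \<Longrightarrow> w \<in> tangent_space X (\<gamma> s) \<Longrightarrow> pairing (U s) w = 0"
    using tangent_covector_arc[OF X x0] by blast
  have r0: "0 \<in> ball 0 r" using regular_arcD(1)[OF U(1)] by simp
  have hol: "(\<lambda>s. pairing (U s) y) holomorphic_on ball 0 r" "(\<lambda>s. g (U s)) holomorphic_on ball 0 r"
    "(\<lambda>s. pairing \<alpha> (\<gamma> s)) holomorphic_on ball 0 r" for y
    by (rule holomorphic_on_polynomial[OF _ U(4)], simp) (rule holomorphic_on_polynomial[OF g_poly U(4)],
        rule regular_arc_holomorphic[OF U(1)], simp)
  have no_fixed: False if y: "y \<in> vec.span (affine_cone X)" "y \<noteq> 0" "\<forall>s\<in>ball 0 r. pairing (U s) y = 0" for y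
  proof -
    have "open (ball 0 r \<inter> (\<lambda>s. g (U s)) -` (- {0}))"
      by (rule continuous_open_preimage[OF holomorphic_on_imp_continuous_on[OF hol(2)] open_ball]) auto
    moreover have "0 \<in> ball 0 r \<inter> (\<lambda>s. g (U s)) -` (- {0})" using r0 U(3) gu by simp
    ultimately obtain e where e: "e > 0" "ball 0 e \<subseteq> ball 0 r \<inter> (\<lambda>s. g (U s)) -` (- {0})" by (metis openE)
    have arc: "regular_arc X l v \<gamma> (min e r)"
      using regular_arc_shrink[OF U(1), of "min e r"] e(1) regular_arcD(1)[OF U(1)] by simp
    show False
    proof (rule no_common_point_of_tangents[OF arc y(2)])
      fix s :: complex assume "s \<in> ball 0 (min e r)"
      then have s: "s \<in> ball 0 r" "g (U s) \<noteq> 0" using e(2) by auto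
      then have "\<exists>t\<in>{w0, w1, w2}. pairing (U s) t \<noteq> 0" using g_zero by blast
      then obtain t where t: "t \<in> vec.span (affine_cone X)" "pairing (U s) t \<noteq> 0" using w by blast
      show "y \<in> tangent_space X (\<gamma> s)"
        by (rule tangent_if_annihilated[OF regular_arc_l(4)[OF U(1) s(1)] U(5)[OF s(1)] y(1) bspec[OF y(3) s(1)] t])
    qed
  qed
  have product: "pairing \<alpha> (\<gamma> s) * (pairing (U s) w1 * ((\<Prod>c\<in>S. pairing (U s) (w2 - c *s w1)) * g (U s))) = 0"
    if s: "s \<in> ball 0 r" for s
  proof (rule ccontr)
    assume "\<not> ?thesis"
    then have ne: "pairing \<alpha> (\<gamma> s) \<noteq> 0" "pairing (U s) w1 \<noteq> 0" "(\<Prod>c\<in>S. pairing (U s) (w2 - c *s w1)) \<noteq> 0" "g (U s) \<noteq> 0"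
      by auto
    have "pairing (U s) w2 / pairing (U s) w1 \<notin> S"
    proof
      assume "pairing (U s) w2 / pairing (U s) w1 \<in> S"
      moreover have "pairing (U s) (w2 - (pairing (U s) w2 / pairing (U s) w1) *s w1) = 0" using ne(2) by simp
      ultimately show False using ne(3) S(1) by (metis prod_zero)
    qed
    then show False using g_general[OF regular_arc_l(4)[OF U(1) s] ne(1) U(5)[OF s] ne(2)] ne(4) by blast
  qed
  note split = holomorphic_mult_zero[OF open_ball connected_ball]
  have hprod: "(\<lambda>s. \<Prod>c\<in>S. pairing (U s) (w2 - c *s w1)) holomorphic_on ball 0 r"
    by (intro holomorphic_on_prod hol(1))
  have h3: "(\<lambda>s. (\<Prod>c\<in>S. pairing (U s) (w2 - c *s w1)) * g (U s)) holomorphic_on ball 0 r"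
    by (rule holomorphic_on_mult[OF hprod hol(2)])
  have h2: "(\<lambda>s. pairing (U s) w1 * ((\<Prod>c\<in>S. pairing (U s) (w2 - c *s w1)) * g (U s))) holomorphic_on ball 0 r"
    by (rule holomorphic_on_mult[OF hol(1) h3])
  consider "\<forall>s\<in>ball 0 r. pairing \<alpha> (\<gamma> s) = 0" | "\<forall>s\<in>ball 0 r. pairing (U s) w1 = 0"
    | "\<forall>s\<in>ball 0 r. (\<Prod>c\<in>S. pairing (U s) (w2 - c *s w1)) = 0" | "\<forall>s\<in>ball 0 r. g (U s) = 0"
  proof -
    have "(\<forall>s\<in>ball 0 r. pairing \<alpha> (\<gamma> s) = 0) \<or>
        (\<forall>s\<in>ball 0 r. pairing (U s) w1 * ((\<Prod>c\<in>S. pairing (U s) (w2 - c *s w1)) * g (U s)) = 0)"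
      by (rule split[OF hol(3) h2 product])
    moreover have "(\<forall>s\<in>ball 0 r. pairing (U s) w1 = 0) \<or>
        (\<forall>s\<in>ball 0 r. (\<Prod>c\<in>S. pairing (U s) (w2 - c *s w1)) * g (U s) = 0)"
      if "\<forall>s\<in>ball 0 r. pairing (U s) w1 * ((\<Prod>c\<in>S. pairing (U s) (w2 - c *s w1)) * g (U s)) = 0"
      by (rule split[OF hol(1) h3]) (use that in blast)
    moreover have "(\<forall>s\<in>ball 0 r. (\<Prod>c\<in>S. pairing (U s) (w2 - c *s w1)) = 0) \<or> (\<forall>s\<in>ball 0 r. g (U s) = 0)"
      if "\<forall>s\<in>ball 0 r. (\<Prod>c\<in>S. pairing (U s) (w2 - c *s w1)) * g (U s) = 0"
      by (rule split[OF hprod hol(2)]) (use that in blast)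
    ultimately show thesis using that by blast
  qed
  then show False
  proof cases
    case 1
    obtain y where y: "y \<in> affine_cone X" "pairing \<alpha> y \<noteq> 0" using \<alpha>_nz by blast
    then show False using regular_arc_dense[OF X U(1) homogeneous_pairing _ y(1), of \<alpha>] 1 by blast
  next
    case 2
    then show False by (rule no_fixed[OF w(2) w1nz])
  next
    case 3
    have "\<exists>c\<in>S. \<forall>s\<in>ball 0 r. pairing (U s) (w2 - c *s w1) = 0"
      by (rule holomorphic_prod_zero[OF open_ball connected_ball S(1) hol(1)]) (use 3 r0 in blast)+
    then obtain c where c: "\<forall>s\<in>ball 0 r. pairing (U s) (w2 - c *s w1) = 0" by blast
    have "w2 - c *s w1 \<in> vec.span (affine_cone X)" by (intro vec.span_diff vec.span_scale w)
    then show False using no_fixed[OF _ w2nz c] by blast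
  next
    case 4
    then show False using gu U(3) r0 by blast
  qed
qed

lemma general_zero_tangent:
  assumes g0: "g u = 0" and u: "pairing u w1 \<noteq> 0" "pairing u w2 / pairing u w1 \<notin> S" "b u \<noteq> 0"
  shows "u \<in> tangent_covectors X"
proof -
  define z where "z = pairing u w2 / pairing u w1"
  have zS: "z \<notin> S" "z \<notin> bad" using u(2) S(2) by (auto simp: z_def)
  have uz: "pairing u w2 = z * pairing u w1" using u(1) by (simp add: z_def)
  have Qz: "poly Q z \<noteq> 0" using u(3) g_eq(2)[OF u(1) z_def] by auto
  have "pairing u w1 * poly P z + pairing u w0 * poly Q z = 0"
    using g0 g_eq(1)[OF u(1) z_def] u(1) by simp
  moreover have "poly P z = - (offset z * poly Q z)" using offset[OF zS(1)] by simp
  ultimately have "poly Q z * (pairing u w0 - pairing u w1 * offset z) = 0" by (simp add: algebra_simps)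
  then have u0: "pairing u w0 = pairing u w1 * offset z" using Qz by simp
  let ?x = "contact z"
  have t: "?x \<in> cone_reg X" "pairing \<alpha> ?x = 1" using contact_touches[OF zS(2)] by (auto simp: touches_def)
  have xC: "?x \<in> affine_cone X" using t(1) cone_reg_iff[OF X] by blast
  have xT: "?x \<in> tangent_space X ?x" by (rule radial_tangent[OF irreducible_curveD(3)[OF X] xC])
  have "pairing u v = 0" if v: "v \<in> tangent_space X ?x" for v
  proof -
    have "v - pairing \<alpha> v *s ?x \<in> tangent_space X ?x"
      by (intro vec.subspace_diff vec.subspace_scale subspace_tangent_space v xT)
    moreover have "pairing \<alpha> (v - pairing \<alpha> v *s ?x) = 0" using t(2) by simp
    ultimately have "pairing (B z) (v - pairing \<alpha> v *s ?x) = 0"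
      using contact_touches[OF zS(2)] unfolding touches_def by blast
    then have Bv: "pairing (B z) v = - pairing \<alpha> v * offset z" by (simp add: offset_def)
    have "pairing u v = pairing u w1 * (pairing (B z) v + pairing \<alpha> v * offset z)"
      unfolding pairing_coords[OF tangent_in_span[OF v], of u] by (simp add: u0 uz B_def algebra_simps)
    then show ?thesis using Bv by simp
  qed
  moreover have "?x \<noteq> 0" using t(2) by auto
  ultimately show ?thesis using t(1) by (auto simp: tangent_covectors_def)
qed

lemma shifted_tangent:
  assumes u: "pairing u w1 \<noteq> 0" "pairing u w2 / pairing u w1 \<notin> S" "b u \<noteq> 0"
  shows "u + (- g u / b u) *s \<alpha> \<in> tangent_covectors X"
proof -
  let ?u = "u + (- g u / b u) *s \<alpha>"
  have "g ?u = g u + (- g u / b u) * b u" by (rule g_line)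
  then have "g ?u = 0" using u(3) by simp
  moreover have "pairing ?u w1 = pairing u w1" "pairing ?u w2 = pairing u w2" using \<alpha>w by simp_all
  moreover have "b ?u = b u" unfolding b_def using \<alpha>w by (intro binary_form_shift)
  ultimately show ?thesis using u by (intro general_zero_tangent) (simp_all only: not_False_eq_True)
qed

lemma general_point:
  obtains z where "z \<notin> S" "b (B z) \<noteq> 0" "pairing (B z) w1 = 1" "pairing (B z) w2 = z"
proof -
  have "finite (S \<union> {z. poly Q z = 0})" using S(1) poly_roots_finite[OF Q_nz] by simp
  then obtain z where z: "z \<notin> S" "poly Q z \<noteq> 0" using ex_new_if_finite[OF infinite_UNIV_char_0] by blast
  have Bw: "pairing (B z) w1 = 1" "pairing (B z) w2 = z" using \<beta>1w \<beta>2w by (simp_all add: B_def)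
  have "b (B z) \<noteq> 0" using g_eq(2)[of "B z" z] Bw z(2) by simp
  then show thesis using that z(1) Bw by blast
qed

lemma b_ex: "\<exists>u. b u \<noteq> 0"
  using general_point by blast

text \<open>
  Substituting the zero \<open>- g / b\<close> of \<open>t \<mapsto> g (u + t \<alpha>)\<close> into \<open>t \<mapsto> G (u + t \<alpha>)\<close> and clearing denominators
  shows that \<open>g\<close> divides \<open>b\<^sup>N G\<close>. The factors of \<open>b\<close> can be cancelled, because \<open>P\<close> and \<open>Q\<close> have no
  common root.
\<close>
lemma equation_divides:
  assumes G: "polynomial G" "\<And>u. u \<in> tangent_covectors X \<Longrightarrow> G u = 0"
  shows "\<exists>H. polynomial H \<and> G = (\<lambda>u. g u * H u)"
proof -
  obtain p N where p: "\<And>j. polynomial (\<lambda>x. coeff (p x) j)" "\<And>x. degree (p x) \<le> N"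
    "\<And>x t. poly (p x) t = G (x + t *s \<alpha>)"
    by (rule polynomial_on_lines[OF G(1), of "\<lambda>x. x" "\<lambda>_. \<alpha>"]) auto
  define K where "K u = - (\<Sum>j<N. coeff (p u) (Suc j) * ((- 1) ^ Suc j * g u ^ j * b u ^ (N - Suc j)))" for u
  have K_poly: "polynomial K"
    unfolding K_def[abs_def]
    by (intro polynomial_minus polynomial_sum polynomial_mult polynomial_power p(1) g_poly b_poly polynomial_const)
  have bNG: "b u ^ N * G u = g u * K u" if u: "pairing u w1 \<noteq> 0" "pairing u w2 / pairing u w1 \<notin> S" "b u \<noteq> 0" for u
  proof -
    let ?t = "- g u / b u"
    have "u + ?t *s \<alpha> \<in> tangent_covectors X" by (rule shifted_tangent[OF u])
    then have "poly (p u) ?t = 0" using G(2) p(3) by simp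
    then have "0 = (\<Sum>j\<le>N. coeff (p u) j * ?t ^ j)" using poly_eq_sum_atMost[OF p(2)] by simp
    then have "0 = b u ^ N * (\<Sum>j\<le>N. coeff (p u) j * ?t ^ j)" by simp
    also have "\<dots> = (\<Sum>j\<le>N. coeff (p u) j * ((- 1) ^ j * g u ^ j * b u ^ (N - j)))"
      unfolding sum_distrib_left
    proof (rule sum.cong)
      fix j assume "j \<in> {..N}"
      then have "b u ^ N = b u ^ (N - j) * b u ^ j" by (simp flip: power_add)
      moreover have "?t ^ j * b u ^ j = (- 1) ^ j * g u ^ j"
        using u(3) by (simp flip: power_mult_distrib)
      ultimately show "b u ^ N * (coeff (p u) j * ?t ^ j) = coeff (p u) j * ((- 1) ^ j * g u ^ j * b u ^ (N - j))"
        by (simp add: mult_ac)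
    qed simp
    also have "\<dots> = coeff (p u) 0 * b u ^ N
        + (\<Sum>j<N. coeff (p u) (Suc j) * ((- 1) ^ Suc j * g u ^ Suc j * b u ^ (N - Suc j)))"
      by (simp add: sum.atMost_shift)
    also have "(\<Sum>j<N. coeff (p u) (Suc j) * ((- 1) ^ Suc j * g u ^ Suc j * b u ^ (N - Suc j))) = - (g u * K u)"
      unfolding K_def by (simp add: sum_distrib_left sum_negf[symmetric] mult_ac)
    also have "coeff (p u) 0 = G u" using p(3)[of u 0] by (simp add: poly_0_coeff_0)
    finally show ?thesis by (simp add: mult.commute)
  qed
  have "b u ^ N * G u = g u * K u" for u
  proof -
    let ?m = "\<lambda>u. pairing u w1 * ((\<Prod>c\<in>S. pairing u (w2 - c *s w1)) * b u)"
    have mp: "polynomial ?m"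
      by (intro polynomial_mult polynomial_prod polynomial_pairing b_poly)
    have "\<exists>u. ?m u \<noteq> 0"
    proof -
      obtain z where z: "z \<notin> S" "b (B z) \<noteq> 0" "pairing (B z) w1 = 1" "pairing (B z) w2 = z"
        by (rule general_point)
      have "(\<Prod>c\<in>S. pairing (B z) (w2 - c *s w1)) \<noteq> 0" using S(1) z(1,3,4) by auto
      then have "?m (B z) \<noteq> 0" using z(2,3) by simp
      then show ?thesis by blast
    qed
    moreover have mz: "?m u * (b u ^ N * G u - g u * K u) = 0" for u
    proof (cases "?m u = 0")
      case False
      then have "pairing u w1 \<noteq> 0" "(\<Prod>c\<in>S. pairing u (w2 - c *s w1)) \<noteq> 0" "b u \<noteq> 0" by auto
      moreover from this have "pairing u w2 / pairing u w1 \<notin> S"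
      proof -
        have "pairing u (w2 - (pairing u w2 / pairing u w1) *s w1) = 0" using \<open>pairing u w1 \<noteq> 0\<close> by simp
        then show ?thesis using \<open>(\<Prod>c\<in>S. pairing u (w2 - c *s w1)) \<noteq> 0\<close> S(1) by (metis prod_zero)
      qed
      ultimately show ?thesis using bNG by simp
    qed simp
    moreover have dp: "polynomial (\<lambda>u. b u ^ N * G u - g u * K u)"
      by (intro polynomial_diff polynomial_mult polynomial_power b_poly G(1) g_poly K_poly)
    ultimately have "\<forall>u. b u ^ N * G u - g u * K u = 0"
      using polynomial_mult_zero[OF mp dp mz] by blast
    then show ?thesis by simp
  qed
  then have "\<exists>H. polynomial H \<and> (\<forall>u. G u = g u * H u)"
    using K_poly
  proof (induction N arbitrary: K)
    case 0
    then show ?case by auto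
  next
    case (Suc N)
    have "\<exists>H. polynomial H \<and> (\<forall>u. b u ^ N * G u = g u * H u)"
    proof (rule cancel_binary_form[OF g_poly w1nz w2nz Q_nz e(3) _ _ Suc.prems(2)])
      fix r assume r: "poly Q r = 0"
      have "pairing (B r) w1 = 1" "pairing (B r) w2 = r" "pairing (B r) w0 = 0"
        using \<beta>1w \<beta>2w by (simp_all add: B_def)
      moreover from this have "g (B r) = poly P r" using g_eq(1)[of "B r" r] r by simp
      moreover have "poly P r \<noteq> 0" using reduced r by blast
      ultimately show "\<exists>a. pairing a (w2 - r *s w1) = 0 \<and> g a \<noteq> 0"
        by (intro exI[of _ "B r"]) simp
    next
      assume "degree Q < e - 1"
      then have eP: "e = degree P" by (auto simp: e_def)
      have "binary_form w1 w2 P e \<beta>2 = (\<Sum>i\<in>{e}. coeff P i * (pairing \<beta>2 w2 ^ i * pairing \<beta>2 w1 ^ (e - i)))"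
        unfolding binary_form_def using \<beta>2w by (intro sum.mono_neutral_right) (auto simp: power_0_left)
      then have "g \<beta>2 = coeff P e" using \<beta>2w by (simp add: g_def)
      moreover have "coeff P e \<noteq> 0" using eP e(1) by auto
      ultimately show "\<exists>a. pairing a w1 = 0 \<and> g a \<noteq> 0" using \<beta>2w by (intro exI[of _ \<beta>2]) simp
    next
      show "polynomial (\<lambda>u. b u ^ N * G u)" by (intro polynomial_mult polynomial_power b_poly G(1))
      show "binary_form w1 w2 Q (e - 1) u * (b u ^ N * G u) = g u * K u" for u
        using Suc.prems(1)[of u] by (simp add: b_def mult.assoc)
    qed
    then obtain H where "polynomial H" "\<And>u. b u ^ N * G u = g u * H u" by blast
    then show ?case using Suc.IH by blast
  qed
  then show ?thesis by blast
qed

lemma g_ex: "\<exists>u. g u \<noteq> 0"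
proof (rule ccontr)
  assume "\<not> ?thesis"
  then show False using b_ex g_line[of _ 1] by simp
qed

lemma dual_cone_iff: "u \<in> affine_cone (dual_variety X) \<longleftrightarrow> g u = 0"
proof
  assume u: "u \<in> affine_cone (dual_variety X)"
  have "tangent_covectors X \<noteq> {}"
  proof -
    obtain z where z: "z \<notin> bad" using ex_new_if_finite[OF infinite_UNIV_char_0 finite_bad] by blast
    then have "contact z \<in> cone_reg X" "contact z \<noteq> 0" using contact_touches[OF z] by (auto simp: touches_def)
    then have "0 \<in> tangent_covectors X" by (auto simp: tangent_covectors_def)
    then show ?thesis by blast
  qed
  from vanishing_ideal_dual[OF g_poly g_tangent this] show "g u = 0" using vanishing_idealD u by blast
next
  assume g0: "g u = 0"
  show "u \<in> affine_cone (dual_variety X)"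
  proof (cases "u = 0")
    case False
    let ?P = "{vec.span {u} | u. u \<in> tangent_covectors X \<and> u \<noteq> 0}"
    define T where "T = {f. (\<exists>k. homogeneous k f) \<and> (\<forall>p\<in>?P. \<forall>v\<in>p. f v = (0::complex))}"
    have dual: "dual_variety X = proj_zeros T"
      unfolding dual_variety_eq T_def by (rule proj_closure_eq) (auto simp: proj_space_def)
    have "f u = 0" if f: "f \<in> T" for f
    proof -
      obtain k where k: "homogeneous k f" using f by (auto simp: T_def)
      have "f v = 0" if v: "v \<in> tangent_covectors X" "v \<noteq> 0" for v
        using f v vec.span_base[of v "{v}"] by (auto simp: T_def)
      moreover have "f 0 = 0"
      proof -
        have "\<exists>v. v \<in> tangent_covectors X \<and> v \<noteq> 0"
        proof -
          obtain z where z: "z \<notin> S" "b (B z) \<noteq> 0" "pairing (B z) w1 = 1" "pairing (B z) w2 = z"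
            by (rule general_point)
          let ?v = "B z + (- g (B z) / b (B z)) *s \<alpha>"
          have "?v \<in> tangent_covectors X" by (rule shifted_tangent) (use z in simp_all)
          moreover have vw: "pairing ?v w1 = 1" using z(3) \<alpha>w by simp
          moreover have "?v \<noteq> 0"
          proof
            assume "?v = 0"
            then have "pairing ?v w1 = 0" by (simp only: pairing_linear)
            then show False using vw by simp
          qed
          ultimately show ?thesis by blast
        qed
        then obtain v where "v \<in> tangent_covectors X" "v \<noteq> 0" by blast
        then have "f v = 0" using \<open>\<And>v. v \<in> tangent_covectors X \<Longrightarrow> v \<noteq> 0 \<Longrightarrow> f v = 0\<close> by blast
        then show ?thesis using homogeneousD[OF k, of 0 v] by simp
      qed
      ultimately have "\<And>v. v \<in> tangent_covectors X \<Longrightarrow> f v = 0" by metis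
      then obtain H where "f = (\<lambda>u. g u * H u)" using equation_divides[OF homogeneous_imp_polynomial[OF k]] by blast
      then show ?thesis using g0 by simp
    qed
    then have "vec.span {u} \<in> dual_variety X"
      unfolding dual using False by (subst proj_zeros_span_iff) (auto simp: T_def)
    then show ?thesis using vec.span_base[of u "{u}"] by (auto simp: affine_cone_def)
  qed (simp add: affine_cone_def)
qed

lemma dual_equation: "hypersurface_equation (dual_variety X) g"
  unfolding hypersurface_equation_def
proof (intro conjI)
  show "g \<noteq> (\<lambda>_. 0)" using g_ex by auto
  show "\<exists>e>0. homogeneous e g" using e(1) g_hom by blast
  show "dual_variety X = proj_zeros {g}"
  proof (rule set_eqI)
    fix p
    have tc: "{vec.span {u} |u. u \<in> tangent_covectors X \<and> u \<noteq> 0} \<subseteq> proj_space" by (auto simp: proj_space_def)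
    have dual: "dual_variety X \<subseteq> proj_space"
      unfolding dual_variety_eq proj_closure_eq[OF tc] by (rule proj_zeros_subset)
    show "p \<in> dual_variety X \<longleftrightarrow> p \<in> proj_zeros {g}"
    proof (cases "p \<in> proj_space")
      case True
      then obtain u where u: "p = vec.span {u}" "u \<noteq> 0" by (auto simp: proj_space_def)
      show ?thesis
        unfolding u(1) using affine_cone_iff[OF dual u(2)] dual_cone_iff[of u] proj_zeros_span_iff[of "{g}" u] u(2) g_hom by blast
    next
      case False
      then show ?thesis using dual proj_zeros_subset by blast
    qed
  qed
  show "vanishing_ideal (dual_variety X) = {\<lambda>x. g x * h x |h. polynomial h}"
  proof (intro set_eqI iffI)
    fix f assume f: "f \<in> vanishing_ideal (dual_variety X)"
    have "f u = 0" if "u \<in> tangent_covectors X" for u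
      using vanishing_idealD[OF f tangent_covectors_subset_dual[OF that]] .
    then show "f \<in> {\<lambda>x. g x * h x |h. polynomial h}"
      using equation_divides[OF vanishing_ideal_polynomial[OF f]] by blast
  next
    fix f assume "f \<in> {\<lambda>x. g x * h x |h. polynomial h}"
    then show "f \<in> vanishing_ideal (dual_variety X)"
      using dual_cone_iff g_poly by (auto simp: vanishing_ideal_def intro: polynomial_mult)
  qed
qed

lemma dual_equation_order: "vanishing_order g \<alpha> = e - 1"
proof -
  define p where "p v = monom (g v) e + monom (b v) (e - 1)" for v
  have "poly (p v) t = g (\<alpha> + t *s v)" for v t
  proof -
    obtain p' where p': "\<And>t. poly p' t = g (\<alpha> + t *s v)" using polynomial_on_line[OF g_poly] by blast
    have "poly (p v - p') t = 0" if t: "t \<noteq> 0" for t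
    proof -
      have eq: "\<alpha> + t *s v = t *s (v + (1 / t) *s \<alpha>)" using t by (simp add: vector_add_ldistrib add.commute)
      have "g (\<alpha> + t *s v) = t ^ e * (g v + (1 / t) * b v)"
        unfolding eq homogeneousD[OF g_hom] g_line by simp
      moreover have "t ^ e * ((1 / t) * b v) = b v * t ^ (e - 1)"
        using t power_minus_mult[OF e(1), of t, symmetric] by simp
      ultimately show ?thesis by (simp add: p_def p' poly_monom distrib_left)
    qed
    then have "p v - p' = 0" by (rule poly_zero_if_zero_off_0)
    then show ?thesis using p' by simp
  qed
  then have "vanishing_order g \<alpha> = (LEAST k. \<exists>v. coeff (p v) k \<noteq> 0)" by (rule vanishing_order_eq_Least)
  also have "\<dots> = e - 1"
  proof (rule Least_equality)
    show "\<exists>v. coeff (p v) (e - 1) \<noteq> 0" using b_ex e(1) by (auto simp: p_def)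
    fix k assume "\<exists>v. coeff (p v) k \<noteq> 0"
    then show "e - 1 \<le> k" by (auto simp: p_def coeff_monom split: if_splits)
  qed
  finally show ?thesis .
qed
end

lemma MLD_1_imp_dual_equation:
  fixes X :: "(complex ^ 'n) set set"
  assumes X: "irreducible_curve X" and deg: "curve_degree X > 1"
    and F: "homogeneous d F" "d > 0" and MLD: "MLD F X = 1"
  obtains \<alpha> g e where "proj_span_dim X = 2" "\<alpha> \<noteq> 0" "(\<lambda>x. F x - pairing \<alpha> x ^ d) \<in> vanishing_ideal X"
    "hypersurface_equation (dual_variety X) g" "homogeneous e g" "e > 0" "vanishing_order g \<alpha> = e - 1"
proof -
  obtain \<alpha> x0 where \<alpha>: "\<And>x. x \<in> affine_cone X \<Longrightarrow> F x = pairing \<alpha> x ^ d"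
    "x0 \<in> cone_reg X" "pairing \<alpha> x0 \<noteq> 0" and dim3: "vec.dim (vec.span (affine_cone X)) = 3"
    using MLD_1_imp_power_of_linear_form[OF X deg F MLD] by blast
  obtain q where q: "polynomial q" "q \<noteq> (\<lambda>_. 0)" "\<And>u. q u \<noteq> 0 \<Longrightarrow> \<exists>!x. (x, u) \<in> crit_incidence F X"
    using MLD_eq_1D[OF MLD] by blast
  have x0C: "x0 \<in> affine_cone X" using \<alpha>(2) cone_reg_iff[OF X] by blast
  interpret power_on_plane_curve X F \<alpha> d
    by unfold_locales (use X dim3 F \<alpha> x0C in blast)+
  obtain w where w: "w \<in> vec.span (affine_cone X)" "pairing \<alpha> w = 0" "w \<noteq> 0" using direction_exists .
  obtain y where y: "pairing y w \<noteq> 0" using pairing_nonzero[OF w(3)] by (metis zero_neq_one)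
  have "\<exists>\<beta>1. q \<beta>1 * pairing \<beta>1 w \<noteq> 0"
    using polynomial_mult_zero[OF q(1), of "\<lambda>u. pairing u w"] q(2) y by auto
  then obtain \<beta>1 where \<beta>1: "q \<beta>1 \<noteq> 0" "pairing \<beta>1 w \<noteq> 0" by auto
  have "\<exists>x\<in>vec.span (affine_cone X). pairing \<beta>1 x \<noteq> c * pairing \<alpha> x" for c
    using w \<beta>1(2) by (intro bexI[of _ w]) auto
  then obtain \<beta>2 w0 w1 w2 where "w0 \<in> vec.span (affine_cone X)" "w1 \<in> vec.span (affine_cone X)" "w2 \<in> vec.span (affine_cone X)"
    "pairing \<alpha> w0 = 1" "pairing \<alpha> w1 = 0" "pairing \<alpha> w2 = 0"
    "pairing \<beta>1 w0 = 0" "pairing \<beta>1 w1 = 1" "pairing \<beta>1 w2 = 0"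
    "pairing \<beta>2 w0 = 0" "pairing \<beta>2 w1 = 0" "pairing \<beta>2 w2 = 1"
    "\<And>x. x \<in> vec.span (affine_cone X) \<Longrightarrow> x = pairing \<beta>1 x *s w1 + pairing \<beta>2 x *s w2 + pairing \<alpha> x *s w0"
    using plane_coordinates[OF vec.subspace_span dim3 vec.span_base[OF x0C] \<alpha>(3), of \<beta>1] by metis
  then interpret unique_critical_points X F \<alpha> d q \<beta>1 \<beta>2 w0 w1 w2
    by unfold_locales (use deg q(1,3) \<beta>1(1) in blast)+
  obtain P Q S where PQ: "Q \<noteq> 0" "finite S" "bad \<subseteq> S" "\<And>z. z \<notin> S \<Longrightarrow> offset z * poly Q z = - poly P z"
    "\<And>r. poly P r = 0 \<Longrightarrow> poly Q r \<noteq> 0"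
    by (rule offset_rational) (rule that)
  interpret offset_fraction X F \<alpha> d q \<beta>1 \<beta>2 w0 w1 w2 P Q S
    by unfold_locales (use PQ in blast)+
  have "(\<lambda>x. F x - pairing \<alpha> x ^ d) \<in> vanishing_ideal X"
    using \<alpha>(1) homogeneous_imp_polynomial[OF F(1)] by (auto simp: vanishing_ideal_def intro!: polynomial_diff polynomial_power)
  moreover have "\<alpha> \<noteq> 0" using \<alpha>(3) by auto
  moreover have "proj_span_dim X = 2" using dim3 by (simp add: proj_span_dim_def)
  ultimately show thesis using that dual_equation g_hom e(1) dual_equation_order by blast
qed

theorem theorem1p2:
  fixes X :: "(complex ^ 'n) set set"
    and F :: "complex ^ 'n \<Rightarrow> complex"
    and d :: nat
  assumes "irreducible_curve X"
    and "curve_degree X > 1"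
    and "homogeneous d F"
    and "d > 0"
    and "\<exists>x\<in>affine_cone X. F x \<noteq> 0"
  shows
    "(MLD F X = 1 \<longleftrightarrow>
        proj_span_dim X = 2 \<and>
        (\<exists>\<alpha>. \<alpha> \<noteq> 0 \<and>
           int (hypersurface_mult \<alpha> (dual_variety X))
             = int (hypersurface_degree (dual_variety X)) - 1 \<and>
           (\<lambda>x. F x - pairing \<alpha> x ^ d) \<in> vanishing_ideal X)) \<and>
     (MLD F X = 1 \<longrightarrow>
        (\<exists>g. hypersurface_equation (dual_variety X) g) \<and>
        (\<forall>\<alpha> g.
           \<alpha> \<noteq> 0 \<and>
           int (hypersurface_mult \<alpha> (dual_variety X))
             = int (hypersurface_degree (dual_variety X)) - 1 \<and>
           (\<lambda>x. F x - pairing \<alpha> x ^ d) \<in> vanishing_ideal X \<and>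
           hypersurface_equation (dual_variety X) g \<longrightarrow>
           (let \<Psi> = (\<lambda>u. of_nat d ^ d * pairing \<alpha> (log_gradient g u) ^ d) in
              homaloidal_solution_of F X \<Psi> \<and>
              (\<forall>\<Phi>. homaloidal_solution_of F X \<Phi> \<longrightarrow> generically (\<lambda>u. \<Phi> u = \<Psi> u)))))"
proof -
  let ?Y = "dual_variety X"
  let ?cond = "\<lambda>\<alpha>. int (hypersurface_mult \<alpha> ?Y) = int (hypersurface_degree ?Y) - 1 \<and>
    (\<lambda>x. F x - pairing \<alpha> x ^ d) \<in> vanishing_ideal X"
  have forward: "proj_span_dim X = 2 \<and> (\<exists>\<alpha>. \<alpha> \<noteq> 0 \<and> ?cond \<alpha>) \<and> (\<exists>g. hypersurface_equation ?Y g)" if MLD: "MLD F X = 1"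
  proof -
    obtain \<alpha> g e where g: "proj_span_dim X = 2" "\<alpha> \<noteq> 0" "(\<lambda>x. F x - pairing \<alpha> x ^ d) \<in> vanishing_ideal X"
      "hypersurface_equation ?Y g" "homogeneous e g" "e > 0" "vanishing_order g \<alpha> = e - 1"
      using MLD_1_imp_dual_equation[OF assms(1-4) MLD] by blast
    have "hypersurface_mult \<alpha> ?Y = e - 1" "hypersurface_degree ?Y = e"
      using hypersurface_mult_eq[OF g(4)] g(7) hypersurface_degree_eq[OF g(4,5)] by simp_all
    then have "?cond \<alpha>" using g(3,6) by simp
    then show ?thesis using g(1,2,4) by blast
  qed
  have backward: "MLD F X = 1 \<and> homaloidal_solution_of F X (\<lambda>u. of_nat d ^ d * pairing \<alpha> (log_gradient g u) ^ d) \<and>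
      (\<forall>\<Phi>. homaloidal_solution_of F X \<Phi> \<longrightarrow>
        generically (\<lambda>u. \<Phi> u = of_nat d ^ d * pairing \<alpha> (log_gradient g u) ^ d))"
    if span: "proj_span_dim X = 2" and cond: "?cond \<alpha>" and eq: "hypersurface_equation ?Y g" for \<alpha> g
  proof -
    have c1: "int (hypersurface_mult \<alpha> ?Y) = int (hypersurface_degree ?Y) - 1"
      and c2: "(\<lambda>x. F x - pairing \<alpha> x ^ d) \<in> vanishing_ideal X" using cond by blast+
    obtain e where "linear_dual_equation X F \<alpha> d g e"
      by (rule linear_dual_equationI[OF assms(1) span assms(3-5) c1 c2 eq]) (rule that)
    then interpret linear_dual_equation X F \<alpha> d g e .
    show ?thesis
      using MLD_eq_1 Psi_solution unfolding \<Psi>_def[abs_def] by blast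
  qed
  have "\<exists>g. hypersurface_equation ?Y g" if "?cond \<alpha>" for \<alpha>
    using hypersurface_equation_if_mult[of \<alpha> ?Y] that by blast
  then show ?thesis
    using forward backward unfolding Let_def by blast
qed

end
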